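(* Let $\mathbf{k}$ be a field, let $\phi : B\to B'$ be a morphism of $\mathbf{k}$-bialgebras, let $(E,\rho)$ be a right $B$-comodule algebra, let $(E',\rho')$ be a right $B'$-comodule algebra, and let $f:E\to E'$ be a map of comodule algebras over $\phi$. Let $\mathbf{G}_E$ and $\mathbf{G}_{E'}$ be the comonads for relative Hopf modules on ${}_E\mathcal{M}$ and ${}_{E'}\mathcal{M}$. Then there is a natural transformation $\alpha_B: f^*\circ G_E\Rightarrow G_{E'}\circ f^*$, whose components (after the canonical identification $B'\otimes_B B\cong B'$) are $$E'\otimes_E(M\otimes B)\to(E'\otimes_E M)\otimes B',\qquad e'\otimes_E(m\otimes b)\mapsto\sum(e'_{(0)}\otimes_E m)\otimes e'_{(1)}\phi(b),$$ and it is a morphism of comonads, i.e. $(f^*,\alpha_B):({}_E\mathcal{M},\mathbf{G}_E)\to({}_{E'}\mathcal{M},\mathbf{G}_{E'})$ satisfies $$(\delta_{E'}f^* )\circ\alpha_B=(G_{E'}\alpha_B)\circ(\alpha_B G_E)\circ(f^*\delta_E),\qquad (\epsilon_{E'}f^* )\circ\alpha_B=f^*\epsilon_E .$$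
   Context: Algebras are associative and unital; unadorned $\otimes$ is over $\mathbf{k}$. ${}_R\mathcal{M}$ denotes the category of left $R$-modules. A right $B$-comodule algebra is an algebra $E$ with a right $B$-coaction $\rho:E\to E\otimes B$ that is an algebra map; write $\rho(e)=\sum e_{(0)}\otimes e_{(1)}$. A map of comodule algebras over $\phi$ is an algebra map $f:E\to E'$ with $\rho'\circ f=(f\otimes\phi)\circ\rho$. Extension of scalars is $f^*M=E'\otimes_E M$. The comonad for relative Hopf modules $\mathbf{G}_E=(G_E,\delta_E,\epsilon_E)$ on ${}_E\mathcal{M}$: $G_E M=M\otimes B$ with $E$-action $e(m\otimes b)=\sum e_{(0)}m\otimes e_{(1)}b$, comultiplication $\delta_E=\mathrm{id}\otimes\Delta_B$ and counit $\epsilon_E=\mathrm{id}\otimes\epsilon_B$. $\mathbf{G}_{E'}$ is defined in the same way using $B'$ and $\rho'$. The transformation $\alpha_B$ is the component at $Q=B$ of the natural transformation with components $E'\otimes_E(M\otimes Q)\to(E'\otimes_E M)\otimes(B'\otimes_B Q)$, $e'\otimes_E(m\otimes q)\mapsto\sum(e'_{(0)}\otimes_E m)\otimes(e'_{(1)}\otimes_B q)$, for $M\in{}_E\mathcal{M}$, $Q\in{}_B\mathcal{M}$. *)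

theory Defs
  imports "HOL-Algebra.Module" "HOL-Algebra.Generated_Groups" "HOL-Algebra.Free_Abelian_Groups"
begin

section \<open>Modules and algebras\<close>

text \<open>
  The library locale \<^locale>\<open>module\<close> requires a commutative ring of scalars. Throughout, the fields
  \<^const>\<open>monoid.mult\<close> and \<^const>\<open>monoid.one\<close> of a record that is only used as a module carry no
  meaning.
\<close>

locale left_module = R?: ring R + M?: abelian_group M
  for R :: "('r, 'p) ring_scheme" (structure) and M :: "('r, 'm, 'q) module_scheme" (structure) +
  assumes smult_closed: "a \<in> carrier R \<Longrightarrow> x \<in> carrier M \<Longrightarrow> a \<odot>\<^bsub>M\<^esub> x \<in> carrier M"
    and smult_l_distr: "a \<in> carrier R \<Longrightarrow> b \<in> carrier R \<Longrightarrow> x \<in> carrier M \<Longrightarrow>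
      (a \<oplus>\<^bsub>R\<^esub> b) \<odot>\<^bsub>M\<^esub> x = a \<odot>\<^bsub>M\<^esub> x \<oplus>\<^bsub>M\<^esub> b \<odot>\<^bsub>M\<^esub> x"
    and smult_r_distr: "a \<in> carrier R \<Longrightarrow> x \<in> carrier M \<Longrightarrow> y \<in> carrier M \<Longrightarrow>
      a \<odot>\<^bsub>M\<^esub> (x \<oplus>\<^bsub>M\<^esub> y) = a \<odot>\<^bsub>M\<^esub> x \<oplus>\<^bsub>M\<^esub> a \<odot>\<^bsub>M\<^esub> y"
    and smult_assoc: "a \<in> carrier R \<Longrightarrow> b \<in> carrier R \<Longrightarrow> x \<in> carrier M \<Longrightarrow>
      (a \<otimes>\<^bsub>R\<^esub> b) \<odot>\<^bsub>M\<^esub> x = a \<odot>\<^bsub>M\<^esub> (b \<odot>\<^bsub>M\<^esub> x)"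
    and smult_one: "x \<in> carrier M \<Longrightarrow> \<one>\<^bsub>R\<^esub> \<odot>\<^bsub>M\<^esub> x = x"

text \<open>Morphisms of the category of left \<open>R\<close>-modules; source and target are required to be objects.\<close>

definition left_module_hom ::
  "('r, 'p) ring_scheme \<Rightarrow> ('r, 'm, 'q) module_scheme \<Rightarrow> ('r, 'n, 's) module_scheme \<Rightarrow> ('m \<Rightarrow> 'n) \<Rightarrow> bool"
  where "left_module_hom R M N h \<longleftrightarrow>
    left_module R M \<and> left_module R N \<and> h \<in> carrier M \<rightarrow> carrier N \<and>
    (\<forall>x \<in> carrier M. \<forall>y \<in> carrier M. h (x \<oplus>\<^bsub>M\<^esub> y) = h x \<oplus>\<^bsub>N\<^esub> h y) \<and>
    (\<forall>a \<in> carrier R. \<forall>x \<in> carrier M. h (a \<odot>\<^bsub>M\<^esub> x) = a \<odot>\<^bsub>N\<^esub> h x)"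

text \<open>The library locale \<^locale>\<open>algebra\<close> is restricted to commutative algebras.\<close>

locale assoc_algebra = module K A + A?: ring A
  for K :: "('k, 'p) ring_scheme" (structure) and A :: "('k, 'a, 'q) module_scheme" (structure) +
  assumes smult_mult_left: "c \<in> carrier K \<Longrightarrow> x \<in> carrier A \<Longrightarrow> y \<in> carrier A \<Longrightarrow>
      (c \<odot>\<^bsub>A\<^esub> x) \<otimes>\<^bsub>A\<^esub> y = c \<odot>\<^bsub>A\<^esub> (x \<otimes>\<^bsub>A\<^esub> y)"
    and smult_mult_right: "c \<in> carrier K \<Longrightarrow> x \<in> carrier A \<Longrightarrow> y \<in> carrier A \<Longrightarrow>
      x \<otimes>\<^bsub>A\<^esub> (c \<odot>\<^bsub>A\<^esub> y) = c \<odot>\<^bsub>A\<^esub> (x \<otimes>\<^bsub>A\<^esub> y)"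

definition alg_hom ::
  "('k, 'p) ring_scheme \<Rightarrow> ('k, 'a, 'q) module_scheme \<Rightarrow> ('k, 'c, 's) module_scheme \<Rightarrow> ('a \<Rightarrow> 'c) set"
  where "alg_hom K A C =
    {h \<in> ring_hom A C. \<forall>c \<in> carrier K. \<forall>x \<in> carrier A. h (c \<odot>\<^bsub>A\<^esub> x) = c \<odot>\<^bsub>C\<^esub> h x}"

definition regular :: "('a, 'p) ring_scheme \<Rightarrow> ('a, 'a) module"
  where "regular A = \<lparr>carrier = carrier A, monoid.mult = monoid.mult A, one = one A,
    ring.zero = ring.zero A, ring.add = ring.add A, smult = monoid.mult A\<rparr>"

text \<open>The vector space underlying a left module \<open>M\<close> over a \<open>K\<close>-algebra \<open>A\<close>.\<close>

definition vs_of :: "('k, 'a, 'p) module_scheme \<Rightarrow> ('a, 'm, 'q) module_scheme \<Rightarrow> ('k, 'm) module"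
  where "vs_of A M = \<lparr>carrier = carrier M, monoid.mult = monoid.mult M, one = one M,
    ring.zero = ring.zero M, ring.add = ring.add M, smult = (\<lambda>c m. (c \<odot>\<^bsub>A\<^esub> \<one>\<^bsub>A\<^esub>) \<odot>\<^bsub>M\<^esub> m)\<rparr>"


section \<open>Tensor products\<close>

type_synonym ('x, 'y) tensor = "('x \<times> 'y \<Rightarrow>\<^sub>0 int) set"

text \<open>
  The tensor product of a right \<open>R\<close>-module \<open>X\<close> and a left \<open>R\<close>-module \<open>Y\<close>, as an abelian group: the
  free abelian group on pairs modulo the usual relations. A right module is given as a module
  record whose scalar multiplication \<open>r \<odot>\<^bsub>X\<^esub> x\<close> means \<open>x \<cdot> r\<close>.
\<close>

definition tensor_relations ::
  "('r, 'p) ring_scheme \<Rightarrow> ('r, 'x, 'q) module_scheme \<Rightarrow> ('r, 'y, 's) module_scheme \<Rightarrow>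
    ('x \<times> 'y \<Rightarrow>\<^sub>0 int) set"
  where "tensor_relations R X Y =
    {frag_of (x \<oplus>\<^bsub>X\<^esub> x', y) - frag_of (x, y) - frag_of (x', y) | x x' y.
      x \<in> carrier X \<and> x' \<in> carrier X \<and> y \<in> carrier Y} \<union>
    {frag_of (x, y \<oplus>\<^bsub>Y\<^esub> y') - frag_of (x, y) - frag_of (x, y') | x y y'.
      x \<in> carrier X \<and> y \<in> carrier Y \<and> y' \<in> carrier Y} \<union>
    {frag_of (r \<odot>\<^bsub>X\<^esub> x, y) - frag_of (x, r \<odot>\<^bsub>Y\<^esub> y) | r x y.
      r \<in> carrier R \<and> x \<in> carrier X \<and> y \<in> carrier Y}"

definition tensor_group ::
  "('r, 'p) ring_scheme \<Rightarrow> ('r, 'x, 'q) module_scheme \<Rightarrow> ('r, 'y, 's) module_scheme \<Rightarrow>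
    ('x, 'y) tensor monoid"
  where "tensor_group R X Y =
    (let F = free_Abelian_group (carrier X \<times> carrier Y)
     in F Mod generate F (tensor_relations R X Y))"

definition tensor ::
  "('r, 'p) ring_scheme \<Rightarrow> ('r, 'x, 'q) module_scheme \<Rightarrow> ('r, 'y, 's) module_scheme \<Rightarrow>
    ('x, 'y) tensor ring"
  where "tensor R X Y =
    \<lparr>carrier = carrier (tensor_group R X Y), monoid.mult = undefined, one = undefined,
     ring.zero = one (tensor_group R X Y), ring.add = monoid.mult (tensor_group R X Y)\<rparr>"

text \<open>
  For \<open>T\<close> a tensor product of \<open>X\<close> and \<open>Y\<close>, the element \<open>x \<otimes> y\<close> is the class in \<open>T\<close> of the pair
  \<open>(x, y)\<close>.
\<close>

definition pure_tensor :: "(('x, 'y) tensor, 'p) ring_scheme \<Rightarrow> 'x \<Rightarrow> 'y \<Rightarrow> ('x, 'y) tensor"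
  where "pure_tensor T x y = (THE t. t \<in> carrier T \<and> frag_of (x, y) \<in> t)"

text \<open>
  For a balanced biadditive map \<open>\<beta>\<close> into an abelian group \<open>A\<close>, \<open>tensor_lift A \<beta>\<close> is the induced
  additive map, i.e. \<open>\<beta>\<close> evaluated on an arbitrary formal sum representing \<open>t\<close>.
\<close>

definition tensor_lift :: "('a, 'p) ring_scheme \<Rightarrow> ('x \<Rightarrow> 'y \<Rightarrow> 'a) \<Rightarrow> ('x, 'y) tensor \<Rightarrow> 'a"
  where "tensor_lift A \<beta> t =
    (let c = (SOME c. c \<in> t)
     in \<Oplus>\<^bsub>A\<^esub>p \<in> Poly_Mapping.keys c. [Poly_Mapping.lookup c p] \<cdot>\<^bsub>A\<^esub> \<beta> (fst p) (snd p))"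

text \<open>The map \<open>g \<otimes> h\<close> with values in a tensor product \<open>T\<close>.\<close>

definition tensor_map ::
  "(('u, 'v) tensor, 'p) ring_scheme \<Rightarrow> ('x \<Rightarrow> 'u) \<Rightarrow> ('y \<Rightarrow> 'v) \<Rightarrow> ('x, 'y) tensor \<Rightarrow> ('u, 'v) tensor"
  where "tensor_map T g h = tensor_lift T (\<lambda>x y. pure_tensor T (g x) (h y))"

text \<open>
  Tensor products over the field \<open>K\<close>, with their vector space structure and the componentwise
  multiplication. The latter is meaningful if both factors are algebras.
\<close>

definition tensor_K ::
  "('k, 'p) ring_scheme \<Rightarrow> ('k, 'x, 'q) module_scheme \<Rightarrow> ('k, 'y, 's) module_scheme \<Rightarrow>
    ('k, ('x, 'y) tensor) module"
  where "tensor_K K X Y =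
    (let T = tensor K X Y
     in \<lparr>carrier = carrier T,
         monoid.mult = (\<lambda>s t. tensor_lift T (\<lambda>a b.
           tensor_lift T (\<lambda>c d. pure_tensor T (a \<otimes>\<^bsub>X\<^esub> c) (b \<otimes>\<^bsub>Y\<^esub> d)) t) s),
         one = pure_tensor T \<one>\<^bsub>X\<^esub> \<one>\<^bsub>Y\<^esub>, ring.zero = ring.zero T, ring.add = ring.add T,
         smult = (\<lambda>c. tensor_map T (\<lambda>x. c \<odot>\<^bsub>X\<^esub> x) (\<lambda>y. y))\<rparr>)"

text \<open>
  The canonical map \<open>X \<otimes> (Y \<otimes> Z) \<rightarrow> (X \<otimes> Y) \<otimes> Z\<close>, where \<open>S\<close> is \<open>X \<otimes> Y\<close> and \<open>T\<close> is
  \<open>(X \<otimes> Y) \<otimes> Z\<close>.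
\<close>

definition tensor_assoc ::
  "(('x, 'y) tensor, 'p) ring_scheme \<Rightarrow> ((('x, 'y) tensor, 'z) tensor, 'q) ring_scheme \<Rightarrow>
    ('x, ('y, 'z) tensor) tensor \<Rightarrow> (('x, 'y) tensor, 'z) tensor"
  where "tensor_assoc S T =
    tensor_lift T (\<lambda>x. tensor_lift T (\<lambda>y z. pure_tensor T (pure_tensor S x y) z))"


section \<open>Bialgebras and comodule algebras\<close>

record ('k, 'b) bialg = "('k, 'b) module" +
  comult :: "'b \<Rightarrow> ('b, 'b) tensor"
  counit :: "'b \<Rightarrow> 'k"

locale bialgebra = assoc_algebra K B
  for K :: "('k, 'p) ring_scheme" (structure) and B :: "('k, 'b) bialg" (structure) +
  assumes comult_hom: "comult B \<in> alg_hom K B (tensor_K K B B)"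
    and counit_hom: "counit B \<in> alg_hom K B (regular K)"
    and coassoc: "b \<in> carrier B \<Longrightarrow>
      (let T = tensor_K K (tensor_K K B B) B
       in tensor_assoc (tensor_K K B B) T
            (tensor_map (tensor_K K B (tensor_K K B B)) (\<lambda>x. x) (comult B) (comult B b)) =
          tensor_map T (comult B) (\<lambda>x. x) (comult B b))"
    and counit_left: "b \<in> carrier B \<Longrightarrow>
      tensor_lift B (\<lambda>x y. counit B x \<odot>\<^bsub>B\<^esub> y) (comult B b) = b"
    and counit_right: "b \<in> carrier B \<Longrightarrow>
      tensor_lift B (\<lambda>x y. counit B y \<odot>\<^bsub>B\<^esub> x) (comult B b) = b"

definition bialg_hom ::
  "('k, 'p) ring_scheme \<Rightarrow> ('k, 'b) bialg \<Rightarrow> ('k, 'c) bialg \<Rightarrow> ('b \<Rightarrow> 'c) set"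
  where "bialg_hom K B B' =
    {\<phi> \<in> alg_hom K B B'. \<forall>b \<in> carrier B.
      comult B' (\<phi> b) = tensor_map (tensor_K K B' B') \<phi> \<phi> (comult B b) \<and>
      counit B' (\<phi> b) = counit B b}"

record ('k, 'b, 'e) comod_alg = "('k, 'e) module" +
  coact :: "'e \<Rightarrow> ('e, 'b) tensor"

locale comodule_algebra = assoc_algebra K E
  for K :: "('k, 'p) ring_scheme" (structure) and B :: "('k, 'b) bialg"
    and E :: "('k, 'b, 'e) comod_alg" (structure) +
  assumes coact_hom: "coact E \<in> alg_hom K E (tensor_K K E B)"
    and coact_coassoc: "e \<in> carrier E \<Longrightarrow>
      (let T = tensor_K K (tensor_K K E B) B
       in tensor_assoc (tensor_K K E B) T
            (tensor_map (tensor_K K E (tensor_K K B B)) (\<lambda>x. x) (comult B) (coact E e)) =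
          tensor_map T (coact E) (\<lambda>x. x) (coact E e))"
    and coact_counit: "e \<in> carrier E \<Longrightarrow>
      tensor_lift E (\<lambda>x y. counit B y \<odot>\<^bsub>E\<^esub> x) (coact E e) = e"

definition comod_alg_hom ::
  "('k, 'p) ring_scheme \<Rightarrow> ('b \<Rightarrow> 'c) \<Rightarrow> ('k, 'c) bialg \<Rightarrow>
    ('k, 'b, 'e) comod_alg \<Rightarrow> ('k, 'c, 'd) comod_alg \<Rightarrow> ('e \<Rightarrow> 'd) set"
  where "comod_alg_hom K \<phi> B' E E' =
    {f \<in> alg_hom K E E'. \<forall>e \<in> carrier E.
      coact E' (f e) = tensor_map (tensor_K K E' B') f \<phi> (coact E e)}"


section \<open>Extension of scalars\<close>

text \<open>\<open>E'\<close> as a right module over the domain of \<open>f\<close>.\<close>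

definition right_via :: "('e \<Rightarrow> 'd) \<Rightarrow> ('d, 'p) ring_scheme \<Rightarrow> ('e, 'd) module"
  where "right_via f E' = \<lparr>carrier = carrier E', monoid.mult = monoid.mult E', one = one E',
    ring.zero = ring.zero E', ring.add = ring.add E', smult = (\<lambda>e x. x \<otimes>\<^bsub>E'\<^esub> f e)\<rparr>"

definition ext_scalars ::
  "('e, 'p) ring_scheme \<Rightarrow> ('d, 'q) ring_scheme \<Rightarrow> ('e \<Rightarrow> 'd) \<Rightarrow> ('e, 'm, 's) module_scheme \<Rightarrow>
    ('d, ('d, 'm) tensor) module"
  where "ext_scalars E E' f M =
    (let T = tensor E (right_via f E') M
     in \<lparr>carrier = carrier T, monoid.mult = undefined, one = undefined,
         ring.zero = ring.zero T, ring.add = ring.add T,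
         smult = (\<lambda>a. tensor_map T (\<lambda>x. a \<otimes>\<^bsub>E'\<^esub> x) (\<lambda>m. m))\<rparr>)"

text \<open>The map \<open>f\<^sup>*h\<close> for \<open>h : M \<rightarrow> N\<close>.\<close>

definition ext_scalars_map ::
  "('e, 'p) ring_scheme \<Rightarrow> ('d, 'q) ring_scheme \<Rightarrow> ('e \<Rightarrow> 'd) \<Rightarrow> ('e, 'n, 's) module_scheme \<Rightarrow>
    ('m \<Rightarrow> 'n) \<Rightarrow> ('d, 'm) tensor \<Rightarrow> ('d, 'n) tensor"
  where "ext_scalars_map E E' f N h = tensor_map (ext_scalars E E' f N) (\<lambda>x. x) h"


section \<open>The comonad for relative Hopf modules\<close>

text \<open>The \<open>E\<close>-module \<open>M \<otimes> Q\<close> for a left \<open>E\<close>-module \<open>M\<close> and a left \<open>B\<close>-module \<open>Q\<close>.\<close>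

definition hopf_tensor ::
  "('k, 'p) ring_scheme \<Rightarrow> ('k, 'b) bialg \<Rightarrow> ('k, 'b, 'e) comod_alg \<Rightarrow>
    ('e, 'm, 's) module_scheme \<Rightarrow> ('b, 'q, 't) module_scheme \<Rightarrow> ('e, ('m, 'q) tensor) module"
  where "hopf_tensor K B E M Q =
    (let T = tensor K (vs_of E M) (vs_of B Q)
     in \<lparr>carrier = carrier T, monoid.mult = undefined, one = undefined,
         ring.zero = ring.zero T, ring.add = ring.add T,
         smult = (\<lambda>e t. tensor_lift T
           (\<lambda>x y. tensor_map T (\<lambda>m. x \<odot>\<^bsub>M\<^esub> m) (\<lambda>q. y \<odot>\<^bsub>Q\<^esub> q) t) (coact E e))\<rparr>)"

definition hopf_G ::
  "('k, 'p) ring_scheme \<Rightarrow> ('k, 'b) bialg \<Rightarrow> ('k, 'b, 'e) comod_alg \<Rightarrow>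
    ('e, 'm, 's) module_scheme \<Rightarrow> ('e, ('m, 'b) tensor) module"
  where "hopf_G K B E M = hopf_tensor K B E M (regular B)"

text \<open>The map \<open>G\<^sub>E h\<close> for \<open>h : M \<rightarrow> N\<close>.\<close>

definition hopf_G_map ::
  "('k, 'p) ring_scheme \<Rightarrow> ('k, 'b) bialg \<Rightarrow> ('k, 'b, 'e) comod_alg \<Rightarrow>
    ('e, 'n, 's) module_scheme \<Rightarrow> ('m \<Rightarrow> 'n) \<Rightarrow> ('m, 'b) tensor \<Rightarrow> ('n, 'b) tensor"
  where "hopf_G_map K B E N h = tensor_map (hopf_G K B E N) h (\<lambda>b. b)"

text \<open>
  \<open>id \<otimes> \<Delta>\<close> lands in \<open>M \<otimes> (B \<otimes> B)\<close>, which is identified with \<open>(M \<otimes> B) \<otimes> B\<close>; likewise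
  \<open>M \<otimes> K\<close> is identified with \<open>M\<close> in the counit.
\<close>

definition hopf_delta ::
  "('k, 'p) ring_scheme \<Rightarrow> ('k, 'b) bialg \<Rightarrow> ('k, 'b, 'e) comod_alg \<Rightarrow>
    ('e, 'm, 's) module_scheme \<Rightarrow> ('m, 'b) tensor \<Rightarrow> (('m, 'b) tensor, 'b) tensor"
  where "hopf_delta K B E M t =
    tensor_assoc (hopf_G K B E M) (hopf_G K B E (hopf_G K B E M))
      (tensor_map (tensor_K K (vs_of E M) (tensor_K K B B)) (\<lambda>m. m) (comult B) t)"

definition hopf_epsilon ::
  "('k, 'b) bialg \<Rightarrow> ('k, 'b, 'e) comod_alg \<Rightarrow> ('e, 'm, 's) module_scheme \<Rightarrow>
    ('m, 'b) tensor \<Rightarrow> 'm"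
  where "hopf_epsilon B E M = tensor_lift M (\<lambda>m b. counit B b \<odot>\<^bsub>vs_of E M\<^esub> m)"


section \<open>The transformation \<open>\<alpha>\<close>\<close>

text \<open>
  The component at \<open>(M, Q)\<close>. The innermost lift is the sum over \<open>\<rho>'(e')\<close>.
\<close>

definition alpha ::
  "('k, 'p) ring_scheme \<Rightarrow> ('k, 'b) bialg \<Rightarrow> ('k, 'c) bialg \<Rightarrow>
    ('k, 'b, 'e) comod_alg \<Rightarrow> ('k, 'c, 'd) comod_alg \<Rightarrow> ('b \<Rightarrow> 'c) \<Rightarrow> ('e \<Rightarrow> 'd) \<Rightarrow>
    ('e, 'm, 's) module_scheme \<Rightarrow> ('b, 'q, 't) module_scheme \<Rightarrow>
    ('d, ('m, 'q) tensor) tensor \<Rightarrow> (('d, 'm) tensor, ('c, 'q) tensor) tensor"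
  where "alpha K B B' E E' \<phi> f M Q =
    (let EM = ext_scalars E E' f M; BQ = ext_scalars B B' \<phi> Q; T = hopf_tensor K B' E' EM BQ
     in tensor_lift T (\<lambda>e'. tensor_lift T (\<lambda>m q.
          tensor_lift T (\<lambda>x y. pure_tensor T (pure_tensor EM x m) (pure_tensor BQ y q))
            (coact E' e'))))"

text \<open>The identification of \<open>B' \<otimes>\<^sub>B B\<close> with \<open>B'\<close>.\<close>

definition unitor :: "('k, 'c) bialg \<Rightarrow> ('b \<Rightarrow> 'c) \<Rightarrow> ('c, 'b) tensor \<Rightarrow> 'c"
  where "unitor B' \<phi> = tensor_lift B' (\<lambda>b' b. b' \<otimes>\<^bsub>B'\<^esub> \<phi> b)"

definition alpha_B ::
  "('k, 'p) ring_scheme \<Rightarrow> ('k, 'b) bialg \<Rightarrow> ('k, 'c) bialg \<Rightarrow>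
    ('k, 'b, 'e) comod_alg \<Rightarrow> ('k, 'c, 'd) comod_alg \<Rightarrow> ('b \<Rightarrow> 'c) \<Rightarrow> ('e \<Rightarrow> 'd) \<Rightarrow>
    ('e, 'm, 's) module_scheme \<Rightarrow> ('d, ('m, 'b) tensor) tensor \<Rightarrow> (('d, 'm) tensor, 'c) tensor"
  where "alpha_B K B B' E E' \<phi> f M t =
    tensor_map (hopf_G K B' E' (ext_scalars E E' f M)) (\<lambda>x. x) (unitor B' \<phi>)
      (alpha K B B' E E' \<phi> f M (regular B) t)"

end

theory Submission
  imports Defs
begin

text \<open>
  Everything rests on one operation. Two bilinear maps \<open>p : X \<times> M \<rightarrow> U\<close> and \<open>r : Y \<times> Q \<rightarrow> V\<close> over a
  commutative ring induce the bilinear map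
  \<open>(X \<otimes> Y) \<times> (M \<otimes> Q) \<rightarrow> U \<otimes> V\<close>, \<open>(x \<otimes> y, m \<otimes> q) \<mapsto> p x m \<otimes> r y q\<close>, called \<open>tensor_zip\<close> below. The
  multiplication of a tensor product of algebras, the action of \<open>E\<close> on \<open>M \<otimes> Q\<close> and the
  transformation itself are all of this kind: the action of \<open>e\<close> on \<open>t\<close> zips the actions of \<open>E\<close> on
  \<open>M\<close> and of \<open>B\<close> on \<open>Q\<close> and feeds in \<open>\<rho>(e)\<close>, and \<open>\<alpha>(e' \<otimes> t)\<close> zips the two maps into the extensions
  of scalars and feeds in \<open>\<rho>'(e')\<close>. For \<open>Q = B\<close>, after the identification of \<open>B' \<otimes>\<^sub>B B\<close> with \<open>B'\<close>, the
  second map becomes \<open>(y, b) \<mapsto> y \<phi>(b)\<close> (lemma \<open>alpha_B_pure\<close>).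

  An algebraic law that holds in both factors is inherited by the zipped maps. For associativity
  this is \<open>zip_assoc\<close>. Since \<open>\<rho>\<close> and \<open>\<rho>'\<close> are multiplicative, it shows that \<open>M \<otimes> Q\<close> is an
  \<open>E\<close>-module, that \<open>\<alpha>\<close> is well defined on the tensor product over \<open>E\<close> (here \<open>\<rho>' \<circ> f = (f \<otimes> \<phi>) \<circ> \<rho>\<close>
  enters), and that \<open>\<alpha>\<close> is \<open>E'\<close>-linear. Compatibility with linear maps is \<open>zip_map\<close>, and naturality
  of \<open>\<alpha>\<close> is an instance.

  The comonad laws are \<open>coaction_comult\<close> and \<open>coaction_counit\<close>, which concern an arbitrary bilinear
  map \<open>p : E' \<times> M \<rightarrow> U\<close>. Both sides of the first one are values of a single map on
  \<open>((E' \<otimes> B') \<otimes> B') \<times> (B \<otimes> B)\<close>, one at \<open>(id \<otimes> \<Delta>) \<rho>'(e')\<close> and the other at \<open>(\<rho>' \<otimes> id) \<rho>'(e')\<close>, so it is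
  the coassociativity of \<open>\<rho>'\<close>. With \<open>p\<close> the canonical map into \<open>E' \<otimes>\<^sub>E M\<close> they give the two laws for
  \<open>\<alpha>\<close>. With \<open>p\<close> the action of \<open>E\<close> on \<open>M\<close> and \<open>\<phi> = id\<close> they say that \<open>\<delta>\<^sub>E\<close> and \<open>\<epsilon>\<^sub>E\<close> are \<open>E\<close>-linear, which
  is what makes \<open>f\<^sup>*\<delta>\<^sub>E\<close> and \<open>f\<^sup>*\<epsilon>\<^sub>E\<close> meaningful.
\<close>

section \<open>Tensor products of modules\<close>

definition additive_map :: "('a, 'p) ring_scheme \<Rightarrow> ('b, 'q) ring_scheme \<Rightarrow> ('a \<Rightarrow> 'b) \<Rightarrow> bool"
  where "additive_map X Y h \<longleftrightarrow> h \<in> carrier X \<rightarrow> carrier Y \<and>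
    (\<forall>x \<in> carrier X. \<forall>y \<in> carrier X. h (x \<oplus>\<^bsub>X\<^esub> y) = h x \<oplus>\<^bsub>Y\<^esub> h y)"

text \<open>
  These are the maps that factor through the tensor product of a right module \<open>X\<close> and a left module
  \<open>Y\<close>. In the last clause \<open>r \<odot>\<^bsub>X\<^esub> x\<close> stands for \<open>x \<cdot> r\<close>.
\<close>

definition balanced_map ::
  "('r, 'p) ring_scheme \<Rightarrow> ('r, 'x, 'q) module_scheme \<Rightarrow> ('r, 'y, 's) module_scheme \<Rightarrow>
    ('a, 't) ring_scheme \<Rightarrow> ('x \<Rightarrow> 'y \<Rightarrow> 'a) \<Rightarrow> bool"
  where "balanced_map R X Y A \<beta> \<longleftrightarrow>
    (\<forall>y \<in> carrier Y. additive_map X A (\<lambda>x. \<beta> x y)) \<and>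
    (\<forall>x \<in> carrier X. additive_map Y A (\<beta> x)) \<and>
    (\<forall>r \<in> carrier R. \<forall>x \<in> carrier X. \<forall>y \<in> carrier Y. \<beta> (r \<odot>\<^bsub>X\<^esub> x) y = \<beta> x (r \<odot>\<^bsub>Y\<^esub> y))"

lemma additive_mapI:
  assumes "\<And>x. x \<in> carrier X \<Longrightarrow> h x \<in> carrier Y"
    and "\<And>x y. x \<in> carrier X \<Longrightarrow> y \<in> carrier X \<Longrightarrow> h (x \<oplus>\<^bsub>X\<^esub> y) = h x \<oplus>\<^bsub>Y\<^esub> h y"
  shows "additive_map X Y h"
  using assms by (auto simp: additive_map_def)

lemma additive_map_closed: "additive_map X Y h \<Longrightarrow> x \<in> carrier X \<Longrightarrow> h x \<in> carrier Y"
  by (auto simp: additive_map_def)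

lemma additive_map_add:
  "additive_map X Y h \<Longrightarrow> x \<in> carrier X \<Longrightarrow> y \<in> carrier X \<Longrightarrow> h (x \<oplus>\<^bsub>X\<^esub> y) = h x \<oplus>\<^bsub>Y\<^esub> h y"
  by (auto simp: additive_map_def)

lemma additive_map_compose:
  "additive_map Y Z g \<Longrightarrow> additive_map X Y h \<Longrightarrow> additive_map X Z (\<lambda>x. g (h x))"
  by (auto simp: additive_map_def Pi_iff)

lemma balanced_mapI:
  assumes "\<And>x y. x \<in> carrier X \<Longrightarrow> y \<in> carrier Y \<Longrightarrow> \<beta> x y \<in> carrier A"
    and "\<And>x x' y. x \<in> carrier X \<Longrightarrow> x' \<in> carrier X \<Longrightarrow> y \<in> carrier Y \<Longrightarrow>
      \<beta> (x \<oplus>\<^bsub>X\<^esub> x') y = \<beta> x y \<oplus>\<^bsub>A\<^esub> \<beta> x' y"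
    and "\<And>x y y'. x \<in> carrier X \<Longrightarrow> y \<in> carrier Y \<Longrightarrow> y' \<in> carrier Y \<Longrightarrow>
      \<beta> x (y \<oplus>\<^bsub>Y\<^esub> y') = \<beta> x y \<oplus>\<^bsub>A\<^esub> \<beta> x y'"
    and "\<And>r x y. r \<in> carrier R \<Longrightarrow> x \<in> carrier X \<Longrightarrow> y \<in> carrier Y \<Longrightarrow>
      \<beta> (r \<odot>\<^bsub>X\<^esub> x) y = \<beta> x (r \<odot>\<^bsub>Y\<^esub> y)"
  shows "balanced_map R X Y A \<beta>"
  using assms by (auto simp: balanced_map_def additive_map_def)

lemma balanced_mapD:
  assumes "balanced_map R X Y A \<beta>"
  shows "\<And>x y. x \<in> carrier X \<Longrightarrow> y \<in> carrier Y \<Longrightarrow> \<beta> x y \<in> carrier A"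
    and "\<And>x x' y. x \<in> carrier X \<Longrightarrow> x' \<in> carrier X \<Longrightarrow> y \<in> carrier Y \<Longrightarrow>
      \<beta> (x \<oplus>\<^bsub>X\<^esub> x') y = \<beta> x y \<oplus>\<^bsub>A\<^esub> \<beta> x' y"
    and "\<And>x y y'. x \<in> carrier X \<Longrightarrow> y \<in> carrier Y \<Longrightarrow> y' \<in> carrier Y \<Longrightarrow>
      \<beta> x (y \<oplus>\<^bsub>Y\<^esub> y') = \<beta> x y \<oplus>\<^bsub>A\<^esub> \<beta> x y'"
    and "\<And>r x y. r \<in> carrier R \<Longrightarrow> x \<in> carrier X \<Longrightarrow> y \<in> carrier Y \<Longrightarrow>
      \<beta> (r \<odot>\<^bsub>X\<^esub> x) y = \<beta> x (r \<odot>\<^bsub>Y\<^esub> y)"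
  using assms by (auto simp: balanced_map_def additive_map_def Pi_iff)

text \<open>
  The homomorphism from formal sums to \<open>A\<close> that extends \<open>g\<close>, in the shape in which it occurs
  inside \<^const>\<open>tensor_lift\<close>.
\<close>

definition frag_eval :: "('a, 'p) ring_scheme \<Rightarrow> ('s \<Rightarrow> 'a) \<Rightarrow> ('s \<Rightarrow>\<^sub>0 int) \<Rightarrow> 'a"
  where "frag_eval A g c =
    (\<Oplus>\<^bsub>A\<^esub>p \<in> Poly_Mapping.keys c. [Poly_Mapping.lookup c p] \<cdot>\<^bsub>A\<^esub> g p)"

context abelian_group
begin

text \<open>
  Sums over the supports of \<open>c\<close>, \<open>d\<close> and \<open>c + d\<close> can only be compared once all three are taken over a
  common set of indices.
\<close>

lemma frag_eval_superset:
  assumes "finite I" "Poly_Mapping.keys c \<subseteq> I" "g \<in> I \<rightarrow> carrier G"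
  shows "frag_eval G g c = (\<Oplus>p \<in> I. [Poly_Mapping.lookup c p] \<cdot> g p)"
  unfolding frag_eval_def
proof (rule add.finprod_mono_neutral_cong_left)
  show "[Poly_Mapping.lookup c p] \<cdot> g p = \<zero>" if "p \<in> I - Poly_Mapping.keys c" for p
    using that assms(3) by (auto simp: in_keys_iff add_pow_def)
qed (use assms in auto)

lemma frag_eval_hom:
  assumes g: "g \<in> S \<rightarrow> carrier G"
  shows "frag_eval G g \<in> hom (free_Abelian_group S) (add_monoid G)"
proof (rule homI)
  show "frag_eval G g c \<in> carrier (add_monoid G)" if "c \<in> carrier (free_Abelian_group S)" for c
    using that g by (auto simp: frag_eval_def intro!: finsum_closed)
next
  fix c d
  assume cd: "c \<in> carrier (free_Abelian_group S)" "d \<in> carrier (free_Abelian_group S)"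
  let ?I = "Poly_Mapping.keys c \<union> Poly_Mapping.keys d"
  have gI: "g \<in> ?I \<rightarrow> carrier G" using cd g by auto
  then have gp: "g p \<in> carrier G" if "p \<in> ?I" for p using that by blast
  have "frag_eval G g (c + d) = (\<Oplus>p \<in> ?I. [Poly_Mapping.lookup (c + d) p] \<cdot> g p)"
    by (rule frag_eval_superset) (use gI keys_add[of c d] in auto)
  also have "\<dots> = (\<Oplus>p \<in> ?I. [Poly_Mapping.lookup c p] \<cdot> g p \<oplus> [Poly_Mapping.lookup d p] \<cdot> g p)"
    by (rule finsum_cong') (use gp in \<open>auto simp: lookup_add add.int_pow_mult\<close>)
  also have "\<dots> = (\<Oplus>p \<in> ?I. [Poly_Mapping.lookup c p] \<cdot> g p) \<oplus> (\<Oplus>p \<in> ?I. [Poly_Mapping.lookup d p] \<cdot> g p)"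
    by (rule finsum_addf) (use gI in auto)
  also have "\<dots> = frag_eval G g c \<oplus> frag_eval G g d"
    by (subst (1 2) frag_eval_superset[where I = ?I]) (use gI in auto)
  finally show "frag_eval G g (c \<otimes>\<^bsub>free_Abelian_group S\<^esub> d) = frag_eval G g c \<otimes>\<^bsub>add_monoid G\<^esub> frag_eval G g d"
    by simp
qed

lemma frag_eval_of:
  assumes "g p \<in> carrier G"
  shows "frag_eval G g (frag_of p) = g p"
  using assms by (simp add: frag_eval_def)

end

text \<open>
  The record \<open>T\<close> is a parameter because the same additive group carries several structures: it
  occurs as a vector space, as a module over an algebra and as an algebra.
\<close>

locale tensor_product =
  fixes R :: "('r, 'p) ring_scheme" and X :: "('r, 'x, 'q) module_scheme"
    and Y :: "('r, 'y, 's) module_scheme" and T :: "(('x, 'y) tensor, 't) ring_scheme"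
  assumes ab_X: "abelian_group X" and ab_Y: "abelian_group Y"
    and smult_X: "r \<in> carrier R \<Longrightarrow> x \<in> carrier X \<Longrightarrow> r \<odot>\<^bsub>X\<^esub> x \<in> carrier X"
    and smult_Y: "r \<in> carrier R \<Longrightarrow> y \<in> carrier Y \<Longrightarrow> r \<odot>\<^bsub>Y\<^esub> y \<in> carrier Y"
    and carrier_T: "carrier T = carrier (tensor R X Y)"
    and zero_T: "\<zero>\<^bsub>T\<^esub> = \<zero>\<^bsub>tensor R X Y\<^esub>"
    and add_T: "add T = add (tensor R X Y)"
begin

abbreviation "formal \<equiv> free_Abelian_group (carrier X \<times> carrier Y)"
abbreviation "relations \<equiv> generate formal (tensor_relations R X Y)"

lemma relations_in_formal: "tensor_relations R X Y \<subseteq> carrier formal"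
proof -
  interpret X: abelian_group X by (rule ab_X)
  interpret Y: abelian_group Y by (rule ab_Y)
  have diff: "u - v \<in> carrier formal" if "u \<in> carrier formal" "v \<in> carrier formal" for u v
    using that keys_diff[of u v] by auto
  show ?thesis
    unfolding tensor_relations_def
    by (intro Un_least subsetI; elim CollectE exE conjE; hypsubst)
       (intro diff; simp add: smult_X smult_Y)+
qed

lemma subgroup_relations: "subgroup relations formal"
  by (intro group.generate_is_subgroup relations_in_formal) simp

lemma normal_relations: "normal relations formal"
  by (intro comm_group.normal_iff_subgroup[THEN iffD2] abelian_free_Abelian_group subgroup_relations)

abbreviation "coset c \<equiv> r_coset formal relations c"

lemma carrier_T_cosets: "carrier T = coset ` carrier formal"
  by (simp add: carrier_T tensor_def tensor_group_def Let_def carrier_FactGroup)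

lemma add_T_coset:
  "c \<in> carrier formal \<Longrightarrow> d \<in> carrier formal \<Longrightarrow> coset c \<oplus>\<^bsub>T\<^esub> coset d = coset (c + d)"
  using normal.rcos_sum[OF normal_relations, of c d]
  by (simp add: add_T tensor_def tensor_group_def Let_def)

lemma abelian_group_T: "abelian_group T"
proof -
  interpret Q: comm_group "formal Mod relations"
    by (rule comm_group.abelian_FactGroup[OF abelian_free_Abelian_group subgroup_relations])
  have eqs: "carrier T = carrier (formal Mod relations)" "\<zero>\<^bsub>T\<^esub> = \<one>\<^bsub>formal Mod relations\<^esub>"
    "add T = monoid.mult (formal Mod relations)"
    by (simp_all add: carrier_T zero_T add_T tensor_def tensor_group_def Let_def)
  show ?thesis
  proof (rule abelian_groupI)
    show "\<exists>y\<in>carrier T. y \<oplus>\<^bsub>T\<^esub> x = \<zero>\<^bsub>T\<^esub>" if "x \<in> carrier T" for x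
      using that Q.l_inv Q.inv_closed unfolding eqs by blast
    show "x \<oplus>\<^bsub>T\<^esub> y = y \<oplus>\<^bsub>T\<^esub> x" if "x \<in> carrier T" "y \<in> carrier T" for x y
      using that unfolding eqs by (rule Q.m_comm)
  qed (simp_all only: eqs Q.m_closed Q.one_closed Q.m_assoc Q.l_one)
qed

lemma pure_tensor_coset:
  assumes "x \<in> carrier X" "y \<in> carrier Y"
  shows "pure_tensor T x y = coset (frag_of (x, y))"
  unfolding pure_tensor_def
proof (rule the_equality)
  have xy: "frag_of (x, y) \<in> carrier formal" using assms by simp
  show "coset (frag_of (x, y)) \<in> carrier T \<and> frag_of (x, y) \<in> coset (frag_of (x, y))"
    using xy group.rcos_self[OF group_free_Abelian_group _ subgroup_relations]
    by (auto simp: carrier_T_cosets)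
  show "t = coset (frag_of (x, y))" if "t \<in> carrier T \<and> frag_of (x, y) \<in> t" for t
    using that group.repr_independence[OF group_free_Abelian_group _ _ subgroup_relations]
    by (auto simp: carrier_T_cosets)
qed

lemma pure_closed: "x \<in> carrier X \<Longrightarrow> y \<in> carrier Y \<Longrightarrow> pure_tensor T x y \<in> carrier T"
  by (auto simp: pure_tensor_coset carrier_T_cosets)

lemma coset_eqI:
  assumes "c \<in> carrier formal" "d \<in> carrier formal" "c - d \<in> relations"
  shows "coset c = coset d"
proof -
  have "c = (c - d) \<otimes>\<^bsub>formal\<^esub> d" by simp
  then have "c \<in> coset d"
    using assms(3) unfolding r_coset_def by blast
  then show ?thesis
    using group.repr_independence[OF group_free_Abelian_group _ assms(2) subgroup_relations] by metis
qed

lemma pure_balanced: "balanced_map R X Y T (pure_tensor T)"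
proof (rule balanced_mapI)
  interpret X: abelian_group X by (rule ab_X)
  interpret Y: abelian_group Y by (rule ab_Y)
  have sum_formal: "frag_of a + frag_of b \<in> carrier formal"
    if "a \<in> carrier X \<times> carrier Y" "b \<in> carrier X \<times> carrier Y" for a b
    using that keys_add[of "frag_of a" "frag_of b"] by auto
  show "pure_tensor T (x \<oplus>\<^bsub>X\<^esub> x') y = pure_tensor T x y \<oplus>\<^bsub>T\<^esub> pure_tensor T x' y"
    if "x \<in> carrier X" "x' \<in> carrier X" "y \<in> carrier Y" for x x' y
  proof -
    have "coset (frag_of (x \<oplus>\<^bsub>X\<^esub> x', y)) = coset (frag_of (x, y) + frag_of (x', y))"
      by (rule coset_eqI, simp add: that, rule sum_formal, simp add: that, simp add: that, rule generate.incl)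
         (use that in \<open>auto simp: tensor_relations_def diff_diff_eq\<close>)
    then show ?thesis using that by (simp add: pure_tensor_coset add_T_coset)
  qed
  show "pure_tensor T x (y \<oplus>\<^bsub>Y\<^esub> y') = pure_tensor T x y \<oplus>\<^bsub>T\<^esub> pure_tensor T x y'"
    if "x \<in> carrier X" "y \<in> carrier Y" "y' \<in> carrier Y" for x y y'
  proof -
    have "coset (frag_of (x, y \<oplus>\<^bsub>Y\<^esub> y')) = coset (frag_of (x, y) + frag_of (x, y'))"
      by (rule coset_eqI, simp add: that, rule sum_formal, simp add: that, simp add: that, rule generate.incl)
         (use that in \<open>auto simp: tensor_relations_def diff_diff_eq\<close>)
    then show ?thesis using that by (simp add: pure_tensor_coset add_T_coset)
  qed
  show "pure_tensor T (r \<odot>\<^bsub>X\<^esub> x) y = pure_tensor T x (r \<odot>\<^bsub>Y\<^esub> y)"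
    if "r \<in> carrier R" "x \<in> carrier X" "y \<in> carrier Y" for r x y
  proof -
    have "coset (frag_of (r \<odot>\<^bsub>X\<^esub> x, y)) = coset (frag_of (x, r \<odot>\<^bsub>Y\<^esub> y))"
      by (rule coset_eqI, simp add: that smult_X, simp add: that smult_Y, rule generate.incl)
         (use that in \<open>auto simp: tensor_relations_def\<close>)
    then show ?thesis using that by (simp add: pure_tensor_coset smult_X smult_Y)
  qed
qed (rule pure_closed)

text \<open>
  Since \<open>-(x \<otimes> y) = (-x) \<otimes> y\<close>, the sums of pure tensors are closed under differences.
\<close>

lemma tensor_induct [consumes 1, case_names pure add]:
  assumes t: "t \<in> carrier T"
    and pure: "\<And>x y. x \<in> carrier X \<Longrightarrow> y \<in> carrier Y \<Longrightarrow> P (pure_tensor T x y)"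
    and add: "\<And>s t. s \<in> carrier T \<Longrightarrow> t \<in> carrier T \<Longrightarrow> P s \<Longrightarrow> P t \<Longrightarrow> P (s \<oplus>\<^bsub>T\<^esub> t)"
  shows "P t"
proof -
  interpret X: abelian_group X by (rule ab_X)
  interpret Y: abelian_group Y by (rule ab_Y)
  interpret T: abelian_group T by (rule abelian_group_T)
  note pb = balanced_mapD[OF pure_balanced]
  have pure_zero: "pure_tensor T \<zero>\<^bsub>X\<^esub> y = \<zero>\<^bsub>T\<^esub>" if "y \<in> carrier Y" for y
    using pb(2)[of "\<zero>\<^bsub>X\<^esub>" "\<zero>\<^bsub>X\<^esub>" y] pb(1)[of "\<zero>\<^bsub>X\<^esub>" y] that
    by (simp add: T.add.l_cancel_one)
  have pure_minus: "pure_tensor T (\<ominus>\<^bsub>X\<^esub> x) y = \<ominus>\<^bsub>T\<^esub> pure_tensor T x y"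
    if "x \<in> carrier X" "y \<in> carrier Y" for x y
    using pb(2)[of "\<ominus>\<^bsub>X\<^esub> x" x y] pb(1) that pure_zero
    by (intro T.minus_equality[symmetric]) (simp_all add: X.l_neg)
  \<comment> \<open>Formal sums are generated under differences, so \<open>c\<close> and \<open>- c\<close> are carried along together.\<close>
  have "P (coset c) \<and> P (coset (- c))" if "Poly_Mapping.keys c \<subseteq> carrier X \<times> carrier Y" for c
  proof (rule free_Abelian_group_induct[OF that])
    have "coset 0 = \<zero>\<^bsub>T\<^esub>"
      using add_T_coset[of 0 0] T.add.l_cancel_one[of "coset 0" "coset 0"]
      by (auto simp: carrier_T_cosets)
    then show "P (coset 0) \<and> P (coset (- 0))"
      using pure[of "\<zero>\<^bsub>X\<^esub>" "\<zero>\<^bsub>Y\<^esub>"] pure_zero by simp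
  next
    fix c d
    assume cd: "Poly_Mapping.keys c \<subseteq> carrier X \<times> carrier Y" "Poly_Mapping.keys d \<subseteq> carrier X \<times> carrier Y"
      "P (coset c) \<and> P (coset (- c))" "P (coset d) \<and> P (coset (- d))"
    have *: "P (coset (c + d))" if "P (coset c)" "P (coset d)"
      "Poly_Mapping.keys c \<subseteq> carrier X \<times> carrier Y" "Poly_Mapping.keys d \<subseteq> carrier X \<times> carrier Y"
      for c d
      using add[of "coset c" "coset d"] that by (simp add: add_T_coset carrier_T_cosets)
    show "P (coset (c - d)) \<and> P (coset (- (c - d)))"
      using *[of c "- d"] *[of "- c" d] cd by simp
  next
    fix p
    assume "p \<in> carrier X \<times> carrier Y"
    then obtain x y where p: "p = (x, y)" and xy: "x \<in> carrier X" "y \<in> carrier Y"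
      by auto
    have "coset (frag_of (x, y)) \<oplus>\<^bsub>T\<^esub> coset (- frag_of (x, y)) = \<zero>\<^bsub>T\<^esub>"
      using xy add_T_coset[of 0 0] T.add.l_cancel_one[of "coset 0" "coset 0"]
      by (auto simp: carrier_T_cosets add_T_coset)
    then have "coset (- frag_of (x, y)) = \<ominus>\<^bsub>T\<^esub> coset (frag_of (x, y))"
      using xy by (intro T.minus_equality[symmetric]) (auto simp: carrier_T_cosets T.a_comm)
    then show "P (coset (frag_of p)) \<and> P (coset (- frag_of p))"
      using pure[OF xy] pure[of "\<ominus>\<^bsub>X\<^esub> x" y] pure_minus[of x y] xy
      by (simp add: p pure_tensor_coset)
  qed
  then show ?thesis using t by (auto simp: carrier_T_cosets)
qed

lemma tensor_ext:
  assumes g: "additive_map T A g" and h: "additive_map T A h"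
    and "\<And>x y. x \<in> carrier X \<Longrightarrow> y \<in> carrier Y \<Longrightarrow> g (pure_tensor T x y) = h (pure_tensor T x y)"
    and "t \<in> carrier T"
  shows "g t = h t"
  using assms(4) by (induction rule: tensor_induct) (simp_all add: assms(3) additive_map_add[OF g] additive_map_add[OF h])

text \<open>
  The evaluation of \<open>\<beta>\<close> kills the tensor relations, so it does not depend on the formal sum that the
  choice operator in \<^const>\<open>tensor_lift\<close> picks from the coset.
\<close>

lemma tensor_lift_coset:
  assumes A: "abelian_group A" and \<beta>: "balanced_map R X Y A \<beta>" and c: "c \<in> carrier formal"
  shows "tensor_lift A \<beta> (coset c) = frag_eval A (\<lambda>p. \<beta> (fst p) (snd p)) c"
proof -
  interpret A: abelian_group A by (rule A)
  interpret X: abelian_group X by (rule ab_X)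
  interpret Y: abelian_group Y by (rule ab_Y)
  let ?g = "\<lambda>p. \<beta> (fst p) (snd p)"
  let ?ev = "frag_eval A ?g"
  note \<beta>D = balanced_mapD[OF \<beta>]
  have g: "?g \<in> carrier X \<times> carrier Y \<rightarrow> carrier A"
    using \<beta>D(1) by auto
  interpret ev: group_hom formal "add_monoid A" ?ev
    using A.frag_eval_hom[OF g] A.a_group by (simp add: group_hom_def group_hom_axioms_def)
  have ev_of: "?ev (frag_of (x, y)) = \<beta> x y" if "x \<in> carrier X" "y \<in> carrier Y" for x y
    using A.frag_eval_of[of ?g "(x, y)"] \<beta>D(1) that by simp
  have ev_closed: "?ev u \<in> carrier A" if "u \<in> carrier formal" for u
    using ev.hom_closed[OF that] by simp
  have ev_add: "?ev (u + v) = ?ev u \<oplus>\<^bsub>A\<^esub> ?ev v" if "u \<in> carrier formal" "v \<in> carrier formal" for u v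
    using ev.hom_mult[OF that] by simp
  have ev_diff: "?ev (u - v) = ?ev u \<ominus>\<^bsub>A\<^esub> ?ev v" if "u \<in> carrier formal" "v \<in> carrier formal" for u v
    using ev_add[of u "- v"] ev.hom_inv[OF that(2)] that by (simp add: a_inv_def a_minus_def)
  have diff_formal: "u - v \<in> carrier formal" if "u \<in> carrier formal" "v \<in> carrier formal" for u v
    using that keys_diff[of u v] by auto
  have cancel: "a \<oplus>\<^bsub>A\<^esub> b \<oplus>\<^bsub>A\<^esub> \<ominus>\<^bsub>A\<^esub> a \<oplus>\<^bsub>A\<^esub> \<ominus>\<^bsub>A\<^esub> b = \<zero>\<^bsub>A\<^esub>"
    if "a \<in> carrier A" "b \<in> carrier A" for a b
    using that by (metis A.a_assoc A.a_comm A.add.inv_closed A.r_neg1 A.r_neg)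
  have rel: "?ev u = \<zero>\<^bsub>A\<^esub>" if "u \<in> tensor_relations R X Y" for u
    using that unfolding tensor_relations_def
    by (elim UnE CollectE exE conjE)
       (simp_all add: ev_diff diff_formal ev_of \<beta>D smult_X smult_Y cancel A.minus_eq A.r_neg
          del: carrier_free_Abelian_group_iff)
  have rels: "u \<in> carrier formal \<and> ?ev u = \<zero>\<^bsub>A\<^esub>" if "u \<in> relations" for u
    using that
  proof (induction rule: generate.induct)
    case one
    then show ?case using ev.hom_one by simp
  next
    case (incl h)
    then show ?case using rel relations_in_formal by blast
  next
    case (inv h)
    then have "h \<in> carrier formal" using relations_in_formal by blast
    then show ?case using ev.hom_inv[of h] rel[OF inv] by simp
  next
    case (eng h1 h2)
    then show ?case using ev_add[of h1 h2] keys_add[of h1 h2] by auto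
  qed
  define d where "d = (SOME d. d \<in> coset c)"
  have "c \<in> coset c"
    using group.rcos_self[OF group_free_Abelian_group c subgroup_relations] .
  then have "d \<in> coset c"
    unfolding d_def by (rule someI)
  then obtain u where "u \<in> relations" "d = u + c"
    by (auto simp: r_coset_def)
  then have "?ev d = ?ev c"
    using rels[of u] ev_add[of u c] c ev_closed[OF c] by simp
  then show ?thesis
    by (simp add: tensor_lift_def d_def frag_eval_def Let_def)
qed

lemma tensor_lift_additive:
  assumes "abelian_group A" "balanced_map R X Y A \<beta>"
  shows "additive_map T A (tensor_lift A \<beta>)"
proof -
  interpret A: abelian_group A by (rule assms)
  have "(\<lambda>p. \<beta> (fst p) (snd p)) \<in> carrier X \<times> carrier Y \<rightarrow> carrier A"
    using balanced_mapD(1)[OF assms(2)] by auto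
  note hom = A.frag_eval_hom[OF this]
  show ?thesis
  proof (rule additive_mapI)
    show "tensor_lift A \<beta> t \<in> carrier A" if "t \<in> carrier T" for t
      using that hom by (auto simp: hom_def Pi_iff carrier_T_cosets tensor_lift_coset[OF assms])
    show "tensor_lift A \<beta> (s \<oplus>\<^bsub>T\<^esub> t) = tensor_lift A \<beta> s \<oplus>\<^bsub>A\<^esub> tensor_lift A \<beta> t"
      if st: "s \<in> carrier T" "t \<in> carrier T" for s t
    proof -
      obtain c d where cd: "c \<in> carrier formal" "d \<in> carrier formal" "s = coset c" "t = coset d"
        using st by (auto simp: carrier_T_cosets)
      then have "c + d \<in> carrier formal"
        using keys_add[of c d] by auto
      then show ?thesis
        using cd hom_mult[OF hom cd(1,2)] by (simp only: add_T_coset tensor_lift_coset[OF assms]) simp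
    qed
  qed
qed

lemma tensor_lift_pure:
  assumes "abelian_group A" "balanced_map R X Y A \<beta>" "x \<in> carrier X" "y \<in> carrier Y"
  shows "tensor_lift A \<beta> (pure_tensor T x y) = \<beta> x y"
  using assms abelian_group.frag_eval_of[of A "\<lambda>p. \<beta> (fst p) (snd p)" "(x, y)"] balanced_mapD(1)[OF assms(2)]
  by (simp add: pure_tensor_coset tensor_lift_coset)

end

section \<open>Bilinear maps over a commutative ring\<close>

text \<open>
  The constructions on tensors see only the additive group of the record. This allows a tensor
  product that is stored with one scalar multiplication to be replaced by the same group with
  another one.
\<close>

lemma pure_tensor_record_cong:
  "carrier T = carrier T' \<Longrightarrow> pure_tensor T = pure_tensor T'"
  by (intro ext) (simp add: pure_tensor_def)

lemma tensor_lift_record_cong: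
  assumes "carrier A = carrier A'" "\<zero>\<^bsub>A\<^esub> = \<zero>\<^bsub>A'\<^esub>" "add A = add A'"
  shows "tensor_lift A \<beta> = tensor_lift A' \<beta>"
  using assms by (intro ext) (simp add: tensor_lift_def finsum_def finprod_def add_pow_def int_pow_def
    nat_pow_def m_inv_def Let_def cong: if_cong)

lemma tensor_map_record_cong:
  assumes "carrier T = carrier T'" "\<zero>\<^bsub>T\<^esub> = \<zero>\<^bsub>T'\<^esub>" "add T = add T'"
  shows "tensor_map T g h = tensor_map T' g h"
  unfolding tensor_map_def pure_tensor_record_cong[OF assms(1)] by (rule tensor_lift_record_cong[OF assms])

text \<open>
  The tensor relations apply the scalar multiplications to elements of the carriers only.
\<close>

lemma tensor_cong:
  assumes "carrier X = carrier X'" "add X = add X'" "carrier Y = carrier Y'" "add Y = add Y'"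
    and "\<And>r x. r \<in> carrier R \<Longrightarrow> x \<in> carrier X \<Longrightarrow> r \<odot>\<^bsub>X\<^esub> x = r \<odot>\<^bsub>X'\<^esub> x"
    and "\<And>r y. r \<in> carrier R \<Longrightarrow> y \<in> carrier Y \<Longrightarrow> r \<odot>\<^bsub>Y\<^esub> y = r \<odot>\<^bsub>Y'\<^esub> y"
  shows "tensor R X Y = tensor R X' Y'"
proof -
  have "tensor_relations R X Y = tensor_relations R X' Y'"
    unfolding tensor_relations_def using assms
    by (intro arg_cong2[where f = "(\<union>)"] Collect_cong) (metis (no_types))+
  then show ?thesis
    by (simp add: tensor_def tensor_group_def assms(1,3))
qed

lemma left_moduleD:
  assumes "left_module R M"
  shows "ring R" "abelian_group M"
    "\<And>a x. a \<in> carrier R \<Longrightarrow> x \<in> carrier M \<Longrightarrow> a \<odot>\<^bsub>M\<^esub> x \<in> carrier M"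
    "\<And>a b x. a \<in> carrier R \<Longrightarrow> b \<in> carrier R \<Longrightarrow> x \<in> carrier M \<Longrightarrow>
      (a \<oplus>\<^bsub>R\<^esub> b) \<odot>\<^bsub>M\<^esub> x = a \<odot>\<^bsub>M\<^esub> x \<oplus>\<^bsub>M\<^esub> b \<odot>\<^bsub>M\<^esub> x"
    "\<And>a x y. a \<in> carrier R \<Longrightarrow> x \<in> carrier M \<Longrightarrow> y \<in> carrier M \<Longrightarrow>
      a \<odot>\<^bsub>M\<^esub> (x \<oplus>\<^bsub>M\<^esub> y) = a \<odot>\<^bsub>M\<^esub> x \<oplus>\<^bsub>M\<^esub> a \<odot>\<^bsub>M\<^esub> y"
    "\<And>a b x. a \<in> carrier R \<Longrightarrow> b \<in> carrier R \<Longrightarrow> x \<in> carrier M \<Longrightarrow>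
      (a \<otimes>\<^bsub>R\<^esub> b) \<odot>\<^bsub>M\<^esub> x = a \<odot>\<^bsub>M\<^esub> (b \<odot>\<^bsub>M\<^esub> x)"
    "\<And>x. x \<in> carrier M \<Longrightarrow> \<one>\<^bsub>R\<^esub> \<odot>\<^bsub>M\<^esub> x = x"
    "\<And>x y. x \<in> carrier M \<Longrightarrow> y \<in> carrier M \<Longrightarrow> x \<oplus>\<^bsub>M\<^esub> y \<in> carrier M"
    "\<zero>\<^bsub>M\<^esub> \<in> carrier M"
proof -
  interpret left_module R M by (rule assms)
  show "\<And>x y. x \<in> carrier M \<Longrightarrow> y \<in> carrier M \<Longrightarrow> x \<oplus>\<^bsub>M\<^esub> y \<in> carrier M"
    "\<zero>\<^bsub>M\<^esub> \<in> carrier M"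
    by simp_all
qed (use assms in \<open>auto simp: left_module_def left_module_axioms_def\<close>)

lemma left_moduleI:
  assumes "ring R" "abelian_group M"
    "\<And>a x. a \<in> carrier R \<Longrightarrow> x \<in> carrier M \<Longrightarrow> a \<odot>\<^bsub>M\<^esub> x \<in> carrier M"
    "\<And>a b x. a \<in> carrier R \<Longrightarrow> b \<in> carrier R \<Longrightarrow> x \<in> carrier M \<Longrightarrow>
      (a \<oplus>\<^bsub>R\<^esub> b) \<odot>\<^bsub>M\<^esub> x = a \<odot>\<^bsub>M\<^esub> x \<oplus>\<^bsub>M\<^esub> b \<odot>\<^bsub>M\<^esub> x"
    "\<And>a x y. a \<in> carrier R \<Longrightarrow> x \<in> carrier M \<Longrightarrow> y \<in> carrier M \<Longrightarrow>
      a \<odot>\<^bsub>M\<^esub> (x \<oplus>\<^bsub>M\<^esub> y) = a \<odot>\<^bsub>M\<^esub> x \<oplus>\<^bsub>M\<^esub> a \<odot>\<^bsub>M\<^esub> y"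
    "\<And>a b x. a \<in> carrier R \<Longrightarrow> b \<in> carrier R \<Longrightarrow> x \<in> carrier M \<Longrightarrow>
      (a \<otimes>\<^bsub>R\<^esub> b) \<odot>\<^bsub>M\<^esub> x = a \<odot>\<^bsub>M\<^esub> (b \<odot>\<^bsub>M\<^esub> x)"
    "\<And>x. x \<in> carrier M \<Longrightarrow> \<one>\<^bsub>R\<^esub> \<odot>\<^bsub>M\<^esub> x = x"
  shows "left_module R M"
  using assms by (auto simp: left_module_def left_module_axioms_def)

lemma left_module_homI:
  assumes "left_module R M" "left_module R N" "additive_map M N h"
    "\<And>a x. a \<in> carrier R \<Longrightarrow> x \<in> carrier M \<Longrightarrow> h (a \<odot>\<^bsub>M\<^esub> x) = a \<odot>\<^bsub>N\<^esub> h x"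
  shows "left_module_hom R M N h"
  using assms by (auto simp: left_module_hom_def additive_map_def)

lemma left_module_homD:
  assumes "left_module_hom R M N h"
  shows "left_module R M" "left_module R N" "additive_map M N h"
    "\<And>x. x \<in> carrier M \<Longrightarrow> h x \<in> carrier N"
    "\<And>x y. x \<in> carrier M \<Longrightarrow> y \<in> carrier M \<Longrightarrow> h (x \<oplus>\<^bsub>M\<^esub> y) = h x \<oplus>\<^bsub>N\<^esub> h y"
    "\<And>a x. a \<in> carrier R \<Longrightarrow> x \<in> carrier M \<Longrightarrow> h (a \<odot>\<^bsub>M\<^esub> x) = a \<odot>\<^bsub>N\<^esub> h x"
  using assms by (auto simp: left_module_hom_def additive_map_def)

lemma left_module_hom_id: "left_module R M \<Longrightarrow> left_module_hom R M M (\<lambda>x. x)"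
  by (auto simp: left_module_hom_def)

lemma left_module_hom_compose:
  "left_module_hom R N P g \<Longrightarrow> left_module_hom R M N h \<Longrightarrow> left_module_hom R M P (\<lambda>x. g (h x))"
  by (auto simp: left_module_hom_def Pi_iff)

definition bilinear_map ::
  "('k, 'p) ring_scheme \<Rightarrow> ('k, 'x, 'q) module_scheme \<Rightarrow> ('k, 'y, 's) module_scheme \<Rightarrow>
    ('k, 'z, 't) module_scheme \<Rightarrow> ('x \<Rightarrow> 'y \<Rightarrow> 'z) \<Rightarrow> bool"
  where "bilinear_map K X Y Z \<beta> \<longleftrightarrow>
    left_module K X \<and> left_module K Y \<and>
    (\<forall>y \<in> carrier Y. left_module_hom K X Z (\<lambda>x. \<beta> x y)) \<and>
    (\<forall>x \<in> carrier X. left_module_hom K Y Z (\<beta> x))"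

lemma bilinear_mapI:
  assumes "left_module K X" "left_module K Y" "left_module K Z"
    and "\<And>x y. x \<in> carrier X \<Longrightarrow> y \<in> carrier Y \<Longrightarrow> \<beta> x y \<in> carrier Z"
    and "\<And>x x' y. x \<in> carrier X \<Longrightarrow> x' \<in> carrier X \<Longrightarrow> y \<in> carrier Y \<Longrightarrow>
      \<beta> (x \<oplus>\<^bsub>X\<^esub> x') y = \<beta> x y \<oplus>\<^bsub>Z\<^esub> \<beta> x' y"
    and "\<And>x y y'. x \<in> carrier X \<Longrightarrow> y \<in> carrier Y \<Longrightarrow> y' \<in> carrier Y \<Longrightarrow>
      \<beta> x (y \<oplus>\<^bsub>Y\<^esub> y') = \<beta> x y \<oplus>\<^bsub>Z\<^esub> \<beta> x y'"
    and "\<And>r x y. r \<in> carrier K \<Longrightarrow> x \<in> carrier X \<Longrightarrow> y \<in> carrier Y \<Longrightarrow>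
      \<beta> (r \<odot>\<^bsub>X\<^esub> x) y = r \<odot>\<^bsub>Z\<^esub> \<beta> x y"
    and "\<And>r x y. r \<in> carrier K \<Longrightarrow> x \<in> carrier X \<Longrightarrow> y \<in> carrier Y \<Longrightarrow>
      \<beta> x (r \<odot>\<^bsub>Y\<^esub> y) = r \<odot>\<^bsub>Z\<^esub> \<beta> x y"
  shows "bilinear_map K X Y Z \<beta>"
  using assms by (auto simp: bilinear_map_def left_module_hom_def)

lemma bilinear_mapD:
  assumes "bilinear_map K X Y Z \<beta>"
  shows "left_module K X" "left_module K Y" "left_module K Z"
    and "\<And>x y. x \<in> carrier X \<Longrightarrow> y \<in> carrier Y \<Longrightarrow> \<beta> x y \<in> carrier Z"
    and "\<And>x x' y. x \<in> carrier X \<Longrightarrow> x' \<in> carrier X \<Longrightarrow> y \<in> carrier Y \<Longrightarrow>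
      \<beta> (x \<oplus>\<^bsub>X\<^esub> x') y = \<beta> x y \<oplus>\<^bsub>Z\<^esub> \<beta> x' y"
    and "\<And>x y y'. x \<in> carrier X \<Longrightarrow> y \<in> carrier Y \<Longrightarrow> y' \<in> carrier Y \<Longrightarrow>
      \<beta> x (y \<oplus>\<^bsub>Y\<^esub> y') = \<beta> x y \<oplus>\<^bsub>Z\<^esub> \<beta> x y'"
    and "\<And>r x y. r \<in> carrier K \<Longrightarrow> x \<in> carrier X \<Longrightarrow> y \<in> carrier Y \<Longrightarrow>
      \<beta> (r \<odot>\<^bsub>X\<^esub> x) y = r \<odot>\<^bsub>Z\<^esub> \<beta> x y"
    and "\<And>r x y. r \<in> carrier K \<Longrightarrow> x \<in> carrier X \<Longrightarrow> y \<in> carrier Y \<Longrightarrow>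
      \<beta> x (r \<odot>\<^bsub>Y\<^esub> y) = r \<odot>\<^bsub>Z\<^esub> \<beta> x y"
proof -
  show Z: "left_module K Z"
  proof -
    interpret Y: abelian_group Y
      using assms by (auto simp: bilinear_map_def dest: left_moduleD)
    show ?thesis using assms Y.zero_closed by (auto simp: bilinear_map_def left_module_hom_def)
  qed
qed (use assms in \<open>auto simp: bilinear_map_def left_module_hom_def Pi_iff\<close>)

lemma bilinear_map_left:
  "bilinear_map K X Y Z \<beta> \<Longrightarrow> y \<in> carrier Y \<Longrightarrow> left_module_hom K X Z (\<lambda>x. \<beta> x y)"
  by (simp add: bilinear_map_def)

lemma bilinear_map_right:
  "bilinear_map K X Y Z \<beta> \<Longrightarrow> x \<in> carrier X \<Longrightarrow> left_module_hom K Y Z (\<beta> x)"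
  by (simp add: bilinear_map_def)

lemma bilinear_map_swap: "bilinear_map K X Y Z \<beta> \<Longrightarrow> bilinear_map K Y X Z (\<lambda>y x. \<beta> x y)"
  by (auto simp: bilinear_map_def)

lemma bilinear_map_compose:
  "bilinear_map K X Y Z \<beta> \<Longrightarrow> left_module_hom K X' X g \<Longrightarrow> left_module_hom K Y' Y h \<Longrightarrow>
    bilinear_map K X' Y' Z (\<lambda>x y. \<beta> (g x) (h y))"
  by (auto simp: bilinear_map_def left_module_hom_def Pi_iff)

lemma bilinear_map_balanced: "bilinear_map K X Y Z \<beta> \<Longrightarrow> balanced_map K X Y Z \<beta>"
  by (intro balanced_mapI) (simp_all add: bilinear_mapD(4-8))

definition tensor_zip ::
  "(('u, 'v) tensor, 'p) ring_scheme \<Rightarrow> ('x \<Rightarrow> 'm \<Rightarrow> 'u) \<Rightarrow> ('y \<Rightarrow> 'q \<Rightarrow> 'v) \<Rightarrow>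
    ('x, 'y) tensor \<Rightarrow> ('m, 'q) tensor \<Rightarrow> ('u, 'v) tensor"
  where "tensor_zip W p r s t =
    tensor_lift W (\<lambda>x y. tensor_lift W (\<lambda>m q. pure_tensor W (p x m) (r y q)) t) s"

lemma tensor_zip_record_cong:
  assumes "carrier T = carrier T'" "\<zero>\<^bsub>T\<^esub> = \<zero>\<^bsub>T'\<^esub>" "add T = add T'"
  shows "tensor_zip T p r = tensor_zip T' p r"
  unfolding tensor_zip_def pure_tensor_record_cong[OF assms(1)] tensor_lift_record_cong[OF assms] ..

locale comm_scalars =
  fixes K :: "('k, 'p) ring_scheme"
  assumes cring_K: "cring K"
begin

abbreviation tensor_over_K (infixl "\<boxtimes>" 70)
  where "X \<boxtimes> Y \<equiv> tensor_K K X Y"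

abbreviation "linear X Y h \<equiv> left_module_hom K X Y h"
abbreviation "bilinear X Y Z \<beta> \<equiv> bilinear_map K X Y Z \<beta>"
abbreviation "tzip X Y p r \<equiv> tensor_zip (X \<boxtimes> Y) p r"

lemma tensor_product_K:
  "left_module K X \<Longrightarrow> left_module K Y \<Longrightarrow> tensor_product K X Y (X \<boxtimes> Y)"
  by (intro tensor_product.intro) (simp_all add: left_moduleD tensor_K_def Let_def)

lemma abelian_group_tensor:
  "left_module K X \<Longrightarrow> left_module K Y \<Longrightarrow> abelian_group (X \<boxtimes> Y)"
  by (rule tensor_product.abelian_group_T[OF tensor_product_K])

lemma tensor_smult: "c \<odot>\<^bsub>X \<boxtimes> Y\<^esub> t = tensor_map (X \<boxtimes> Y) (\<lambda>x. c \<odot>\<^bsub>X\<^esub> x) (\<lambda>y. y) t"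
  unfolding tensor_K_def Let_def by (simp, rule tensor_map_record_cong[THEN fun_cong]) simp_all

lemma smult_commute:
  assumes X: "left_module K X" and "c \<in> carrier K" "d \<in> carrier K" "x \<in> carrier X"
  shows "c \<odot>\<^bsub>X\<^esub> (d \<odot>\<^bsub>X\<^esub> x) = d \<odot>\<^bsub>X\<^esub> (c \<odot>\<^bsub>X\<^esub> x)"
proof -
  interpret K: cring K by (rule cring_K)
  show ?thesis using left_moduleD(6)[OF X] assms K.m_comm[of c d] by metis
qed

lemma tensor_smult_balanced:
  assumes X: "left_module K X" and Y: "left_module K Y" and c: "c \<in> carrier K"
  shows "balanced_map K X Y (X \<boxtimes> Y) (\<lambda>x y. pure_tensor (X \<boxtimes> Y) (c \<odot>\<^bsub>X\<^esub> x) y)"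
proof -
  interpret T: tensor_product K X Y "X \<boxtimes> Y" by (rule tensor_product_K[OF X Y])
  note D = balanced_mapD[OF T.pure_balanced]
  show ?thesis
    by (rule balanced_mapI) (simp_all add: D c left_moduleD[OF X] left_moduleD[OF Y] smult_commute[OF X c] flip: D(4))
qed

lemma tensor_smult_additive:
  assumes "left_module K X" "left_module K Y" "c \<in> carrier K"
  shows "additive_map (X \<boxtimes> Y) (X \<boxtimes> Y) (\<lambda>t. c \<odot>\<^bsub>X \<boxtimes> Y\<^esub> t)"
  using tensor_product.tensor_lift_additive[OF tensor_product_K[OF assms(1,2)]
      abelian_group_tensor[OF assms(1,2)] tensor_smult_balanced[OF assms]]
  by (simp add: tensor_smult tensor_map_def)

lemma tensor_smult_pure:
  assumes "left_module K X" "left_module K Y" "c \<in> carrier K" "x \<in> carrier X" "y \<in> carrier Y"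
  shows "c \<odot>\<^bsub>X \<boxtimes> Y\<^esub> pure_tensor (X \<boxtimes> Y) x y = pure_tensor (X \<boxtimes> Y) (c \<odot>\<^bsub>X\<^esub> x) y"
  using tensor_product.tensor_lift_pure[OF tensor_product_K[OF assms(1,2)]
      abelian_group_tensor[OF assms(1,2)] tensor_smult_balanced[OF assms(1,2,3)] assms(4,5)]
  by (simp add: tensor_smult tensor_map_def)

lemma left_module_tensor:
  assumes X: "left_module K X" and Y: "left_module K Y"
  shows "left_module K (X \<boxtimes> Y)"
proof -
  interpret T: tensor_product K X Y "X \<boxtimes> Y" by (rule tensor_product_K[OF X Y])
  interpret A: abelian_group "X \<boxtimes> Y" by (rule T.abelian_group_T)
  interpret K: cring K by (rule cring_K)
  note P = balanced_mapD[OF T.pure_balanced]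
  note S = tensor_smult_pure[OF X Y] additive_map_add[OF tensor_smult_additive[OF X Y]]
  have cl: "c \<odot>\<^bsub>X \<boxtimes> Y\<^esub> t \<in> carrier (X \<boxtimes> Y)" if "c \<in> carrier K" "t \<in> carrier (X \<boxtimes> Y)" for c t
    by (rule additive_map_closed[OF tensor_smult_additive[OF X Y that(1)] that(2)])
  show ?thesis
  proof (rule left_moduleI)
    fix a b t assume ab: "a \<in> carrier K" "b \<in> carrier K" and t: "t \<in> carrier (X \<boxtimes> Y)"
    show "(a \<oplus>\<^bsub>K\<^esub> b) \<odot>\<^bsub>X \<boxtimes> Y\<^esub> t = a \<odot>\<^bsub>X \<boxtimes> Y\<^esub> t \<oplus>\<^bsub>X \<boxtimes> Y\<^esub> b \<odot>\<^bsub>X \<boxtimes> Y\<^esub> t"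
      using t by (induction rule: T.tensor_induct)
        (simp_all add: ab S P(1-3) cl left_moduleD[OF X] A.a_ac)
    show "(a \<otimes>\<^bsub>K\<^esub> b) \<odot>\<^bsub>X \<boxtimes> Y\<^esub> t = a \<odot>\<^bsub>X \<boxtimes> Y\<^esub> (b \<odot>\<^bsub>X \<boxtimes> Y\<^esub> t)"
      using t by (induction rule: T.tensor_induct)
        (simp_all add: ab S P(1-3) cl left_moduleD[OF X])
  next
    show "\<one>\<^bsub>K\<^esub> \<odot>\<^bsub>X \<boxtimes> Y\<^esub> t = t" if "t \<in> carrier (X \<boxtimes> Y)" for t
      using that by (induction rule: T.tensor_induct) (simp_all add: S left_moduleD[OF X])
  qed (simp_all add: S cl K.ring_axioms A.abelian_group_axioms)
qed

lemma pure_bilinear: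
  assumes X: "left_module K X" and Y: "left_module K Y"
  shows "bilinear X Y (X \<boxtimes> Y) (pure_tensor (X \<boxtimes> Y))"
proof -
  interpret T: tensor_product K X Y "X \<boxtimes> Y" by (rule tensor_product_K[OF X Y])
  note P = balanced_mapD[OF T.pure_balanced]
  show ?thesis
    by (rule bilinear_mapI)
       (simp_all add: P X Y left_module_tensor tensor_smult_pure[OF X Y] flip: P(4))
qed

lemmas pure_simps = bilinear_mapD(4-8)[OF pure_bilinear]

lemma lift_linear:
  assumes \<beta>: "bilinear X Y Z \<beta>"
  shows "linear (X \<boxtimes> Y) Z (tensor_lift Z \<beta>)"
    and "x \<in> carrier X \<Longrightarrow> y \<in> carrier Y \<Longrightarrow> tensor_lift Z \<beta> (pure_tensor (X \<boxtimes> Y) x y) = \<beta> x y"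
proof -
  note D = bilinear_mapD[OF \<beta>]
  interpret T: tensor_product K X Y "X \<boxtimes> Y" by (rule tensor_product_K[OF D(1,2)])
  note Z = left_moduleD[OF D(3)]
  note bal = bilinear_map_balanced[OF \<beta>]
  note L = T.tensor_lift_additive[OF Z(2) bal]
  show on_pure: "tensor_lift Z \<beta> (pure_tensor (X \<boxtimes> Y) x y) = \<beta> x y" if "x \<in> carrier X" "y \<in> carrier Y" for x y
    using T.tensor_lift_pure[OF Z(2) bal that] .
  show "linear (X \<boxtimes> Y) Z (tensor_lift Z \<beta>)"
  proof (rule left_module_homI[OF left_module_tensor[OF D(1,2)] D(3) L])
    fix c t assume c: "c \<in> carrier K" and t: "t \<in> carrier (X \<boxtimes> Y)"
    show "tensor_lift Z \<beta> (c \<odot>\<^bsub>X \<boxtimes> Y\<^esub> t) = c \<odot>\<^bsub>Z\<^esub> tensor_lift Z \<beta> t"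
      using t
    proof (induction rule: T.tensor_induct)
      case (pure x y)
      then show ?case
        using c by (simp add: tensor_smult_pure D on_pure left_moduleD[OF D(1)])
    next
      case (add s t)
      then show ?case
        using c left_moduleD[OF left_module_tensor[OF D(1,2)]] additive_map_closed[OF L]
        by (simp add: additive_map_add[OF L] Z)
    qed
  qed
qed

lemma tensor_map_linear:
  assumes g: "linear X U g" and h: "linear Y V h"
  shows "linear (X \<boxtimes> Y) (U \<boxtimes> V) (tensor_map (U \<boxtimes> V) g h)"
    and "x \<in> carrier X \<Longrightarrow> y \<in> carrier Y \<Longrightarrow>
      tensor_map (U \<boxtimes> V) g h (pure_tensor (X \<boxtimes> Y) x y) = pure_tensor (U \<boxtimes> V) (g x) (h y)"
proof -
  have "bilinear X Y (U \<boxtimes> V) (\<lambda>x y. pure_tensor (U \<boxtimes> V) (g x) (h y))"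
    by (rule bilinear_map_compose[OF pure_bilinear g h])
       (use left_module_homD[OF g] left_module_homD[OF h] in simp_all)
  from lift_linear[OF this]
  show "linear (X \<boxtimes> Y) (U \<boxtimes> V) (tensor_map (U \<boxtimes> V) g h)"
    "x \<in> carrier X \<Longrightarrow> y \<in> carrier Y \<Longrightarrow>
      tensor_map (U \<boxtimes> V) g h (pure_tensor (X \<boxtimes> Y) x y) = pure_tensor (U \<boxtimes> V) (g x) (h y)"
    by (simp_all add: tensor_map_def)
qed

text \<open>
  With \<open>t\<close> fixed, the inner lift has to be bilinear in \<open>(x, y)\<close> before the outer lift exists. This is
  an induction on \<open>t\<close>.
\<close>

lemma zip_bilinear:
  assumes p: "bilinear X M U p" and r: "bilinear Y Q V r"
  shows "bilinear (X \<boxtimes> Y) (M \<boxtimes> Q) (U \<boxtimes> V) (tzip U V p r)"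
    and "x \<in> carrier X \<Longrightarrow> y \<in> carrier Y \<Longrightarrow> m \<in> carrier M \<Longrightarrow> q \<in> carrier Q \<Longrightarrow>
      tzip U V p r (pure_tensor (X \<boxtimes> Y) x y) (pure_tensor (M \<boxtimes> Q) m q) =
      pure_tensor (U \<boxtimes> V) (p x m) (r y q)"
proof -
  note P = bilinear_mapD[OF p] and R = bilinear_mapD[OF r]
  note UV = left_module_tensor[OF P(3) R(3)]
  note MQ = left_module_tensor[OF P(2) R(2)]
  note XY = left_module_tensor[OF P(1) R(1)]
  interpret MQ: tensor_product K M Q "M \<boxtimes> Q" by (rule tensor_product_K[OF P(2) R(2)])
  interpret XY: tensor_product K X Y "X \<boxtimes> Y" by (rule tensor_product_K[OF P(1) R(1)])
  interpret UV: abelian_group "U \<boxtimes> V" by (rule abelian_group_tensor[OF P(3) R(3)])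
  define inner where "inner x y = tensor_lift (U \<boxtimes> V) (\<lambda>m q. pure_tensor (U \<boxtimes> V) (p x m) (r y q))" for x y
  have "bilinear M Q (U \<boxtimes> V) (\<lambda>m q. pure_tensor (U \<boxtimes> V) (p x m) (r y q))"
    if "x \<in> carrier X" "y \<in> carrier Y" for x y
    by (rule bilinear_map_compose[OF pure_bilinear[OF P(3) R(3)] bilinear_map_right[OF p that(1)]
          bilinear_map_right[OF r that(2)]])
  note I0 = lift_linear[OF this, folded inner_def]
  note I = left_module_homD(4-6)[OF I0(1)] I0(2)
  have inner: "bilinear X Y (U \<boxtimes> V) (\<lambda>x y. inner x y t)" if "t \<in> carrier (M \<boxtimes> Q)" for t
    using that
  proof (induction rule: MQ.tensor_induct)
    case (pure m q)
    have "bilinear X Y (U \<boxtimes> V) (\<lambda>x y. pure_tensor (U \<boxtimes> V) (p x m) (r y q))"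
      by (rule bilinear_map_compose[OF pure_bilinear[OF P(3) R(3)] bilinear_map_left[OF p pure(1)]
          bilinear_map_left[OF r pure(2)]])
    note D = bilinear_mapD[OF this]
    show ?case
      by (rule bilinear_mapI) (simp_all add: P(1) R(1) UV I pure D left_moduleD[OF P(1)] left_moduleD[OF R(1)])
  next
    case (add s t)
    note S = bilinear_mapD[OF add(3)] and T = bilinear_mapD[OF add(4)]
    show ?case
      by (rule bilinear_mapI)
         (simp_all add: P(1) R(1) UV I add(1,2) S(4-8) T(4-8) UV.a_ac left_moduleD[OF P(1)]
           left_moduleD[OF R(1)] left_moduleD[OF UV])
  qed
  have zip: "tensor_lift (U \<boxtimes> V) (\<lambda>x y. inner x y t) = (\<lambda>s. tzip U V p r s t)" for t
    by (simp add: tensor_zip_def inner_def)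
  note L0 = lift_linear[OF inner, unfolded zip]
  note L = left_module_homD(4-6)[OF L0(1)] L0(2)
  show "tzip U V p r (pure_tensor (X \<boxtimes> Y) x y) (pure_tensor (M \<boxtimes> Q) m q) = pure_tensor (U \<boxtimes> V) (p x m) (r y q)"
    if "x \<in> carrier X" "y \<in> carrier Y" "m \<in> carrier M" "q \<in> carrier Q"
    using that by (simp add: L I MQ.pure_closed)
  have right: "linear (M \<boxtimes> Q) (U \<boxtimes> V) (tzip U V p r s)" if "s \<in> carrier (X \<boxtimes> Y)" for s
    using that
  proof (induction rule: XY.tensor_induct)
    case (pure x y)
    show ?case
      by (rule left_module_homI[OF MQ UV] additive_mapI)+
         (simp_all add: L I pure left_moduleD[OF MQ] MQ.pure_closed)
  next
    case (add s t)
    note S = left_module_homD[OF add(3)] and T = left_module_homD[OF add(4)]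
    have eq: "tzip U V p r (s \<oplus>\<^bsub>X \<boxtimes> Y\<^esub> t) x = tzip U V p r s x \<oplus>\<^bsub>U \<boxtimes> V\<^esub> tzip U V p r t x"
      if "x \<in> carrier (M \<boxtimes> Q)" for x
      by (rule L(2)[OF that add(1,2)])
    show ?case
      by (rule left_module_homI[OF MQ UV] additive_mapI)+
         (simp_all add: eq S(4-6) T(4-6) UV.a_ac left_moduleD[OF MQ] left_moduleD[OF UV])
  qed
  show "bilinear (X \<boxtimes> Y) (M \<boxtimes> Q) (U \<boxtimes> V) (tzip U V p r)"
    by (auto simp: bilinear_map_def XY MQ right L0(1))
qed

lemma tensor_induct_K [consumes 3, case_names pure add]:
  assumes "left_module K X" "left_module K Y" "t \<in> carrier (X \<boxtimes> Y)"
    and "\<And>x y. x \<in> carrier X \<Longrightarrow> y \<in> carrier Y \<Longrightarrow> P (pure_tensor (X \<boxtimes> Y) x y)"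
    and "\<And>s t. s \<in> carrier (X \<boxtimes> Y) \<Longrightarrow> t \<in> carrier (X \<boxtimes> Y) \<Longrightarrow> P s \<Longrightarrow> P t \<Longrightarrow> P (s \<oplus>\<^bsub>X \<boxtimes> Y\<^esub> t)"
  shows "P t"
  by (rule tensor_product.tensor_induct[OF tensor_product_K[OF assms(1,2)] assms(3)]) (use assms in auto)

text \<open>
  Both sides are additive in \<open>s\<close> and \<open>t\<close>, so it suffices that each factor is compatible with the
  linear maps.
\<close>

lemma zip_map:
  assumes p: "bilinear X M U p" and r: "bilinear Y Q V r"
    and p': "bilinear X' M' U' p'" and r': "bilinear Y' Q' V' r'"
    and lin: "linear X X' gX" "linear M M' gM" "linear U U' gU"
      "linear Y Y' hY" "linear Q Q' hQ" "linear V V' hV"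
    and g: "\<And>x m. x \<in> carrier X \<Longrightarrow> m \<in> carrier M \<Longrightarrow> gU (p x m) = p' (gX x) (gM m)"
    and h: "\<And>y q. y \<in> carrier Y \<Longrightarrow> q \<in> carrier Q \<Longrightarrow> hV (r y q) = r' (hY y) (hQ q)"
    and s: "s \<in> carrier (X \<boxtimes> Y)" and t: "t \<in> carrier (M \<boxtimes> Q)"
  shows "tensor_map (U' \<boxtimes> V') gU hV (tzip U V p r s t) =
    tzip U' V' p' r' (tensor_map (X' \<boxtimes> Y') gX hY s) (tensor_map (M' \<boxtimes> Q') gM hQ t)"
proof -
  note P = bilinear_mapD[OF p] and R = bilinear_mapD[OF r]
  note Z = bilinear_mapD(4-6)[OF zip_bilinear(1)[OF p r]] zip_bilinear(2)[OF p r]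
  note Z' = bilinear_mapD(4-6)[OF zip_bilinear(1)[OF p' r']] zip_bilinear(2)[OF p' r']
  note TX = left_module_homD(4,5)[OF tensor_map_linear(1)[OF lin(1,4)]] tensor_map_linear(2)[OF lin(1,4)]
  note TM = left_module_homD(4,5)[OF tensor_map_linear(1)[OF lin(2,5)]] tensor_map_linear(2)[OF lin(2,5)]
  note TU = left_module_homD(4,5)[OF tensor_map_linear(1)[OF lin(3,6)]] tensor_map_linear(2)[OF lin(3,6)]
  note C = lin[THEN left_module_homD(4)]
  show ?thesis
    using P(1) R(1) s
  proof (induction s rule: tensor_induct_K)
    case pxy: (pure x y)
    note cl = pure_simps(1)[OF P(1) R(1) pxy]
    show ?case
      using P(2) R(2) t
    proof (induction t rule: tensor_induct_K)
      case (pure m q)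
      then show ?case using pxy by (simp add: Z Z' TX TM TU C P R g h)
    next
      case (add t t')
      then show ?case using cl by (simp add: Z Z' TX(1,2) TM(1,2) TU(1,2))
    qed
  next
    case (add s s')
    then show ?case using t by (simp add: Z Z' TX(1,2) TM(1,2) TU(1,2))
  qed
qed

lemma tensor_map_id:
  assumes "left_module K X" "left_module K Y" "t \<in> carrier (X \<boxtimes> Y)"
  shows "tensor_map (X \<boxtimes> Y) (\<lambda>x. x) (\<lambda>y. y) t = t"
proof -
  note T = tensor_map_linear[OF assms(1,2)[THEN left_module_hom_id]]
  show ?thesis
    using assms by (induction t rule: tensor_induct_K) (simp_all add: T(2) left_module_homD(5)[OF T(1)])
qed

lemma zip_swap:
  assumes p: "bilinear X M U p" and r: "bilinear Y Q V r"
    and s: "s \<in> carrier (X \<boxtimes> Y)" and t: "t \<in> carrier (M \<boxtimes> Q)"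
  shows "tzip U V (\<lambda>m x. p x m) (\<lambda>q y. r y q) t s = tzip U V p r s t"
proof -
  note P = bilinear_mapD[OF p] and R = bilinear_mapD[OF r]
  note Z = bilinear_mapD(4-6)[OF zip_bilinear(1)[OF p r]] zip_bilinear(2)[OF p r]
  note p' = bilinear_map_swap[OF p] and r' = bilinear_map_swap[OF r]
  note Z' = bilinear_mapD(4-6)[OF zip_bilinear(1)[OF p' r']] zip_bilinear(2)[OF p' r']
  show ?thesis
    using P(1) R(1) s
  proof (induction s rule: tensor_induct_K)
    case pxy: (pure x y)
    note cl = pure_simps(1)[OF P(1) R(1) pxy]
    show ?case
      using P(2) R(2) t
    proof (induction t rule: tensor_induct_K)
      case (pure m q)
      then show ?case using pxy by (simp add: Z Z')
    next
      case (add t t')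
      then show ?case using cl by (simp add: Z Z')
    qed
  next
    case (add s s')
    then show ?case using t by (simp add: Z Z')
  qed
qed

text \<open>
  The left side is \<open>(s \<cdot> s') \<cdot> t\<close> and the right side is \<open>s \<cdot> (s' \<cdot> t)\<close>, where each dot is a zipped map. Four
  different products are allowed so that the law covers the associativity of an action, the
  balancedness of \<open>\<alpha>\<close> and the equivariance of \<open>\<alpha>\<close>.
\<close>

lemma zip_assoc:
  assumes p1: "bilinear X X' A p1" and r1: "bilinear Y Y' C r1"
    and p2: "bilinear A M U p2" and r2: "bilinear C Q V r2"
    and p3: "bilinear X' M N p3" and r3: "bilinear Y' Q D r3"
    and p4: "bilinear X N U p4" and r4: "bilinear Y D V r4"
    and p: "\<And>x x' m. x \<in> carrier X \<Longrightarrow> x' \<in> carrier X' \<Longrightarrow> m \<in> carrier M \<Longrightarrow>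
      p2 (p1 x x') m = p4 x (p3 x' m)"
    and r: "\<And>y y' q. y \<in> carrier Y \<Longrightarrow> y' \<in> carrier Y' \<Longrightarrow> q \<in> carrier Q \<Longrightarrow>
      r2 (r1 y y') q = r4 y (r3 y' q)"
    and s: "s \<in> carrier (X \<boxtimes> Y)" and s': "s' \<in> carrier (X' \<boxtimes> Y')" and t: "t \<in> carrier (M \<boxtimes> Q)"
  shows "tzip U V p2 r2 (tzip A C p1 r1 s s') t = tzip U V p4 r4 s (tzip N D p3 r3 s' t)"
proof -
  note Z1 = bilinear_mapD(4-6)[OF zip_bilinear(1)[OF p1 r1]] zip_bilinear(2)[OF p1 r1]
  note Z2 = bilinear_mapD(4-6)[OF zip_bilinear(1)[OF p2 r2]] zip_bilinear(2)[OF p2 r2]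
  note Z3 = bilinear_mapD(4-6)[OF zip_bilinear(1)[OF p3 r3]] zip_bilinear(2)[OF p3 r3]
  note Z4 = bilinear_mapD(4-6)[OF zip_bilinear(1)[OF p4 r4]] zip_bilinear(2)[OF p4 r4]
  note P1 = bilinear_mapD[OF p1] and R1 = bilinear_mapD[OF r1]
  note P3 = bilinear_mapD[OF p3] and R3 = bilinear_mapD[OF r3]
  show ?thesis
    using P1(1) R1(1) s
  proof (induction s rule: tensor_induct_K)
    case xy: (pure x y)
    note cl = pure_simps(1)[OF P1(1) R1(1) xy]
    show ?case
      using P1(2) R1(2) s'
    proof (induction s' rule: tensor_induct_K)
      case xy': (pure x' y')
      note cl' = pure_simps(1)[OF P1(2) R1(2) xy']
      show ?case
        using P3(2) R3(2) t
      proof (induction t rule: tensor_induct_K)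
        case (pure m q)
        then show ?case using xy xy' by (simp add: Z1 Z2 Z3 Z4 P1(4) R1(4) P3(4) R3(4) p r)
      next
        case (add t t')
        then show ?case using cl cl' by (simp add: Z1(1-3) Z2(1-3) Z3(1-3) Z4(1-3))
      qed
    next
      case (add u u')
      then show ?case using cl t by (simp add: Z1(1-3) Z2(1-3) Z3(1-3) Z4(1-3))
    qed
  next
    case (add u u')
    then show ?case using s' t by (simp add: Z1(1-3) Z2(1-3) Z3(1-3) Z4(1-3))
  qed
qed

lemma tensor_assoc_linear:
  assumes X: "left_module K X" and Y: "left_module K Y" and Z: "left_module K Z"
  shows "linear (X \<boxtimes> (Y \<boxtimes> Z)) ((X \<boxtimes> Y) \<boxtimes> Z) (tensor_assoc (X \<boxtimes> Y) ((X \<boxtimes> Y) \<boxtimes> Z))"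
    and "x \<in> carrier X \<Longrightarrow> y \<in> carrier Y \<Longrightarrow> z \<in> carrier Z \<Longrightarrow>
      tensor_assoc (X \<boxtimes> Y) ((X \<boxtimes> Y) \<boxtimes> Z) (pure_tensor (X \<boxtimes> (Y \<boxtimes> Z)) x (pure_tensor (Y \<boxtimes> Z) y z)) =
      pure_tensor ((X \<boxtimes> Y) \<boxtimes> Z) (pure_tensor (X \<boxtimes> Y) x y) z"
proof -
  let ?T = "(X \<boxtimes> Y) \<boxtimes> Z"
  note XY = left_module_tensor[OF X Y] and YZ = left_module_tensor[OF Y Z]
  note T = left_module_tensor[OF XY Z]
  interpret A: abelian_group ?T by (rule abelian_group_tensor[OF XY Z])
  define inner where "inner x = tensor_lift ?T (\<lambda>y z. pure_tensor ?T (pure_tensor (X \<boxtimes> Y) x y) z)" for x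
  note pb = pure_bilinear[OF X Y] and pT = pure_bilinear[OF XY Z]
  have "bilinear Y Z ?T (\<lambda>y z. pure_tensor ?T (pure_tensor (X \<boxtimes> Y) x y) z)" if "x \<in> carrier X" for x
    by (rule bilinear_map_compose[OF pT bilinear_map_right[OF pb that] left_module_hom_id[OF Z]])
  note I0 = lift_linear[OF this, folded inner_def]
  note I = left_module_homD(4-6)[OF I0(1)] I0(2)
  note pz = bilinear_mapD(4-8)[OF pb] bilinear_mapD(4-8)[OF pT]
  have left: "linear X ?T (\<lambda>x. inner x w)" if "w \<in> carrier (Y \<boxtimes> Z)" for w
    using Y Z that
  proof (induction w rule: tensor_induct_K)
    case (pure y z)
    show ?case
      by (rule left_module_homI[OF X T] additive_mapI)+
         (simp_all add: I pz pure left_moduleD[OF X])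
  next
    case (add s t)
    note S = left_module_homD[OF add(3)] and S' = left_module_homD[OF add(4)]
    show ?case
      by (rule left_module_homI[OF X T] additive_mapI)+
         (simp_all add: I add(1,2) S(4-6) S'(4-6) A.a_ac left_moduleD[OF X] left_moduleD[OF T])
  qed
  have "bilinear X (Y \<boxtimes> Z) ?T inner"
    using left I0(1) by (auto simp: bilinear_map_def X YZ)
  note L = lift_linear[OF this]
  have eq: "tensor_assoc (X \<boxtimes> Y) ?T = tensor_lift ?T inner"
    unfolding tensor_assoc_def inner_def[abs_def] ..
  show "linear (X \<boxtimes> (Y \<boxtimes> Z)) ?T (tensor_assoc (X \<boxtimes> Y) ?T)"
    unfolding eq by (rule L(1))
  show "tensor_assoc (X \<boxtimes> Y) ?T (pure_tensor (X \<boxtimes> (Y \<boxtimes> Z)) x (pure_tensor (Y \<boxtimes> Z) y z)) =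
      pure_tensor ?T (pure_tensor (X \<boxtimes> Y) x y) z"
    if "x \<in> carrier X" "y \<in> carrier Y" "z \<in> carrier Z"
    unfolding eq using that by (simp add: L(2) I(4) pure_simps(1)[OF Y Z])
qed

end

section \<open>Algebras, bialgebras and comodule algebras\<close>

lemma assoc_algebraD:
  assumes "assoc_algebra K A"
  shows "comm_scalars K" "cring K" "ring A" "left_module K A"
    "bilinear_map K A A A (monoid.mult A)"
proof -
  interpret assoc_algebra K A by (rule assms)
  show K: "cring K" by (rule cring_axioms)
  then show "comm_scalars K" by unfold_locales
  show "ring A" by (rule A.ring_axioms)
  show l: "left_module K A"
    by (rule left_moduleI)
      (simp_all add: smult_l_distr smult_r_distr smult_assoc1 cring.axioms(1)[OF K] abelian_group_axioms)
  show "bilinear_map K A A A (monoid.mult A)"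
    by (rule bilinear_mapI[OF l l l])
      (simp_all add: A.l_distr A.r_distr smult_mult_left smult_mult_right)
qed

lemma alg_homD:
  assumes "h \<in> alg_hom K A C"
  shows "h \<in> carrier A \<rightarrow> carrier C"
    "\<And>x. x \<in> carrier A \<Longrightarrow> h x \<in> carrier C"
    "\<And>x y. x \<in> carrier A \<Longrightarrow> y \<in> carrier A \<Longrightarrow> h (x \<oplus>\<^bsub>A\<^esub> y) = h x \<oplus>\<^bsub>C\<^esub> h y"
    "\<And>x y. x \<in> carrier A \<Longrightarrow> y \<in> carrier A \<Longrightarrow> h (x \<otimes>\<^bsub>A\<^esub> y) = h x \<otimes>\<^bsub>C\<^esub> h y"
    "h \<one>\<^bsub>A\<^esub> = \<one>\<^bsub>C\<^esub>"
    "\<And>c x. c \<in> carrier K \<Longrightarrow> x \<in> carrier A \<Longrightarrow> h (c \<odot>\<^bsub>A\<^esub> x) = c \<odot>\<^bsub>C\<^esub> h x"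
  using assms by (auto simp: alg_hom_def ring_hom_def)

lemma alg_hom_linear:
  assumes "h \<in> alg_hom K A C" "left_module K A" "left_module K C"
  shows "left_module_hom K A C h"
  using alg_homD[OF assms(1)] assms(2,3) by (auto simp: left_module_hom_def)

context comm_scalars
begin

lemma tensor_mult: "s \<otimes>\<^bsub>X \<boxtimes> Y\<^esub> t = tzip X Y (monoid.mult X) (monoid.mult Y) s t"
proof -
  have eq: "tensor_zip (tensor K X Y) (monoid.mult X) (monoid.mult Y) = tzip X Y (monoid.mult X) (monoid.mult Y)"
    by (rule tensor_zip_record_cong) (simp_all add: tensor_K_def Let_def)
  show ?thesis
    unfolding eq[symmetric] by (simp add: tensor_K_def Let_def tensor_zip_def)
qed

lemma tensor_one: "\<one>\<^bsub>X \<boxtimes> Y\<^esub> = pure_tensor (X \<boxtimes> Y) \<one>\<^bsub>X\<^esub> \<one>\<^bsub>Y\<^esub>"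
  by (simp add: tensor_K_def Let_def pure_tensor_def)

definition delta_K :: "('k, 'b) bialg \<Rightarrow> ('k, 'm, 'q) module_scheme \<Rightarrow> ('m, 'b) tensor \<Rightarrow> (('m, 'b) tensor, 'b) tensor"
  where "delta_K B M t =
    tensor_assoc (M \<boxtimes> B) ((M \<boxtimes> B) \<boxtimes> B) (tensor_map (M \<boxtimes> (B \<boxtimes> B)) (\<lambda>m. m) (comult B) t)"

end

lemma bialgebraD:
  assumes "bialgebra K B"
  shows "assoc_algebra K B" "comult B \<in> alg_hom K B (tensor_K K B B)" "counit B \<in> alg_hom K B (regular K)"
    "left_module K B" "left_module_hom K B (tensor_K K B B) (comult B)"
proof -
  interpret bialgebra K B by (rule assms)
  show a: "assoc_algebra K B" by (rule assoc_algebra_axioms)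
  interpret comm_scalars K by (rule assoc_algebraD[OF a])
  show "comult B \<in> alg_hom K B (tensor_K K B B)" "counit B \<in> alg_hom K B (regular K)"
    by (rule comult_hom counit_hom)+
  show l: "left_module K B" by (rule assoc_algebraD[OF a])
  show "left_module_hom K B (tensor_K K B B) (comult B)"
    by (rule alg_hom_linear[OF comult_hom l left_module_tensor[OF l l]])
qed

lemma comodule_algebraD:
  assumes "comodule_algebra K B E" "bialgebra K B"
  shows "assoc_algebra K E" "coact E \<in> alg_hom K E (tensor_K K E B)"
    "left_module K E" "left_module_hom K E (tensor_K K E B) (coact E)"
proof -
  interpret comodule_algebra K B E by (rule assms)
  show a: "assoc_algebra K E" by (rule assoc_algebra_axioms)
  interpret comm_scalars K by (rule assoc_algebraD[OF a])
  show "coact E \<in> alg_hom K E (tensor_K K E B)" by (rule coact_hom)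
  show l: "left_module K E" by (rule assoc_algebraD[OF a])
  show "left_module_hom K E (tensor_K K E B) (coact E)"
    by (rule alg_hom_linear[OF coact_hom l left_module_tensor[OF l bialgebraD(4)[OF assms(2)]]])
qed

context comm_scalars
begin

lemma delta_K_linear:
  assumes B: "bialgebra K B" and M: "left_module K M"
  shows "linear (M \<boxtimes> B) ((M \<boxtimes> B) \<boxtimes> B) (delta_K B M)"
    and "m \<in> carrier M \<Longrightarrow> b \<in> carrier B \<Longrightarrow> delta_K B M (pure_tensor (M \<boxtimes> B) m b) =
      tensor_assoc (M \<boxtimes> B) ((M \<boxtimes> B) \<boxtimes> B) (pure_tensor (M \<boxtimes> (B \<boxtimes> B)) m (comult B b))"
proof -
  note L = bialgebraD(4)[OF B]
  note T = tensor_map_linear[OF left_module_hom_id[OF M] bialgebraD(5)[OF B]]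
  show "linear (M \<boxtimes> B) ((M \<boxtimes> B) \<boxtimes> B) (delta_K B M)"
    unfolding delta_K_def[abs_def]
    by (rule left_module_hom_compose[OF tensor_assoc_linear(1)[OF M L L] T(1)])
  show "delta_K B M (pure_tensor (M \<boxtimes> B) m b) =
      tensor_assoc (M \<boxtimes> B) ((M \<boxtimes> B) \<boxtimes> B) (pure_tensor (M \<boxtimes> (B \<boxtimes> B)) m (comult B b))"
    if "m \<in> carrier M" "b \<in> carrier B"
    by (simp add: delta_K_def T(2) that)
qed

lemma bialg_homD:
  assumes "\<phi> \<in> bialg_hom K B B'" "bialgebra K B" "bialgebra K B'"
  shows "\<phi> \<in> alg_hom K B B'" "linear B B' \<phi>"
    "\<And>b. b \<in> carrier B \<Longrightarrow> comult B' (\<phi> b) = tensor_map (B' \<boxtimes> B') \<phi> \<phi> (comult B b)"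
    "\<And>b. b \<in> carrier B \<Longrightarrow> counit B' (\<phi> b) = counit B b"
    "bilinear B' B B' (\<lambda>y b. y \<otimes>\<^bsub>B'\<^esub> \<phi> b)"
proof -
  show a: "\<phi> \<in> alg_hom K B B'" using assms(1) by (simp add: bialg_hom_def)
  show l: "linear B B' \<phi>"
    by (rule alg_hom_linear[OF a bialgebraD(4)[OF assms(2)] bialgebraD(4)[OF assms(3)]])
  show "bilinear B' B B' (\<lambda>y b. y \<otimes>\<^bsub>B'\<^esub> \<phi> b)"
    by (rule bilinear_map_compose[OF assoc_algebraD(5) left_module_hom_id l])
       (rule bialgebraD[OF assms(3)])+
qed (use assms in \<open>auto simp: bialg_hom_def\<close>)

lemma tensor_mult_map:
  assumes A: "assoc_algebra K A" and C: "assoc_algebra K C"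
    and g: "linear X A g" and h: "linear Y C h"
    and s: "s \<in> carrier (A \<boxtimes> C)" and u: "u \<in> carrier (X \<boxtimes> Y)"
  shows "s \<otimes>\<^bsub>A \<boxtimes> C\<^esub> tensor_map (A \<boxtimes> C) g h u =
    tzip A C (\<lambda>x u. x \<otimes>\<^bsub>A\<^esub> g u) (\<lambda>y v. y \<otimes>\<^bsub>C\<^esub> h v) s u"
proof -
  note DA = assoc_algebraD(4,5)[OF A] and DC = assoc_algebraD(4,5)[OF C]
  note iA = left_module_hom_id[OF DA(1)] and iC = left_module_hom_id[OF DC(1)]
  note p = bilinear_map_compose[OF DA(2) iA g] and r = bilinear_map_compose[OF DC(2) iC h]
  have "tensor_map (A \<boxtimes> C) (\<lambda>z. z) (\<lambda>z. z) (tzip A C (\<lambda>x u. x \<otimes>\<^bsub>A\<^esub> g u) (\<lambda>y v. y \<otimes>\<^bsub>C\<^esub> h v) s u) =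
    tzip A C (monoid.mult A) (monoid.mult C)
      (tensor_map (A \<boxtimes> C) (\<lambda>z. z) (\<lambda>z. z) s) (tensor_map (A \<boxtimes> C) g h u)"
    by (rule zip_map[OF p r DA(2) DC(2) iA g iA iC h iC _ _ s u]) simp_all
  then show ?thesis
    by (simp add: tensor_map_id DA(1) DC(1) bilinear_mapD(4)[OF zip_bilinear(1)[OF p r]] s u tensor_mult)
qed

lemma comult_translate:
  assumes B: "bialgebra K B" and B': "bialgebra K B'" and \<phi>: "\<phi> \<in> bialg_hom K B B'"
    and y: "y \<in> carrier B'" and b: "b \<in> carrier B"
  shows "comult B' (y \<otimes>\<^bsub>B'\<^esub> \<phi> b) =
    tzip B' B' (\<lambda>y b. y \<otimes>\<^bsub>B'\<^esub> \<phi> b) (\<lambda>y b. y \<otimes>\<^bsub>B'\<^esub> \<phi> b) (comult B' y) (comult B b)"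
proof -
  note F = bialg_homD[OF \<phi> B B'] and D = bialgebraD[OF B] and D' = bialgebraD[OF B']
  have "comult B' (y \<otimes>\<^bsub>B'\<^esub> \<phi> b) = comult B' y \<otimes>\<^bsub>B' \<boxtimes> B'\<^esub> comult B' (\<phi> b)"
    by (rule alg_homD(4)[OF D'(2) y left_module_homD(4)[OF F(2) b]])
  then show ?thesis
    using left_module_homD(4)[OF D(5) b] left_module_homD(4)[OF D'(5) y]
    by (simp add: F(3) b tensor_mult_map[OF D'(1) D'(1) F(2) F(2)])
qed

text \<open>
  For a coaction \<open>\<rho>'(e) = \<Sum> x \<otimes> y\<close> and \<open>t = m \<otimes> b\<close>, both sides are sums of terms
  \<open>(p x\<^sub>0 m \<otimes> y\<^sub>1 \<phi>(b\<^sub>1)) \<otimes> y\<^sub>2 \<phi>(b\<^sub>2)\<close> with \<open>\<Delta>(b) = \<Sum> b\<^sub>1 \<otimes> b\<^sub>2\<close>. On the left the triple \<open>x\<^sub>0, y\<^sub>1, y\<^sub>2\<close>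
  comes from applying \<open>\<Delta>\<close> to \<open>y\<close>, because \<open>\<Delta>(y \<phi>(b)) = \<Delta>(y) (\<phi> \<otimes> \<phi>)(\<Delta>(b))\<close>. On the right it comes from
  applying \<open>\<rho>'\<close> to \<open>x\<close>. The two triples agree by the coassociativity of \<open>\<rho>'\<close>.
\<close>

lemma coaction_comult:
  assumes B: "bialgebra K B" and B': "bialgebra K B'" and \<phi>: "\<phi> \<in> bialg_hom K B B'"
    and E': "comodule_algebra K B' E'" and p: "bilinear E' M U p"
    and e: "e \<in> carrier E'" and t: "t \<in> carrier (M \<boxtimes> B)"
  shows "delta_K B' U (tzip U B' p (\<lambda>y b. y \<otimes>\<^bsub>B'\<^esub> \<phi> b) (coact E' e) t) =
    tzip (U \<boxtimes> B') B' (\<lambda>x t. tzip U B' p (\<lambda>y b. y \<otimes>\<^bsub>B'\<^esub> \<phi> b) (coact E' x) t)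
      (\<lambda>y b. y \<otimes>\<^bsub>B'\<^esub> \<phi> b) (coact E' e) (delta_K B M t)"
proof -
  define r where "r y b = y \<otimes>\<^bsub>B'\<^esub> \<phi> b" for y b
  define \<Lambda> where "\<Lambda> = tzip U B' p r"
  define q where "q x t = \<Lambda> (coact E' x) t" for x t
  note F = bialg_homD[OF \<phi> B B'] and D = bialgebraD[OF B] and D' = bialgebraD[OF B']
  note C = comodule_algebraD[OF E' B']
  note P = bilinear_mapD[OF p]
  note LB = D(4) and LB' = D'(4) and LE = C(3)
  have r: "bilinear B' B B' r" using F(5) unfolding r_def[abs_def] .
  note R = bilinear_mapD(4-6)[OF r]
  note \<Lambda>0 = zip_bilinear[OF p r, folded \<Lambda>_def]
  note \<Lambda> = bilinear_mapD(4-6)[OF \<Lambda>0(1)] \<Lambda>0(2)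
  note LMB = left_module_tensor[OF P(2) LB]
    and LEB = left_module_tensor[OF LE LB']
  have q: "bilinear E' (M \<boxtimes> B) (U \<boxtimes> B') q"
    unfolding q_def[abs_def]
    by (rule bilinear_map_compose[OF \<Lambda>0(1) C(4) left_module_hom_id[OF LMB]])
  note Z0 = zip_bilinear[OF q r]
  note Z = bilinear_mapD(4-6)[OF Z0(1)] Z0(2)
  note \<delta>U = left_module_homD(4,5)[OF delta_K_linear(1)[OF B' P(3)]] delta_K_linear(2)[OF B' P(3)]
  note \<delta>M = left_module_homD(4,5)[OF delta_K_linear(1)[OF B P(2)]] delta_K_linear(2)[OF B P(2)]
  note aU0 = tensor_assoc_linear[OF P(3) LB' LB'] and aM0 = tensor_assoc_linear[OF P(2) LB LB]
    and aE0 = tensor_assoc_linear[OF LE LB' LB']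
  note aU = left_module_homD(4,5)[OF aU0(1)] aU0(2)
    and aM = left_module_homD(4,5)[OF aM0(1)] aM0(2)
    and aE = left_module_homD(4,5)[OF aE0(1)] aE0(2)
  note comult = left_module_homD(4,5)[OF D(5)] and comult' = left_module_homD(4,5)[OF D'(5)]
    and coact = left_module_homD(4,5)[OF C(4)]
  note LBB = left_module_tensor[OF LB LB] and LBB' = left_module_tensor[OF LB' LB']
  note rr = zip_bilinear[OF r r]
  note RR = bilinear_mapD(4-6)[OF rr(1)] rr(2)
  have on_pure: "delta_K B' U (\<Lambda> (coact E' e) (pure_tensor (M \<boxtimes> B) m b)) =
    tzip (U \<boxtimes> B') B' q r (coact E' e) (delta_K B M (pure_tensor (M \<boxtimes> B) m b))"
    if m: "m \<in> carrier M" and b: "b \<in> carrier B" for m b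
  proof -
    have mb: "pure_tensor (M \<boxtimes> B) m b \<in> carrier (M \<boxtimes> B)" if "b \<in> carrier B" for b
      using that m by (simp add: pure_simps P(2) LB)
    have \<Delta>b: "comult B b \<in> carrier (B \<boxtimes> B)" by (rule comult(1)[OF b])
    \<comment> \<open>Zipping \<open>p'\<close> with \<open>r\<close> is the map on \<open>((E' \<otimes> B') \<otimes> B') \<times> (B \<otimes> B)\<close> through which both sides factor.\<close>
    define p' where "p' s b = \<Lambda> s (pure_tensor (M \<boxtimes> B) m b)" for s b
    have p': "bilinear (E' \<boxtimes> B') B (U \<boxtimes> B') p'"
      unfolding p'_def[abs_def]
      by (rule bilinear_map_compose[OF \<Lambda>0(1) left_module_hom_id[OF LEB]
            bilinear_map_right[OF pure_bilinear[OF P(2) LB] m]])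
    have p'_pure: "p' (pure_tensor (E' \<boxtimes> B') x y) b = pure_tensor (U \<boxtimes> B') (p x m) (r y b)"
      if "x \<in> carrier E'" "y \<in> carrier B'" "b \<in> carrier B" for x y b
      using that m by (simp add: p'_def \<Lambda>(4))
    have p'_coact: "p' (coact E' x) b = q x (pure_tensor (M \<boxtimes> B) m b)" for x b
      by (simp add: p'_def q_def)
    note \<Psi>0 = zip_bilinear[OF p' r]
    note \<Psi> = bilinear_mapD(4-6)[OF \<Psi>0(1)] \<Psi>0(2)
    note tE = tensor_map_linear[OF left_module_hom_id[OF LE] D'(5)]
    note TE = left_module_homD(4,5)[OF tE(1)] tE(2)
    note tc = tensor_map_linear[OF C(4) left_module_hom_id[OF LB']]
    note TC = left_module_homD(4,5)[OF tc(1)] tc(2)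
    have step1: "tensor_assoc (U \<boxtimes> B') ((U \<boxtimes> B') \<boxtimes> B')
        (pure_tensor (U \<boxtimes> (B' \<boxtimes> B')) (p x m) (tzip B' B' r r v w)) =
      tzip (U \<boxtimes> B') B' p' r (tensor_assoc (E' \<boxtimes> B') ((E' \<boxtimes> B') \<boxtimes> B') (pure_tensor (E' \<boxtimes> (B' \<boxtimes> B')) x v)) w"
      if x: "x \<in> carrier E'" and v: "v \<in> carrier (B' \<boxtimes> B')" and w: "w \<in> carrier (B \<boxtimes> B)" for x v w
      using LB' LB' v
    proof (induction v rule: tensor_induct_K)
      case y: (pure y1 y2)
      show ?case
        using LB LB w
      proof (induction w rule: tensor_induct_K)
        case (pure b1 b2)
        then show ?case
          using x y m by (simp add: RR(4) aU(3) aE(3) \<Psi>(4) p'_pure P(4) R(1) pure_simps(1) LE LB')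
      next
        case (add w w')
        then show ?case using x y m
          by (simp add: RR(1-3) aU(1,2) aE(1,2) \<Psi>(1-3) P(4) pure_simps(1-3) LE LB' P(3) LBB')
      qed
    next
      case (add v v')
      then show ?case using x w m
        by (simp add: RR(1-3) aU(1,2) aE(1,2) \<Psi>(1-3) P(4) pure_simps(1-3) LE LB' P(3) LBB')
    qed
    have left: "delta_K B' U (\<Lambda> s (pure_tensor (M \<boxtimes> B) m b)) =
      tzip (U \<boxtimes> B') B' p' r (tensor_assoc (E' \<boxtimes> B') ((E' \<boxtimes> B') \<boxtimes> B')
        (tensor_map (E' \<boxtimes> (B' \<boxtimes> B')) (\<lambda>x. x) (comult B') s)) (comult B b)"
      if s: "s \<in> carrier (E' \<boxtimes> B')" for s
      using LE LB' s
    proof (induction s rule: tensor_induct_K)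
      case (pure x y)
      then show ?case
        using m b \<Delta>b by (simp add: \<Lambda>(4) \<delta>U(3) P(4) R(1) TE(3) comult'(1) flip: step1)
          (simp add: r_def[abs_def] comult_translate[OF B B' \<phi>])
    next
      case (add s s')
      then show ?case
        using mb[OF b] \<Delta>b by (simp add: \<Lambda>(1-3) \<delta>U(1,2) TE(1,2) aE(1,2) \<Psi>(1-3))
    qed
    have step2: "tzip (U \<boxtimes> B') B' q r (pure_tensor (E' \<boxtimes> B') x y)
        (tensor_assoc (M \<boxtimes> B) ((M \<boxtimes> B) \<boxtimes> B) (pure_tensor (M \<boxtimes> (B \<boxtimes> B)) m w)) =
      tzip (U \<boxtimes> B') B' p' r (pure_tensor ((E' \<boxtimes> B') \<boxtimes> B') (coact E' x) y) w"
      if x: "x \<in> carrier E'" and y: "y \<in> carrier B'" and w: "w \<in> carrier (B \<boxtimes> B)" for x y w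
      using LB LB w
    proof (induction w rule: tensor_induct_K)
      case (pure b1 b2)
      then show ?case
        using x y m by (simp add: Z(4) aM(3) \<Psi>(4) p'_coact mb coact(1))
    next
      case (add w w')
      then show ?case
        using x y m by (simp add: Z(1-3) aM(1,2) \<Psi>(1-3) pure_simps(1-3) coact(1) LE LB' LEB P(2) LBB)
    qed
    have right: "tzip (U \<boxtimes> B') B' q r s (delta_K B M (pure_tensor (M \<boxtimes> B) m b)) =
      tzip (U \<boxtimes> B') B' p' r (tensor_map ((E' \<boxtimes> B') \<boxtimes> B') (coact E') (\<lambda>y. y) s) (comult B b)"
      if s: "s \<in> carrier (E' \<boxtimes> B')" for s
      using LE LB' s
    proof (induction s rule: tensor_induct_K)
      case (pure x y)
      then show ?case
        using m b \<Delta>b by (simp add: \<delta>M(3) TC(3) step2)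
    next
      case (add s s')
      then show ?case
        using mb[OF b] \<Delta>b by (simp add: \<delta>M(1) Z(1-3) TC(1,2) \<Psi>(1-3))
    qed
    show ?thesis
      using comodule_algebra.coact_coassoc[OF E' e]
      by (simp add: left right coact(1) e Let_def)
  qed
  have "delta_K B' U (\<Lambda> (coact E' e) t) = tzip (U \<boxtimes> B') B' q r (coact E' e) (delta_K B M t)"
    using P(2) LB t
  proof (induction t rule: tensor_induct_K)
    case (pure m b)
    then show ?case by (rule on_pure)
  next
    case (add t t')
    then show ?case using coact(1)[OF e]
      by (simp add: \<Lambda>(1-3) \<delta>U(1,2) \<delta>M(1,2) Z(1-3))
  qed
  then show ?thesis
    by (simp add: \<Lambda>_def q_def[abs_def] r_def[abs_def])
qed

definition epsilon_K :: "('k, 'b) bialg \<Rightarrow> ('k, 'm, 'q) module_scheme \<Rightarrow> ('m, 'b) tensor \<Rightarrow> 'm"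
  where "epsilon_K B M = tensor_lift M (\<lambda>m b. counit B b \<odot>\<^bsub>M\<^esub> m)"

lemma counitD:
  assumes B: "bialgebra K B"
  shows "\<And>b. b \<in> carrier B \<Longrightarrow> counit B b \<in> carrier K"
    "\<And>b b'. b \<in> carrier B \<Longrightarrow> b' \<in> carrier B \<Longrightarrow> counit B (b \<oplus>\<^bsub>B\<^esub> b') = counit B b \<oplus>\<^bsub>K\<^esub> counit B b'"
    "\<And>b b'. b \<in> carrier B \<Longrightarrow> b' \<in> carrier B \<Longrightarrow> counit B (b \<otimes>\<^bsub>B\<^esub> b') = counit B b \<otimes>\<^bsub>K\<^esub> counit B b'"
    "\<And>c b. c \<in> carrier K \<Longrightarrow> b \<in> carrier B \<Longrightarrow> counit B (c \<odot>\<^bsub>B\<^esub> b) = c \<otimes>\<^bsub>K\<^esub> counit B b"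
  using alg_homD[OF bialgebraD(3)[OF B]] by (simp_all add: regular_def)

lemma counit_bilinear:
  assumes B: "bialgebra K B" and M: "left_module K M"
  shows "bilinear M B M (\<lambda>m b. counit B b \<odot>\<^bsub>M\<^esub> m)"
  by (rule bilinear_mapI[OF M bialgebraD(4)[OF B] M])
    (simp_all add: counitD[OF B] left_moduleD[OF M] smult_commute[OF M])

text \<open>
  The counit is multiplicative and satisfies \<open>\<epsilon>' \<circ> \<phi> = \<epsilon>\<close>, so \<open>\<epsilon>'(y \<phi>(b))\<close> splits into \<open>\<epsilon>'(y) \<epsilon>(b)\<close>. The
  factors \<open>\<epsilon>'(y)\<close> turn \<open>\<rho>'(e)\<close> back into \<open>e\<close>.
\<close>

lemma coaction_counit:
  assumes B: "bialgebra K B" and B': "bialgebra K B'" and \<phi>: "\<phi> \<in> bialg_hom K B B'"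
    and E': "comodule_algebra K B' E'" and p: "bilinear E' M U p"
    and e: "e \<in> carrier E'" and t: "t \<in> carrier (M \<boxtimes> B)"
  shows "epsilon_K B' U (tzip U B' p (\<lambda>y b. y \<otimes>\<^bsub>B'\<^esub> \<phi> b) (coact E' e) t) = p e (epsilon_K B M t)"
proof -
  note F = bialg_homD[OF \<phi> B B'] and D = bialgebraD[OF B] and D' = bialgebraD[OF B']
  note C = comodule_algebraD[OF E' B']
  note P = bilinear_mapD[OF p]
  note \<Lambda>0 = zip_bilinear[OF p F(5)]
  note \<Lambda> = bilinear_mapD(4-6)[OF \<Lambda>0(1)] \<Lambda>0(2)
  note coact = left_module_homD(4,5)[OF C(4)]
  note eU0 = lift_linear[OF counit_bilinear[OF B' P(3)], folded epsilon_K_def]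
  note eM0 = lift_linear[OF counit_bilinear[OF B P(2)], folded epsilon_K_def]
  note eE0 = lift_linear[OF counit_bilinear[OF B' C(3)]]
  note eU = left_module_homD(4,5)[OF eU0(1)] eU0(2) and eM = left_module_homD(4,5)[OF eM0(1)] eM0(2)
    and eE = left_module_homD(4,5)[OF eE0(1)] eE0(2)
  note \<phi>_cl = left_module_homD(4)[OF F(2)]
  note mult = bilinear_mapD(4)[OF F(5)]
  have on_pure: "epsilon_K B' U (tzip U B' p (\<lambda>y b. y \<otimes>\<^bsub>B'\<^esub> \<phi> b) s (pure_tensor (M \<boxtimes> B) m b)) =
    counit B b \<odot>\<^bsub>U\<^esub> p (tensor_lift E' (\<lambda>x y. counit B' y \<odot>\<^bsub>E'\<^esub> x) s) m"
    if m: "m \<in> carrier M" and b: "b \<in> carrier B" and s: "s \<in> carrier (E' \<boxtimes> B')" for m b s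
    using C(3) D'(4) s
  proof (induction s rule: tensor_induct_K)
    case (pure x y)
    have "(counit B' y \<otimes>\<^bsub>K\<^esub> counit B b) \<odot>\<^bsub>U\<^esub> p x m = counit B b \<odot>\<^bsub>U\<^esub> (counit B' y \<odot>\<^bsub>U\<^esub> p x m)"
      using pure m b by (simp add: left_moduleD(6)[OF P(3)] counitD[OF B] counitD[OF B'] P(4) smult_commute[OF P(3)])
    then show ?case
      using pure m b
      by (simp add: \<Lambda>(4) eU(3) eE(3) P mult \<phi>_cl F(4) counitD[OF B'] counitD(1)[OF B])
  next
    case (add s s')
    moreover have "pure_tensor (M \<boxtimes> B) m b \<in> carrier (M \<boxtimes> B)"
      using m b by (simp add: pure_simps P(2) D(4))
    ultimately show ?case
      using m b by (simp add: \<Lambda>(1-3) eU(1,2) eE(1,2) P(4-6) left_moduleD[OF P(3)] counitD(1)[OF B])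
  qed
  show ?thesis
    using P(2) D(4) t
  proof (induction t rule: tensor_induct_K)
    case (pure m b)
    then show ?case
      using comodule_algebra.coact_counit[OF E' e]
      by (simp add: on_pure coact(1) e eM(3) P(8) counitD(1)[OF B])
  next
    case (add t t')
    then show ?case using coact(1)[OF e]
      by (simp add: \<Lambda>(1-3) eU(1,2) eM(1,2) P(6) e)
  qed
qed

end

section \<open>Relative Hopf modules\<close>

lemma vs_of_simps [simp]:
  "carrier (vs_of A M) = carrier M" "\<zero>\<^bsub>vs_of A M\<^esub> = \<zero>\<^bsub>M\<^esub>" "add (vs_of A M) = add M"
  "c \<odot>\<^bsub>vs_of A M\<^esub> m = (c \<odot>\<^bsub>A\<^esub> \<one>\<^bsub>A\<^esub>) \<odot>\<^bsub>M\<^esub> m"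
  by (simp_all add: vs_of_def)

lemma regular_simps [simp]:
  "carrier (regular A) = carrier A" "\<zero>\<^bsub>regular A\<^esub> = \<zero>\<^bsub>A\<^esub>" "add (regular A) = add A"
  "smult (regular A) = monoid.mult A"
  by (simp_all add: regular_def)

lemma abelian_group_cong:
  assumes "abelian_group M" "carrier M = carrier N" "\<zero>\<^bsub>M\<^esub> = \<zero>\<^bsub>N\<^esub>" "add M = add N"
  shows "abelian_group N"
proof -
  interpret M: abelian_group M by (rule assms)
  have eq: "carrier N = carrier M" "\<zero>\<^bsub>N\<^esub> = \<zero>\<^bsub>M\<^esub>" "add N = add M" using assms by auto
  show ?thesis
    by (rule abelian_groupI) (use M.l_neg in \<open>auto simp: eq M.a_ac\<close>)
qed

lemma left_module_regular: "ring A \<Longrightarrow> left_module A (regular A)"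
proof -
  assume A: "ring A"
  interpret ring A by (rule A)
  show ?thesis
    by (rule left_moduleI[OF A abelian_group_cong[OF abelian_group_axioms]])
      (simp_all add: l_distr r_distr m_assoc)
qed

lemma left_module_vs_of:
  assumes A: "assoc_algebra K A" and M: "left_module A M"
  shows "left_module K (vs_of A M)"
proof -
  note D = assoc_algebraD[OF A]
  note L = left_moduleD[OF D(4)] and LM = left_moduleD[OF M]
  interpret A: ring A by (rule D(3))
  have "(a \<otimes>\<^bsub>K\<^esub> b) \<odot>\<^bsub>A\<^esub> \<one>\<^bsub>A\<^esub> = (a \<odot>\<^bsub>A\<^esub> \<one>\<^bsub>A\<^esub>) \<otimes>\<^bsub>A\<^esub> (b \<odot>\<^bsub>A\<^esub> \<one>\<^bsub>A\<^esub>)"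
    if "a \<in> carrier K" "b \<in> carrier K" for a b
    using that by (simp add: bilinear_mapD(7)[OF D(5)] L)
  then show ?thesis
    by (intro left_moduleI[OF cring.axioms(1)[OF D(2)] abelian_group_cong[OF LM(2)]])
      (simp_all add: L LM flip: LM(6))
qed

lemma action_bilinear:
  assumes A: "assoc_algebra K A" and M: "left_module A M"
  shows "bilinear_map K A (vs_of A M) (vs_of A M) (smult M)"
proof -
  note D = assoc_algebraD[OF A]
  note L = left_moduleD[OF D(4)] and LM = left_moduleD[OF M]
  interpret A: ring A by (rule D(3))
  have "(c \<odot>\<^bsub>A\<^esub> \<one>\<^bsub>A\<^esub>) \<otimes>\<^bsub>A\<^esub> x = c \<odot>\<^bsub>A\<^esub> x" "x \<otimes>\<^bsub>A\<^esub> (c \<odot>\<^bsub>A\<^esub> \<one>\<^bsub>A\<^esub>) = c \<odot>\<^bsub>A\<^esub> x"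
    if "c \<in> carrier K" "x \<in> carrier A" for c x
    using that by (simp_all add: bilinear_mapD(7,8)[OF D(5)])
  then show ?thesis
    by (intro bilinear_mapI[OF D(4) left_module_vs_of[OF A M] left_module_vs_of[OF A M]])
      (simp_all add: L LM flip: LM(6))
qed

lemma vs_of_linear:
  assumes A: "assoc_algebra K A" and h: "left_module_hom A M N h"
  shows "left_module_hom K (vs_of A M) (vs_of A N) h"
proof -
  note D = assoc_algebraD[OF A] and H = left_module_homD[OF h]
  interpret A: ring A by (rule D(3))
  show ?thesis
    using left_module_vs_of[OF A H(1)] left_module_vs_of[OF A H(2)] left_moduleD(3)[OF D(4)] H
    by (auto simp: left_module_hom_def)
qed

lemma smult_one_mult:
  assumes "assoc_algebra K A" "c \<in> carrier K" "x \<in> carrier A"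
  shows "(c \<odot>\<^bsub>A\<^esub> \<one>\<^bsub>A\<^esub>) \<otimes>\<^bsub>A\<^esub> x = c \<odot>\<^bsub>A\<^esub> x"
proof -
  interpret A: ring A by (rule assoc_algebraD[OF assms(1)])
  show ?thesis using bilinear_mapD(7)[OF assoc_algebraD(5)[OF assms(1)] assms(2) A.one_closed assms(3)] assms
    by simp
qed

locale comodule_algebra_over = comm_scalars K for K :: "('k, 'p) ring_scheme" +
  fixes B :: "('k, 'b) bialg" and E :: "('k, 'b, 'e) comod_alg"
  assumes bialg: "bialgebra K B" and comod: "comodule_algebra K B E"
begin

lemmas B_facts = bialgebraD[OF bialg]
lemmas E_facts = comodule_algebraD[OF comod bialg]
lemmas ring_B = assoc_algebraD(3)[OF B_facts(1)] and ring_E = assoc_algebraD(3)[OF E_facts(1)]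
lemmas coact_closed = left_module_homD(4)[OF E_facts(4)]
lemmas coact_add = left_module_homD(5)[OF E_facts(4)]
lemmas coact_scale = left_module_homD(6)[OF E_facts(4)]
lemmas coact_mult = alg_homD(4)[OF E_facts(2)]
lemmas coact_one = alg_homD(5)[OF E_facts(2)]

lemma hopf_tensor_records:
  "carrier (hopf_tensor K B E M Q) = carrier (vs_of E M \<boxtimes> vs_of B Q)"
  "\<zero>\<^bsub>hopf_tensor K B E M Q\<^esub> = \<zero>\<^bsub>vs_of E M \<boxtimes> vs_of B Q\<^esub>"
  "add (hopf_tensor K B E M Q) = add (vs_of E M \<boxtimes> vs_of B Q)"
  by (simp_all add: hopf_tensor_def tensor_K_def Let_def)

lemma hopf_tensor_smult:
  "e \<odot>\<^bsub>hopf_tensor K B E M Q\<^esub> t = tzip (vs_of E M) (vs_of B Q) (smult M) (smult Q) (coact E e) t"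
proof -
  have eq: "tensor_zip (tensor K (vs_of E M) (vs_of B Q)) (smult M) (smult Q) =
      tzip (vs_of E M) (vs_of B Q) (smult M) (smult Q)"
    by (rule tensor_zip_record_cong) (simp_all add: tensor_K_def Let_def)
  show ?thesis
    unfolding eq[symmetric] by (simp add: hopf_tensor_def Let_def tensor_zip_def tensor_map_def)
qed

lemma left_module_hopf_tensor:
  assumes M: "left_module E M" and Q: "left_module B Q"
  shows "left_module E (hopf_tensor K B E M Q)"
proof -
  let ?T = "vs_of E M \<boxtimes> vs_of B Q"
  note VM = left_module_vs_of[OF E_facts(1) M] and VQ = left_module_vs_of[OF B_facts(1) Q]
  note aM = action_bilinear[OF E_facts(1) M] and aQ = action_bilinear[OF B_facts(1) Q]
  note Z = zip_bilinear[OF aM aQ]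
  note ZD = bilinear_mapD(4-6)[OF Z(1)]
  interpret E: ring E by (rule ring_E)
  interpret B: ring B by (rule ring_B)
  note simps = hopf_tensor_records hopf_tensor_smult
  show ?thesis
  proof (rule left_moduleI[OF ring_E abelian_group_cong[OF abelian_group_tensor[OF VM VQ]]])
    show "(a \<otimes>\<^bsub>E\<^esub> b) \<odot>\<^bsub>hopf_tensor K B E M Q\<^esub> t = a \<odot>\<^bsub>hopf_tensor K B E M Q\<^esub> (b \<odot>\<^bsub>hopf_tensor K B E M Q\<^esub> t)"
      if "a \<in> carrier E" "b \<in> carrier E" "t \<in> carrier (hopf_tensor K B E M Q)" for a b t
      unfolding hopf_tensor_smult coact_mult[OF that(1,2)] tensor_mult
      by (rule zip_assoc[OF assoc_algebraD(5)[OF E_facts(1)] assoc_algebraD(5)[OF B_facts(1)] aM aQ aM aQ aM aQ])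
        (use that in \<open>simp_all add: left_moduleD(6)[OF M] left_moduleD(6)[OF Q] coact_closed hopf_tensor_records\<close>)
    show "\<one>\<^bsub>E\<^esub> \<odot>\<^bsub>hopf_tensor K B E M Q\<^esub> t = t" if "t \<in> carrier (hopf_tensor K B E M Q)" for t
    proof -
      have "t \<in> carrier ?T" using that by (simp add: simps)
      with VM VQ have "tzip (vs_of E M) (vs_of B Q) (smult M) (smult Q) (pure_tensor (E \<boxtimes> B) \<one>\<^bsub>E\<^esub> \<one>\<^bsub>B\<^esub>) t = t"
      proof (induction t rule: tensor_induct_K)
        case (pure m q)
        then show ?case by (simp add: Z(2) left_moduleD(7)[OF M] left_moduleD(7)[OF Q])
      next
        case (add s t)
        then show ?case by (simp add: ZD pure_simps(1) E_facts(3) B_facts(4))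
      qed
      then show ?thesis by (simp add: simps coact_one tensor_one)
    qed
  qed (simp_all add: simps ZD coact_closed coact_add)
qed

text \<open>
  The scalar \<open>c\<close> acts on the module \<open>M \<otimes> Q\<close> through \<open>\<rho>(c 1) = c (1 \<otimes> 1)\<close>, so the vector space
  underlying that module is the tensor product of the underlying vector spaces. In particular an
  iterated \<open>G\<^sub>E\<close> is an iterated tensor product over \<open>K\<close>.
\<close>

lemma vs_of_hopf_tensor_smult:
  assumes M: "left_module E M" and Q: "left_module B Q"
    and c: "c \<in> carrier K" and t: "t \<in> carrier (hopf_tensor K B E M Q)"
  shows "c \<odot>\<^bsub>vs_of E (hopf_tensor K B E M Q)\<^esub> t = c \<odot>\<^bsub>vs_of E M \<boxtimes> vs_of B Q\<^esub> t"
proof -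
  interpret E: ring E by (rule ring_E)
  interpret B: ring B by (rule ring_B)
  note Z = bilinear_mapD(7)[OF zip_bilinear(1)[OF action_bilinear[OF E_facts(1) M] action_bilinear[OF B_facts(1) Q]]]
  have "coact E (c \<odot>\<^bsub>E\<^esub> \<one>\<^bsub>E\<^esub>) = c \<odot>\<^bsub>E \<boxtimes> B\<^esub> coact E \<one>\<^bsub>E\<^esub>"
    using c by (simp add: coact_scale)
  moreover have "\<one>\<^bsub>E\<^esub> \<odot>\<^bsub>hopf_tensor K B E M Q\<^esub> t = t"
    by (rule left_moduleD(7)[OF left_module_hopf_tensor[OF M Q] t])
  ultimately show ?thesis
    using c t by (simp add: Z hopf_tensor_smult hopf_tensor_records coact_closed)
qed

text \<open>
  The space underlying the regular module has the scalar multiplication \<open>(c 1) b\<close>, which agrees with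
  \<open>c b\<close> on the carrier, and the tensor relations only involve elements of the carrier.
\<close>

lemma tensor_vs_of_regular:
  "carrier (X \<boxtimes> vs_of B (regular B)) = carrier (X \<boxtimes> B)"
  "\<zero>\<^bsub>X \<boxtimes> vs_of B (regular B)\<^esub> = \<zero>\<^bsub>X \<boxtimes> B\<^esub>"
  "add (X \<boxtimes> vs_of B (regular B)) = add (X \<boxtimes> B)"
proof -
  have "tensor K X (vs_of B (regular B)) = tensor K X B"
    by (rule tensor_cong) (simp_all add: smult_one_mult[OF B_facts(1)])
  then show "carrier (X \<boxtimes> vs_of B (regular B)) = carrier (X \<boxtimes> B)"
    "\<zero>\<^bsub>X \<boxtimes> vs_of B (regular B)\<^esub> = \<zero>\<^bsub>X \<boxtimes> B\<^esub>"
    "add (X \<boxtimes> vs_of B (regular B)) = add (X \<boxtimes> B)"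
    by (simp_all add: tensor_K_def Let_def)
qed

lemma vs_of_regular_linear: "linear (vs_of B (regular B)) B (\<lambda>b. b)"
  using left_module_vs_of[OF B_facts(1) left_module_regular[OF ring_B]] B_facts(4)
  by (auto simp: left_module_hom_def smult_one_mult[OF B_facts(1)])

lemma hopf_G_records:
  "carrier (hopf_G K B E M) = carrier (vs_of E M \<boxtimes> B)"
  "\<zero>\<^bsub>hopf_G K B E M\<^esub> = \<zero>\<^bsub>vs_of E M \<boxtimes> B\<^esub>"
  "add (hopf_G K B E M) = add (vs_of E M \<boxtimes> B)"
  by (simp_all add: hopf_G_def hopf_tensor_records tensor_vs_of_regular)

lemma hopf_G_smult:
  "e \<odot>\<^bsub>hopf_G K B E M\<^esub> t = tzip (vs_of E M) B (smult M) (monoid.mult B) (coact E e) t"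
  unfolding hopf_G_def hopf_tensor_smult tensor_zip_record_cong[OF tensor_vs_of_regular] by simp

lemma left_module_hopf_G: "left_module E M \<Longrightarrow> left_module E (hopf_G K B E M)"
  unfolding hopf_G_def by (rule left_module_hopf_tensor[OF _ left_module_regular[OF ring_B]])

lemma hopf_G_pure: "pure_tensor (hopf_G K B E M) = pure_tensor (vs_of E M \<boxtimes> B)"
  by (rule pure_tensor_record_cong[OF hopf_G_records(1)])

lemma hopf_G_map_eq: "hopf_G_map K B E N h = tensor_map (vs_of E N \<boxtimes> B) h (\<lambda>b. b)"
  unfolding hopf_G_map_def[abs_def] by (intro ext) (rule tensor_map_record_cong[OF hopf_G_records, THEN fun_cong])

lemma vs_of_hopf_G_smult:
  assumes M: "left_module E M" and c: "c \<in> carrier K" and t: "t \<in> carrier (vs_of E M \<boxtimes> B)"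
  shows "c \<odot>\<^bsub>vs_of E (hopf_G K B E M)\<^esub> t = c \<odot>\<^bsub>vs_of E M \<boxtimes> B\<^esub> t"
proof -
  show ?thesis
    using vs_of_hopf_tensor_smult[OF M left_module_regular[OF ring_B] c, of t] t
    unfolding hopf_G_def[symmetric] by (simp add: hopf_G_records tensor_smult tensor_map_record_cong[OF tensor_vs_of_regular] del: vs_of_simps(4))
qed

lemma tensor_vs_of_hopf_G:
  assumes M: "left_module E M"
  shows "carrier (vs_of E (hopf_G K B E M) \<boxtimes> Y) = carrier ((vs_of E M \<boxtimes> B) \<boxtimes> Y)"
    "\<zero>\<^bsub>vs_of E (hopf_G K B E M) \<boxtimes> Y\<^esub> = \<zero>\<^bsub>(vs_of E M \<boxtimes> B) \<boxtimes> Y\<^esub>"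
    "add (vs_of E (hopf_G K B E M) \<boxtimes> Y) = add ((vs_of E M \<boxtimes> B) \<boxtimes> Y)"
proof -
  have "tensor K (vs_of E (hopf_G K B E M)) Y = tensor K (vs_of E M \<boxtimes> B) Y"
    by (rule tensor_cong)
      (simp_all add: hopf_G_records vs_of_hopf_G_smult[OF M] del: vs_of_simps(4))
  then show "carrier (vs_of E (hopf_G K B E M) \<boxtimes> Y) = carrier ((vs_of E M \<boxtimes> B) \<boxtimes> Y)"
    "\<zero>\<^bsub>vs_of E (hopf_G K B E M) \<boxtimes> Y\<^esub> = \<zero>\<^bsub>(vs_of E M \<boxtimes> B) \<boxtimes> Y\<^esub>"
    "add (vs_of E (hopf_G K B E M) \<boxtimes> Y) = add ((vs_of E M \<boxtimes> B) \<boxtimes> Y)"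
    by (simp_all add: tensor_K_def Let_def)
qed

lemma vs_of_hopf_G_linear:
  assumes M: "left_module E M"
  shows "linear (vs_of E (hopf_G K B E M)) (vs_of E M \<boxtimes> B) (\<lambda>t. t)"
  using left_module_vs_of[OF E_facts(1) left_module_hopf_G[OF M]]
    left_module_tensor[OF left_module_vs_of[OF E_facts(1) M] B_facts(4)]
  by (auto simp: left_module_hom_def hopf_G_records vs_of_hopf_G_smult[OF M] simp del: vs_of_simps(4))

lemma hopf_delta_eq:
  assumes M: "left_module E M"
  shows "hopf_delta K B E M = delta_K B (vs_of E M)"
proof -
  note rec = hopf_G_records[of "hopf_G K B E M", unfolded tensor_vs_of_hopf_G[OF M]]
  show ?thesis
    unfolding hopf_delta_def[abs_def] delta_K_def[abs_def] tensor_assoc_def hopf_G_pure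
      pure_tensor_record_cong[OF tensor_vs_of_hopf_G(1)[OF M]] tensor_lift_record_cong[OF rec] ..
qed

lemma hopf_epsilon_eq: "hopf_epsilon B E M = epsilon_K B (vs_of E M)"
  unfolding hopf_epsilon_def epsilon_K_def by (rule tensor_lift_record_cong) simp_all

lemma id_bialg_hom: "(\<lambda>b. b) \<in> bialg_hom K B B"
  using left_module_homD(4)[OF B_facts(5)]
  by (auto simp: bialg_hom_def alg_hom_def ring_hom_def tensor_map_id B_facts(4))

text \<open>
  This is \<open>coaction_comult\<close> for the action of \<open>E\<close> on \<open>M\<close> and \<open>\<phi> = id\<close>: the map \<open>q\<close> of that lemma is then
  the action of \<open>E\<close> on \<open>M \<otimes> B\<close>.
\<close>

lemma hopf_delta_hom:
  assumes M: "left_module E M"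
  shows "left_module_hom E (hopf_G K B E M) (hopf_G K B E (hopf_G K B E M)) (hopf_delta K B E M)"
proof -
  note VM = left_module_vs_of[OF E_facts(1) M]
  note rec = hopf_G_records[of "hopf_G K B E M", unfolded tensor_vs_of_hopf_G[OF M]]
  note D = left_module_homD(4,5)[OF delta_K_linear(1)[OF bialg VM]]
  have zip: "tzip (vs_of E (hopf_G K B E M)) B = tzip (vs_of E M \<boxtimes> B) B"
    by (intro ext tensor_zip_record_cong[THEN fun_cong, THEN fun_cong] tensor_vs_of_hopf_G[OF M])
  have "hopf_delta K B E M (e \<odot>\<^bsub>hopf_G K B E M\<^esub> t) = e \<odot>\<^bsub>hopf_G K B E (hopf_G K B E M)\<^esub> hopf_delta K B E M t"
    if "e \<in> carrier E" "t \<in> carrier (hopf_G K B E M)" for e t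
    using coaction_comult[OF bialg bialg id_bialg_hom comod action_bilinear[OF E_facts(1) M] that(1), of t] that(2)
    by (simp add: hopf_delta_eq[OF M] hopf_G_smult hopf_G_records zip flip: hopf_G_smult[abs_def])
  then show ?thesis
    by (intro left_module_homI additive_mapI left_module_hopf_G M)
      (simp_all add: hopf_delta_eq[OF M] D rec hopf_G_records(1,3)[of M])
qed

lemma hopf_epsilon_hom:
  assumes M: "left_module E M"
  shows "left_module_hom E (hopf_G K B E M) M (hopf_epsilon B E M)"
proof -
  note VM = left_module_vs_of[OF E_facts(1) M]
  note D = left_module_homD(4,5)[OF lift_linear(1)[OF counit_bilinear[OF bialg VM], folded epsilon_K_def]]
  have "hopf_epsilon B E M (e \<odot>\<^bsub>hopf_G K B E M\<^esub> t) = e \<odot>\<^bsub>M\<^esub> hopf_epsilon B E M t"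
    if "e \<in> carrier E" "t \<in> carrier (hopf_G K B E M)" for e t
    using coaction_counit[OF bialg bialg id_bialg_hom comod action_bilinear[OF E_facts(1) M] that(1), of t] that(2)
    by (simp add: hopf_epsilon_eq hopf_G_smult hopf_G_records)
  then show ?thesis
    using D by (intro left_module_homI additive_mapI left_module_hopf_G M)
      (simp_all add: hopf_epsilon_eq hopf_G_records)
qed

lemma hopf_tensor_map_hom:
  assumes h: "left_module_hom E M N h" and k: "left_module_hom B Q P k"
  shows "left_module_hom E (hopf_tensor K B E M Q) (hopf_tensor K B E N P)
    (tensor_map (vs_of E N \<boxtimes> vs_of B P) h k)"
proof -
  note H = left_module_homD[OF h] and K' = left_module_homD[OF k]
  note hk = tensor_map_linear(1)[OF vs_of_linear[OF E_facts(1) h] vs_of_linear[OF B_facts(1) k]]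
  note T = left_module_homD(4,5)[OF hk]
  note aM = action_bilinear[OF E_facts(1) H(1)] and aN = action_bilinear[OF E_facts(1) H(2)]
    and aQ = action_bilinear[OF B_facts(1) K'(1)] and aP = action_bilinear[OF B_facts(1) K'(2)]
  show ?thesis
  proof (intro left_module_homI additive_mapI left_module_hopf_tensor H(1,2) K'(1,2))
    fix e t assume e: "e \<in> carrier E" and t: "t \<in> carrier (hopf_tensor K B E M Q)"
    have "tensor_map (vs_of E N \<boxtimes> vs_of B P) h k
        (tzip (vs_of E M) (vs_of B Q) (smult M) (smult Q) (coact E e) t) =
      tzip (vs_of E N) (vs_of B P) (smult N) (smult P) (tensor_map (E \<boxtimes> B) (\<lambda>x. x) (\<lambda>x. x) (coact E e))
        (tensor_map (vs_of E N \<boxtimes> vs_of B P) h k t)"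
      by (rule zip_map[OF aM aQ aN aP left_module_hom_id[OF E_facts(3)] vs_of_linear[OF E_facts(1) h] vs_of_linear[OF E_facts(1) h]
            left_module_hom_id[OF B_facts(4)] vs_of_linear[OF B_facts(1) k] vs_of_linear[OF B_facts(1) k]])
        (use e t in \<open>simp_all add: H K' coact_closed hopf_tensor_records\<close>)
    then show "tensor_map (vs_of E N \<boxtimes> vs_of B P) h k (e \<odot>\<^bsub>hopf_tensor K B E M Q\<^esub> t) =
      e \<odot>\<^bsub>hopf_tensor K B E N P\<^esub> tensor_map (vs_of E N \<boxtimes> vs_of B P) h k t"
      using e by (simp add: hopf_tensor_smult tensor_map_id E_facts(3) B_facts(4) coact_closed)
  qed (simp_all add: hopf_tensor_records T)
qed

lemma hopf_G_map_hom:
  assumes h: "left_module_hom E M N h"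
  shows "left_module_hom E (hopf_G K B E M) (hopf_G K B E N) (hopf_G_map K B E N h)"
  using hopf_tensor_map_hom[OF h left_module_hom_id[OF left_module_regular[OF ring_B]]]
  unfolding hopf_G_map_eq hopf_G_def tensor_map_record_cong[OF tensor_vs_of_regular] .

end

section \<open>Extension of scalars\<close>

lemma right_via_simps [simp]:
  "carrier (right_via f E') = carrier E'" "\<zero>\<^bsub>right_via f E'\<^esub> = \<zero>\<^bsub>E'\<^esub>" "add (right_via f E') = add E'"
  "e \<odot>\<^bsub>right_via f E'\<^esub> x = x \<otimes>\<^bsub>E'\<^esub> f e"
  by (simp_all add: right_via_def)

locale scalar_extension =
  fixes E :: "('e, 'p) ring_scheme" and E' :: "('d, 'q) ring_scheme" and f :: "'e \<Rightarrow> 'd"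
  assumes ring_E: "ring E" and ring_E': "ring E'" and f: "f \<in> ring_hom E E'"
begin

lemma f_closed: "e \<in> carrier E \<Longrightarrow> f e \<in> carrier E'"
  by (rule ring_hom_closed[OF f])

lemma tensor_product_ext:
  assumes "left_module E M"
  shows "tensor_product E (right_via f E') M (ext_scalars E E' f M)"
proof -
  interpret E': ring E' by (rule ring_E')
  show ?thesis
    by (intro tensor_product.intro abelian_group_cong[OF E'.abelian_group_axioms])
      (simp_all add: left_moduleD[OF assms] ext_scalars_def Let_def f_closed)
qed

lemma abelian_group_ext: "left_module E M \<Longrightarrow> abelian_group (ext_scalars E E' f M)"
  by (rule tensor_product.abelian_group_T[OF tensor_product_ext])

lemma ext_smult: "a \<odot>\<^bsub>ext_scalars E E' f M\<^esub> t =
    tensor_map (ext_scalars E E' f M) (\<lambda>x. a \<otimes>\<^bsub>E'\<^esub> x) (\<lambda>m. m) t"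
  unfolding ext_scalars_def Let_def by (simp, rule tensor_map_record_cong[THEN fun_cong]) simp_all

lemma ext_pure:
  assumes "left_module E M"
  shows "\<And>x m. x \<in> carrier E' \<Longrightarrow> m \<in> carrier M \<Longrightarrow>
      pure_tensor (ext_scalars E E' f M) x m \<in> carrier (ext_scalars E E' f M)"
    "\<And>x x' m. x \<in> carrier E' \<Longrightarrow> x' \<in> carrier E' \<Longrightarrow> m \<in> carrier M \<Longrightarrow>
      pure_tensor (ext_scalars E E' f M) (x \<oplus>\<^bsub>E'\<^esub> x') m =
      pure_tensor (ext_scalars E E' f M) x m \<oplus>\<^bsub>ext_scalars E E' f M\<^esub> pure_tensor (ext_scalars E E' f M) x' m"
    "\<And>x m m'. x \<in> carrier E' \<Longrightarrow> m \<in> carrier M \<Longrightarrow> m' \<in> carrier M \<Longrightarrow>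
      pure_tensor (ext_scalars E E' f M) x (m \<oplus>\<^bsub>M\<^esub> m') =
      pure_tensor (ext_scalars E E' f M) x m \<oplus>\<^bsub>ext_scalars E E' f M\<^esub> pure_tensor (ext_scalars E E' f M) x m'"
    "\<And>e x m. e \<in> carrier E \<Longrightarrow> x \<in> carrier E' \<Longrightarrow> m \<in> carrier M \<Longrightarrow>
      pure_tensor (ext_scalars E E' f M) (x \<otimes>\<^bsub>E'\<^esub> f e) m = pure_tensor (ext_scalars E E' f M) x (e \<odot>\<^bsub>M\<^esub> m)"
  using balanced_mapD[OF tensor_product.pure_balanced[OF tensor_product_ext[OF assms]]] by simp_all

lemma ext_induct [consumes 2, case_names pure add]:
  assumes "left_module E M" "t \<in> carrier (ext_scalars E E' f M)"
    and "\<And>x m. x \<in> carrier E' \<Longrightarrow> m \<in> carrier M \<Longrightarrow> P (pure_tensor (ext_scalars E E' f M) x m)"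
    and "\<And>s t. s \<in> carrier (ext_scalars E E' f M) \<Longrightarrow> t \<in> carrier (ext_scalars E E' f M) \<Longrightarrow>
      P s \<Longrightarrow> P t \<Longrightarrow> P (s \<oplus>\<^bsub>ext_scalars E E' f M\<^esub> t)"
  shows "P t"
  by (rule tensor_product.tensor_induct[OF tensor_product_ext[OF assms(1)] assms(2)]) (use assms in auto)

text \<open>
  The map \<open>g\<close> is right \<open>E\<close>-linear. This covers both the functoriality in \<open>M\<close>
  (\<open>g = id\<close>) and the left action of \<open>E'\<close> (\<open>g\<close> a left multiplication).
\<close>

lemma ext_map:
  assumes M: "left_module E M" and N: "left_module E N"
    and g: "additive_map E' E' g" "\<And>x e. x \<in> carrier E' \<Longrightarrow> e \<in> carrier E \<Longrightarrow> g (x \<otimes>\<^bsub>E'\<^esub> f e) = g x \<otimes>\<^bsub>E'\<^esub> f e"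
    and h: "left_module_hom E M N h"
  shows "additive_map (ext_scalars E E' f M) (ext_scalars E E' f N) (tensor_map (ext_scalars E E' f N) g h)"
    and "x \<in> carrier E' \<Longrightarrow> m \<in> carrier M \<Longrightarrow>
      tensor_map (ext_scalars E E' f N) g h (pure_tensor (ext_scalars E E' f M) x m) =
      pure_tensor (ext_scalars E E' f N) (g x) (h m)"
proof -
  interpret T: tensor_product E "right_via f E'" M "ext_scalars E E' f M" by (rule tensor_product_ext[OF M])
  interpret E': ring E' by (rule ring_E')
  note H = left_module_homD(4-6)[OF h] and P = ext_pure[OF N]
  have "balanced_map E (right_via f E') M (ext_scalars E E' f N)
      (\<lambda>x m. pure_tensor (ext_scalars E E' f N) (g x) (h m))"
    by (rule balanced_mapI)
      (simp_all add: P H g(2) additive_map_closed[OF g(1)] additive_map_add[OF g(1)])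
  note L = abelian_group_ext[OF N] this
  show "additive_map (ext_scalars E E' f M) (ext_scalars E E' f N) (tensor_map (ext_scalars E E' f N) g h)"
    unfolding tensor_map_def by (rule T.tensor_lift_additive[OF L])
  show "tensor_map (ext_scalars E E' f N) g h (pure_tensor (ext_scalars E E' f M) x m) =
      pure_tensor (ext_scalars E E' f N) (g x) (h m)" if "x \<in> carrier E'" "m \<in> carrier M"
    unfolding tensor_map_def using that by (intro T.tensor_lift_pure[OF L]) simp_all
qed

lemma ext_smult_map:
  assumes M: "left_module E M" and a: "a \<in> carrier E'"
  shows "additive_map (ext_scalars E E' f M) (ext_scalars E E' f M) (\<lambda>t. a \<odot>\<^bsub>ext_scalars E E' f M\<^esub> t)"
    and "x \<in> carrier E' \<Longrightarrow> m \<in> carrier M \<Longrightarrow>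
      a \<odot>\<^bsub>ext_scalars E E' f M\<^esub> pure_tensor (ext_scalars E E' f M) x m =
      pure_tensor (ext_scalars E E' f M) (a \<otimes>\<^bsub>E'\<^esub> x) m"
proof -
  interpret E': ring E' by (rule ring_E')
  have g: "additive_map E' E' (\<lambda>x. a \<otimes>\<^bsub>E'\<^esub> x)"
    using a by (auto intro!: additive_mapI simp: E'.r_distr)
  have g': "a \<otimes>\<^bsub>E'\<^esub> (x \<otimes>\<^bsub>E'\<^esub> f e) = a \<otimes>\<^bsub>E'\<^esub> x \<otimes>\<^bsub>E'\<^esub> f e" if "x \<in> carrier E'" "e \<in> carrier E" for x e
    using that a by (simp add: E'.m_assoc f_closed)
  note L = ext_map[OF M M g g' left_module_hom_id[OF M]]
  show "additive_map (ext_scalars E E' f M) (ext_scalars E E' f M) (\<lambda>t. a \<odot>\<^bsub>ext_scalars E E' f M\<^esub> t)"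
    "x \<in> carrier E' \<Longrightarrow> m \<in> carrier M \<Longrightarrow>
      a \<odot>\<^bsub>ext_scalars E E' f M\<^esub> pure_tensor (ext_scalars E E' f M) x m =
      pure_tensor (ext_scalars E E' f M) (a \<otimes>\<^bsub>E'\<^esub> x) m"
    using L by (simp_all add: ext_smult[abs_def])
qed

lemma left_module_ext:
  assumes M: "left_module E M"
  shows "left_module E' (ext_scalars E E' f M)"
proof -
  interpret E': ring E' by (rule ring_E')
  interpret T: abelian_group "ext_scalars E E' f M" by (rule abelian_group_ext[OF M])
  note S = additive_map_closed[OF ext_smult_map(1)[OF M]] additive_map_add[OF ext_smult_map(1)[OF M]]
    ext_smult_map(2)[OF M]
  note P = ext_pure[OF M]
  show ?thesis
  proof (rule left_moduleI[OF ring_E' abelian_group_ext[OF M]])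
    fix a b t assume ab: "a \<in> carrier E'" "b \<in> carrier E'" and t: "t \<in> carrier (ext_scalars E E' f M)"
    show "(a \<oplus>\<^bsub>E'\<^esub> b) \<odot>\<^bsub>ext_scalars E E' f M\<^esub> t =
        a \<odot>\<^bsub>ext_scalars E E' f M\<^esub> t \<oplus>\<^bsub>ext_scalars E E' f M\<^esub> b \<odot>\<^bsub>ext_scalars E E' f M\<^esub> t"
      using M t by (induction rule: ext_induct) (simp_all add: ab S P(1,2) E'.l_distr T.a_ac)
    show "(a \<otimes>\<^bsub>E'\<^esub> b) \<odot>\<^bsub>ext_scalars E E' f M\<^esub> t =
        a \<odot>\<^bsub>ext_scalars E E' f M\<^esub> (b \<odot>\<^bsub>ext_scalars E E' f M\<^esub> t)"
      using M t by (induction rule: ext_induct) (simp_all add: ab S P(1,2) E'.m_assoc)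
  next
    show "\<one>\<^bsub>E'\<^esub> \<odot>\<^bsub>ext_scalars E E' f M\<^esub> t = t" if "t \<in> carrier (ext_scalars E E' f M)" for t
      using M that by (induction rule: ext_induct) (simp_all add: S)
  qed (simp_all add: S)
qed

lemma ext_scalars_map_hom:
  assumes h: "left_module_hom E M N h"
  shows "left_module_hom E' (ext_scalars E E' f M) (ext_scalars E E' f N) (ext_scalars_map E E' f N h)"
    and "x \<in> carrier E' \<Longrightarrow> m \<in> carrier M \<Longrightarrow>
      ext_scalars_map E E' f N h (pure_tensor (ext_scalars E E' f M) x m) =
      pure_tensor (ext_scalars E E' f N) x (h m)"
proof -
  note H = left_module_homD[OF h]
  interpret E': ring E' by (rule ring_E')
  have i: "additive_map E' E' (\<lambda>x. x)" by (simp add: additive_mapI)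
  note L = ext_map[OF H(1,2) i refl h, folded ext_scalars_map_def]
  note A = additive_map_closed[OF L(1)] additive_map_add[OF L(1)]
  note S = additive_map_closed[OF ext_smult_map(1)] additive_map_add[OF ext_smult_map(1)] ext_smult_map(2)
  show *: "ext_scalars_map E E' f N h (pure_tensor (ext_scalars E E' f M) x m) =
      pure_tensor (ext_scalars E E' f N) x (h m)" if "x \<in> carrier E'" "m \<in> carrier M" for x m
    using L(2)[OF that] .
  show "left_module_hom E' (ext_scalars E E' f M) (ext_scalars E E' f N) (ext_scalars_map E E' f N h)"
  proof (rule left_module_homI[OF left_module_ext[OF H(1)] left_module_ext[OF H(2)] L(1)])
    fix a t assume a: "a \<in> carrier E'" and t: "t \<in> carrier (ext_scalars E E' f M)"
    show "ext_scalars_map E E' f N h (a \<odot>\<^bsub>ext_scalars E E' f M\<^esub> t) =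
        a \<odot>\<^bsub>ext_scalars E E' f N\<^esub> ext_scalars_map E E' f N h t"
      using H(1) t by (induction rule: ext_induct) (simp_all add: * S[OF H(1) a] S[OF H(2) a] A H(4) a)
  qed
qed

end

section \<open>The transformation\<close>

lemma alg_hom_scalar_extension:
  assumes "assoc_algebra K E" "assoc_algebra K E'" "f \<in> alg_hom K E E'"
  shows "scalar_extension E E' f"
  using assms by (intro scalar_extension.intro assoc_algebraD(3)) (auto simp: alg_hom_def)

text \<open>
  Scalars of \<open>K\<close> can be moved across the tensor sign over \<open>E\<close> because
  \<open>x f(c 1) = c x\<close>.
\<close>

lemma ext_pure_bilinear:
  assumes E: "assoc_algebra K E" and E': "assoc_algebra K E'" and f: "f \<in> alg_hom K E E'"
    and M: "left_module E M"
  shows "bilinear_map K E' (vs_of E M) (vs_of E' (ext_scalars E E' f M)) (pure_tensor (ext_scalars E E' f M))"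
proof -
  note D = assoc_algebraD[OF E] and D' = assoc_algebraD[OF E']
  interpret X: scalar_extension E E' f
    by (rule alg_hom_scalar_extension[OF E E' f])
  interpret E: ring E by (rule D)
  interpret E': ring E' by (rule D')
  note P = X.ext_pure[OF M] and S = X.ext_smult_map(2)[OF M]
  note L' = left_moduleD(3)[OF D'(4)]
  have "pure_tensor (ext_scalars E E' f M) x ((c \<odot>\<^bsub>E\<^esub> \<one>\<^bsub>E\<^esub>) \<odot>\<^bsub>M\<^esub> m) = pure_tensor (ext_scalars E E' f M) (c \<odot>\<^bsub>E'\<^esub> x) m"
    if "c \<in> carrier K" "x \<in> carrier E'" "m \<in> carrier M" for c x m
  proof -
    have "x \<otimes>\<^bsub>E'\<^esub> f (c \<odot>\<^bsub>E\<^esub> \<one>\<^bsub>E\<^esub>) = c \<odot>\<^bsub>E'\<^esub> x"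
      using that by (simp add: alg_homD[OF f] bilinear_mapD(8)[OF D'(5)])
    then show ?thesis using that P(4)[of "c \<odot>\<^bsub>E\<^esub> \<one>\<^bsub>E\<^esub>" x m] left_moduleD(3)[OF D(4)] by simp
  qed
  then show ?thesis
    by (intro bilinear_mapI[OF D'(4) left_module_vs_of[OF E M] left_module_vs_of[OF E' X.left_module_ext[OF M]]])
      (simp_all add: P(1-3) S L' smult_one_mult[OF E'])
qed

lemma additive_map_finsum:
  assumes g: "additive_map X Y g" and X: "abelian_group X" and Y: "abelian_group Y"
    and x: "x \<in> {..<n :: nat} \<rightarrow> carrier X"
  shows "g (\<Oplus>\<^bsub>X\<^esub>i \<in> {..<n}. x i) = (\<Oplus>\<^bsub>Y\<^esub>i \<in> {..<n}. g (x i))"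
proof -
  interpret X: abelian_group X by (rule X)
  interpret Y: abelian_group Y by (rule Y)
  note G = additive_map_closed[OF g] additive_map_add[OF g]
  have zero: "g \<zero>\<^bsub>X\<^esub> = \<zero>\<^bsub>Y\<^esub>"
    using G(2)[of "\<zero>\<^bsub>X\<^esub>" "\<zero>\<^bsub>X\<^esub>"] G(1)[of "\<zero>\<^bsub>X\<^esub>"] by (simp add: Y.add.l_cancel_one)
  show ?thesis using x
  proof (induction n)
    case 0
    then show ?case by (simp add: zero)
  next
    case (Suc n)
    then have "x \<in> {..<n} \<rightarrow> carrier X" "x n \<in> carrier X" by auto
    with Suc.IH show ?case
      by (simp add: lessThan_Suc Pi_iff X.finsum_insert Y.finsum_insert X.finsum_closed G)
  qed
qed

locale comodule_algebra_map =
  comm_scalars K + D: comodule_algebra_over K B E + D': comodule_algebra_over K B' E'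
  for K :: "('k, 'p) ring_scheme" and B :: "('k, 'b) bialg" and B' :: "('k, 'c) bialg"
    and E :: "('k, 'b, 'e) comod_alg" and E' :: "('k, 'c, 'd) comod_alg" +
  fixes \<phi> :: "'b \<Rightarrow> 'c" and f :: "'e \<Rightarrow> 'd"
  assumes \<phi>: "\<phi> \<in> bialg_hom K B B'" and f: "f \<in> comod_alg_hom K \<phi> B' E E'"
begin

lemmas \<phi>D = bialg_homD[OF \<phi> D.bialg D'.bialg]

lemma f_alg_hom: "f \<in> alg_hom K E E'"
  using f by (simp add: comod_alg_hom_def)

lemma f_linear: "linear E E' f"
  by (rule alg_hom_linear[OF f_alg_hom D.E_facts(3) D'.E_facts(3)])

lemma coact_f: "e \<in> carrier E \<Longrightarrow> coact E' (f e) = tensor_map (E' \<boxtimes> B') f \<phi> (coact E e)"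
  using f by (simp add: comod_alg_hom_def)

sublocale X: scalar_extension E E' f
  by (rule alg_hom_scalar_extension[OF D.E_facts(1) D'.E_facts(1) f_alg_hom])

sublocale Y: scalar_extension B B' \<phi>
  by (rule alg_hom_scalar_extension[OF D.B_facts(1) D'.B_facts(1) \<phi>D(1)])

abbreviation "ext_E M \<equiv> ext_scalars E E' f M"
abbreviation "ext_B Q \<equiv> ext_scalars B B' \<phi> Q"
abbreviation "translate \<equiv> \<lambda>y b. y \<otimes>\<^bsub>B'\<^esub> \<phi> b"

lemma unitor_additive: "additive_map (ext_B (regular B)) B' (unitor B' \<phi>)"
  and unitor_pure: "y \<in> carrier B' \<Longrightarrow> b \<in> carrier B \<Longrightarrow>
    unitor B' \<phi> (pure_tensor (ext_B (regular B)) y b) = y \<otimes>\<^bsub>B'\<^esub> \<phi> b"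
proof -
  interpret B': ring B' by (rule D'.ring_B)
  interpret T: tensor_product B "right_via \<phi> B'" "regular B" "ext_B (regular B)"
    by (rule Y.tensor_product_ext[OF left_module_regular[OF D.ring_B]])
  have "balanced_map B (right_via \<phi> B') (regular B) B' translate"
    by (rule balanced_mapI)
      (simp_all add: alg_homD[OF \<phi>D(1)] B'.l_distr B'.r_distr B'.m_assoc)
  note L = B'.abelian_group_axioms this
  show "additive_map (ext_B (regular B)) B' (unitor B' \<phi>)"
    unfolding unitor_def by (rule T.tensor_lift_additive[OF L])
  show "y \<in> carrier B' \<Longrightarrow> b \<in> carrier B \<Longrightarrow>
    unitor B' \<phi> (pure_tensor (ext_B (regular B)) y b) = y \<otimes>\<^bsub>B'\<^esub> \<phi> b"
    unfolding unitor_def by (rule T.tensor_lift_pure[OF L]) simp_all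
qed

lemma unitor_hom: "left_module_hom B' (ext_B (regular B)) (regular B') (unitor B' \<phi>)"
proof -
  interpret B': ring B' by (rule D'.ring_B)
  note R = left_module_regular[OF D.ring_B]
  note U = additive_map_closed[OF unitor_additive] additive_map_add[OF unitor_additive]
  show ?thesis
  proof (rule left_module_homI[OF Y.left_module_ext[OF R] left_module_regular[OF D'.ring_B]])
    show "additive_map (ext_B (regular B)) (regular B') (unitor B' \<phi>)"
      using U by (auto intro!: additive_mapI)
    fix a t assume a: "a \<in> carrier B'" and t: "t \<in> carrier (ext_B (regular B))"
    note S = additive_map_closed[OF Y.ext_smult_map(1)[OF R a]]
      additive_map_add[OF Y.ext_smult_map(1)[OF R a]] Y.ext_smult_map(2)[OF R a]
    show "unitor B' \<phi> (a \<odot>\<^bsub>ext_B (regular B)\<^esub> t) = a \<odot>\<^bsub>regular B'\<^esub> unitor B' \<phi> t"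
      using R t by (induction rule: Y.ext_induct)
        (simp_all add: a S U unitor_pure B'.m_assoc B'.r_distr alg_homD(2)[OF \<phi>D(1)])
  qed
qed

text \<open>
  The inverse is \<open>y \<mapsto> y \<otimes> 1\<close>, since \<open>y \<otimes> b = y \<phi>(b) \<otimes> 1\<close> over \<open>B\<close>.
\<close>

lemma unitor_bij: "bij_betw (unitor B' \<phi>) (carrier (ext_B (regular B))) (carrier B')"
proof (rule bij_betw_byWitness[where f' = "\<lambda>y. pure_tensor (ext_B (regular B)) y \<one>\<^bsub>B\<^esub>"])
  interpret B: ring B by (rule D.ring_B)
  interpret B': ring B' by (rule D'.ring_B)
  note R = left_module_regular[OF D.ring_B]
  note U = additive_map_closed[OF unitor_additive] additive_map_add[OF unitor_additive]
  note P = Y.ext_pure[OF R]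
  show "\<forall>t \<in> carrier (ext_B (regular B)). pure_tensor (ext_B (regular B)) (unitor B' \<phi> t) \<one>\<^bsub>B\<^esub> = t"
  proof
    fix t assume "t \<in> carrier (ext_B (regular B))"
    with R show "pure_tensor (ext_B (regular B)) (unitor B' \<phi> t) \<one>\<^bsub>B\<^esub> = t"
      by (induction rule: Y.ext_induct) (simp_all add: unitor_pure U P)
  qed
  show "\<forall>y \<in> carrier B'. unitor B' \<phi> (pure_tensor (ext_B (regular B)) y \<one>\<^bsub>B\<^esub>) = y"
    by (simp add: unitor_pure alg_homD(5)[OF \<phi>D(1)])
  show "unitor B' \<phi> ` carrier (ext_B (regular B)) \<subseteq> carrier B'"
    using U by auto
  show "(\<lambda>y. pure_tensor (ext_B (regular B)) y \<one>\<^bsub>B\<^esub>) ` carrier B' \<subseteq> carrier (ext_B (regular B))"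
    using P(1) by auto
qed

lemma coact_translate:
  assumes x: "x \<in> carrier E'" and e: "e \<in> carrier E"
  shows "coact E' (x \<otimes>\<^bsub>E'\<^esub> f e) =
    tzip E' B' (\<lambda>x e. x \<otimes>\<^bsub>E'\<^esub> f e) translate (coact E' x) (coact E e)"
  using assms tensor_mult_map[OF D'.E_facts(1) D'.B_facts(1) f_linear \<phi>D(2) D'.coact_closed[OF x] D.coact_closed[OF e]]
  by (simp add: D'.coact_mult X.f_closed coact_f)

lemma translate_E_bilinear: "bilinear E' E E' (\<lambda>x e. x \<otimes>\<^bsub>E'\<^esub> f e)"
  by (rule bilinear_map_compose[OF assoc_algebraD(5)[OF D'.E_facts(1)] left_module_hom_id[OF D'.E_facts(3)] f_linear])

lemmas pure_E = ext_pure_bilinear[OF D.E_facts(1) D'.E_facts(1) f_alg_hom]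
  and pure_B = ext_pure_bilinear[OF D.B_facts(1) D'.B_facts(1) \<phi>D(1)]

text \<open>
  The value of \<open>\<alpha>\<close> at \<open>e' \<otimes> t\<close>, for \<open>t\<close> in \<open>M \<otimes> Q\<close>.
\<close>

definition "twist M Q e' t =
  tzip (vs_of E' (ext_E M)) (vs_of B' (ext_B Q)) (pure_tensor (ext_E M)) (pure_tensor (ext_B Q)) (coact E' e') t"

lemma twist_bilinear:
  assumes M: "left_module E M" and Q: "left_module B Q"
  shows "bilinear E' (vs_of E M \<boxtimes> vs_of B Q) (vs_of E' (ext_E M) \<boxtimes> vs_of B' (ext_B Q)) (twist M Q)"
  unfolding twist_def[abs_def]
  by (rule bilinear_map_compose[OF zip_bilinear(1)[OF pure_E[OF M] pure_B[OF Q]] D'.E_facts(4) left_module_hom_id])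
    (rule left_module_tensor[OF left_module_vs_of[OF D.E_facts(1) M] left_module_vs_of[OF D.B_facts(1) Q]])

text \<open>
  The element \<open>\<rho>'(x f(e))\<close> is the product of \<open>\<rho>'(x)\<close> and \<open>(f \<otimes> \<phi>)(\<rho>(e))\<close>, and in each factor \<open>f\<close> and \<open>\<phi>\<close>
  pass through the tensor sign to become the actions of \<open>E\<close> on \<open>M\<close> and of \<open>B\<close> on \<open>Q\<close>.
\<close>

lemma twist_balanced:
  assumes M: "left_module E M" and Q: "left_module B Q"
    and x: "x \<in> carrier E'" and e: "e \<in> carrier E" and t: "t \<in> carrier (vs_of E M \<boxtimes> vs_of B Q)"
  shows "twist M Q (x \<otimes>\<^bsub>E'\<^esub> f e) t = twist M Q x (e \<odot>\<^bsub>hopf_tensor K B E M Q\<^esub> t)"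
  unfolding twist_def coact_translate[OF x e] D.hopf_tensor_smult
  by (rule zip_assoc[OF translate_E_bilinear \<phi>D(5) pure_E[OF M] pure_B[OF Q]
        action_bilinear[OF D.E_facts(1) M] action_bilinear[OF D.B_facts(1) Q] pure_E[OF M] pure_B[OF Q]])
    (use x e t in \<open>simp_all add: X.ext_pure(4)[OF M] Y.ext_pure(4)[OF Q] D.coact_closed D'.coact_closed\<close>)

lemma twist_equivariant:
  assumes M: "left_module E M" and Q: "left_module B Q"
    and a: "a \<in> carrier E'" and x: "x \<in> carrier E'" and t: "t \<in> carrier (vs_of E M \<boxtimes> vs_of B Q)"
  shows "twist M Q (a \<otimes>\<^bsub>E'\<^esub> x) t = a \<odot>\<^bsub>hopf_tensor K B' E' (ext_E M) (ext_B Q)\<^esub> twist M Q x t"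
  unfolding twist_def D'.coact_mult[OF a x] D'.hopf_tensor_smult tensor_mult
  by (rule zip_assoc[OF assoc_algebraD(5)[OF D'.E_facts(1)] assoc_algebraD(5)[OF D'.B_facts(1)] pure_E[OF M] pure_B[OF Q]
        pure_E[OF M] pure_B[OF Q] action_bilinear[OF D'.E_facts(1) X.left_module_ext[OF M]]
        action_bilinear[OF D'.B_facts(1) Y.left_module_ext[OF Q]]])
    (use a x t in \<open>simp_all add: X.ext_smult_map(2)[OF M] Y.ext_smult_map(2)[OF Q] D'.coact_closed\<close>)

lemma
  assumes M: "left_module E M" and Q: "left_module B Q"
  shows alpha_additive: "additive_map (ext_E (hopf_tensor K B E M Q)) (hopf_tensor K B' E' (ext_E M) (ext_B Q))
      (alpha K B B' E E' \<phi> f M Q)"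
    and alpha_pure: "e' \<in> carrier E' \<Longrightarrow> t \<in> carrier (vs_of E M \<boxtimes> vs_of B Q) \<Longrightarrow>
      alpha K B B' E E' \<phi> f M Q (pure_tensor (ext_E (hopf_tensor K B E M Q)) e' t) = twist M Q e' t"
proof -
  let ?T = "hopf_tensor K B' E' (ext_E M) (ext_B Q)"
  \<comment> \<open>The definition of \<open>\<alpha>\<close> expands \<open>t\<close> outside and the coaction inside, the reverse of \<open>twist\<close>.\<close>
  define \<beta> where "\<beta> e' t = tzip (vs_of E' (ext_E M)) (vs_of B' (ext_B Q))
    (\<lambda>m x. pure_tensor (ext_E M) x m) (\<lambda>q y. pure_tensor (ext_B Q) y q) t (coact E' e')" for e' t
  have alpha: "alpha K B B' E E' \<phi> f M Q = tensor_lift ?T \<beta>"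
    unfolding alpha_def[abs_def] \<beta>_def[abs_def] tensor_zip_def Let_def
      pure_tensor_record_cong[OF D'.hopf_tensor_records(1)] tensor_lift_record_cong[OF D'.hopf_tensor_records] ..
  have \<beta>: "\<beta> e' t = twist M Q e' t" if "e' \<in> carrier E'" "t \<in> carrier (vs_of E M \<boxtimes> vs_of B Q)" for e' t
    unfolding \<beta>_def twist_def
    by (rule zip_swap[OF pure_E[OF M] pure_B[OF Q] D'.coact_closed[OF that(1)] that(2)])
  note H = D.left_module_hopf_tensor[OF M Q]
  note tw = bilinear_mapD(4-6)[OF twist_bilinear[OF M Q]]
  interpret E': ring E' by (rule D'.ring_E)
  interpret T: tensor_product E "right_via f E'" "hopf_tensor K B E M Q" "ext_E (hopf_tensor K B E M Q)"
    by (rule X.tensor_product_ext[OF H])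
  note closed = left_moduleD(3,8)[OF H, unfolded D.hopf_tensor_records]
  have bal: "balanced_map E (right_via f E') (hopf_tensor K B E M Q) ?T \<beta>"
    by (rule balanced_mapI)
      (simp_all add: D.hopf_tensor_records D'.hopf_tensor_records \<beta> tw X.f_closed closed twist_balanced[OF M Q])
  have ab: "abelian_group ?T"
    by (rule left_moduleD(2)[OF D'.left_module_hopf_tensor[OF X.left_module_ext[OF M] Y.left_module_ext[OF Q]]])
  show "additive_map (ext_E (hopf_tensor K B E M Q)) ?T (alpha K B B' E E' \<phi> f M Q)"
    unfolding alpha by (rule T.tensor_lift_additive[OF ab bal])
  show "alpha K B B' E E' \<phi> f M Q (pure_tensor (ext_E (hopf_tensor K B E M Q)) e' t) = twist M Q e' t"
    if "e' \<in> carrier E'" "t \<in> carrier (vs_of E M \<boxtimes> vs_of B Q)"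
    unfolding alpha using that T.tensor_lift_pure[OF ab bal, of e' t] by (simp add: \<beta> D.hopf_tensor_records)
qed

lemma alpha_hom:
  assumes M: "left_module E M" and Q: "left_module B Q"
  shows "left_module_hom E' (ext_E (hopf_tensor K B E M Q)) (hopf_tensor K B' E' (ext_E M) (ext_B Q))
      (alpha K B B' E E' \<phi> f M Q)"
proof -
  note H = D.left_module_hopf_tensor[OF M Q]
    and H' = D'.left_module_hopf_tensor[OF X.left_module_ext[OF M] Y.left_module_ext[OF Q]]
  note A = additive_map_closed[OF alpha_additive[OF M Q]] additive_map_add[OF alpha_additive[OF M Q]]
  interpret E': ring E' by (rule D'.ring_E)
  show ?thesis
  proof (rule left_module_homI[OF X.left_module_ext[OF H] H' alpha_additive[OF M Q]])
    fix a z assume a: "a \<in> carrier E'" and z: "z \<in> carrier (ext_E (hopf_tensor K B E M Q))"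
    note S = additive_map_closed[OF X.ext_smult_map(1)[OF H a]]
      additive_map_add[OF X.ext_smult_map(1)[OF H a]] X.ext_smult_map(2)[OF H a]
    show "alpha K B B' E E' \<phi> f M Q (a \<odot>\<^bsub>ext_E (hopf_tensor K B E M Q)\<^esub> z) =
        a \<odot>\<^bsub>hopf_tensor K B' E' (ext_E M) (ext_B Q)\<^esub> alpha K B B' E E' \<phi> f M Q z"
      using H z
    proof (induction rule: X.ext_induct)
      case (pure x t)
      then show ?case
        using a by (simp add: S(3) alpha_pure[OF M Q] twist_equivariant[OF M Q] D.hopf_tensor_records)
    next
      case (add s t)
      then show ?case using a by (simp add: S(1,2) A left_moduleD(5)[OF H'])
    qed
  qed
qed

lemma alpha_B_eq: "alpha_B K B B' E E' \<phi> f M =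
    (\<lambda>z. tensor_map (vs_of E' (ext_E M) \<boxtimes> vs_of B' (regular B')) (\<lambda>x. x) (unitor B' \<phi>)
      (alpha K B B' E E' \<phi> f M (regular B) z))"
  unfolding alpha_B_def[abs_def] tensor_map_record_cong[OF D'.hopf_G_records]
    tensor_map_record_cong[OF D'.tensor_vs_of_regular] ..

lemma alpha_B_hom:
  assumes M: "left_module E M"
  shows "left_module_hom E' (ext_E (hopf_G K B E M)) (hopf_G K B' E' (ext_E M)) (alpha_B K B B' E E' \<phi> f M)"
  unfolding alpha_B_eq hopf_G_def
  by (rule left_module_hom_compose[OF D'.hopf_tensor_map_hom[OF left_module_hom_id unitor_hom]
        alpha_hom[OF M left_module_regular[OF D.ring_B]]])
    (rule X.left_module_ext[OF M])

text \<open>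
  The map \<open>(x \<otimes> y, m \<otimes> b) \<mapsto> (x \<otimes> m) \<otimes> y \<phi>(b)\<close>.
\<close>

abbreviation "pure_translate M \<equiv> tzip (vs_of E' (ext_E M)) B' (pure_tensor (ext_E M)) translate"

lemma alpha_B_pure:
  assumes M: "left_module E M" and e': "e' \<in> carrier E'" and t: "t \<in> carrier (vs_of E M \<boxtimes> B)"
  shows "alpha_B K B B' E E' \<phi> f M (pure_tensor (ext_E (hopf_G K B E M)) e' t) = pure_translate M (coact E' e') t"
proof -
  note R = left_module_regular[OF D.ring_B]
  note VEM = left_module_vs_of[OF D'.E_facts(1) X.left_module_ext[OF M]] and VM = left_module_vs_of[OF D.E_facts(1) M]
  have U: "linear (vs_of B' (ext_B (regular B))) B' (unitor B' \<phi>)"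
    using left_module_hom_compose[OF D'.vs_of_regular_linear vs_of_linear[OF D'.B_facts(1) unitor_hom]] .
  have "alpha_B K B B' E E' \<phi> f M (pure_tensor (ext_E (hopf_G K B E M)) e' t) =
      tensor_map (vs_of E' (ext_E M) \<boxtimes> B') (\<lambda>x. x) (unitor B' \<phi>) (twist M (regular B) e' t)"
    using t e' alpha_pure[OF M R, of e' t]
    by (simp add: alpha_B_eq hopf_G_def D.tensor_vs_of_regular tensor_map_record_cong[OF D'.tensor_vs_of_regular])
  also have "\<dots> = pure_translate M (tensor_map (E' \<boxtimes> B') (\<lambda>x. x) (\<lambda>x. x) (coact E' e'))
      (tensor_map (vs_of E M \<boxtimes> B) (\<lambda>x. x) (\<lambda>x. x) t)"
    unfolding twist_def
    by (rule zip_map[OF pure_E[OF M] pure_B[OF R] pure_E[OF M] \<phi>D(5) left_module_hom_id[OF D'.E_facts(3)]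
          left_module_hom_id[OF VM] left_module_hom_id[OF VEM] left_module_hom_id[OF D'.B_facts(4)]
          D.vs_of_regular_linear U])
      (use e' t in \<open>simp_all add: unitor_pure D'.coact_closed D.tensor_vs_of_regular\<close>)
  also have "\<dots> = pure_translate M (coact E' e') t"
    by (simp add: tensor_map_id D'.E_facts(3) D'.B_facts(4) D'.coact_closed[OF e'] VM D.B_facts(4) t)
  finally show ?thesis .
qed

lemma hopf_ext_eqI:
  assumes M: "left_module E M"
    and g: "additive_map (ext_E (hopf_G K B E M)) A g" and h: "additive_map (ext_E (hopf_G K B E M)) A h"
    and eq: "\<And>e' t. e' \<in> carrier E' \<Longrightarrow> t \<in> carrier (vs_of E M \<boxtimes> B) \<Longrightarrow>
      g (pure_tensor (ext_E (hopf_G K B E M)) e' t) = h (pure_tensor (ext_E (hopf_G K B E M)) e' t)"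
    and z: "z \<in> carrier (ext_E (hopf_G K B E M))"
  shows "g z = h z"
  by (rule tensor_product.tensor_ext[OF X.tensor_product_ext[OF D.left_module_hopf_G[OF M]] g h _ z])
    (simp add: eq D.hopf_G_records)

lemma alpha_B_natural:
  assumes h: "left_module_hom E M N h" and z: "z \<in> carrier (ext_E (hopf_G K B E M))"
  shows "alpha_B K B B' E E' \<phi> f N
      (ext_scalars_map E E' f (hopf_G K B E N) (hopf_G_map K B E N h) z) =
    hopf_G_map K B' E' (ext_E N) (ext_scalars_map E E' f N h) (alpha_B K B B' E E' \<phi> f M z)"
proof (rule hopf_ext_eqI[OF _ _ _ _ z])
  note H = left_module_homD[OF h]
  note Gh = D.hopf_G_map_hom[OF h] and fh = X.ext_scalars_map_hom[OF h]
  note fGh = X.ext_scalars_map_hom[OF Gh]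
  note hV = vs_of_linear[OF D.E_facts(1) h]
  note Th = tensor_map_linear[OF hV left_module_hom_id[OF D.B_facts(4)]]
  show "left_module E M" by (rule H)
  show "additive_map (ext_E (hopf_G K B E M)) (hopf_G K B' E' (ext_E N))
      (\<lambda>z. alpha_B K B B' E E' \<phi> f N (ext_scalars_map E E' f (hopf_G K B E N) (hopf_G_map K B E N h) z))"
    by (rule additive_map_compose[OF alpha_B_hom[OF H(2), THEN left_module_homD(3)] fGh(1)[THEN left_module_homD(3)]])
  show "additive_map (ext_E (hopf_G K B E M)) (hopf_G K B' E' (ext_E N))
      (\<lambda>z. hopf_G_map K B' E' (ext_E N) (ext_scalars_map E E' f N h) (alpha_B K B B' E E' \<phi> f M z))"
    by (rule additive_map_compose[OF D'.hopf_G_map_hom[OF fh(1), THEN left_module_homD(3)]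
          alpha_B_hom[OF H(1), THEN left_module_homD(3)]])
  fix e' t assume e': "e' \<in> carrier E'" and t: "t \<in> carrier (vs_of E M \<boxtimes> B)"
  have "tensor_map (vs_of E' (ext_E N) \<boxtimes> B') (ext_scalars_map E E' f N h) (\<lambda>y. y)
      (pure_translate M (coact E' e') t) =
    pure_translate N (tensor_map (E' \<boxtimes> B') (\<lambda>x. x) (\<lambda>x. x) (coact E' e'))
      (tensor_map (vs_of E N \<boxtimes> B) h (\<lambda>x. x) t)"
    by (rule zip_map[OF pure_E[OF H(1)] \<phi>D(5) pure_E[OF H(2)] \<phi>D(5) left_module_hom_id[OF D'.E_facts(3)]
          hV vs_of_linear[OF D'.E_facts(1) fh(1)] left_module_hom_id[OF D'.B_facts(4)] left_module_hom_id[OF D.B_facts(4)]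
          left_module_hom_id[OF D'.B_facts(4)]])
      (use e' t in \<open>simp_all add: fh(2) D'.coact_closed\<close>)
  then show "alpha_B K B B' E E' \<phi> f N (ext_scalars_map E E' f (hopf_G K B E N) (hopf_G_map K B E N h)
      (pure_tensor (ext_E (hopf_G K B E M)) e' t)) =
    hopf_G_map K B' E' (ext_E N) (ext_scalars_map E E' f N h)
      (alpha_B K B B' E E' \<phi> f M (pure_tensor (ext_E (hopf_G K B E M)) e' t))"
    using e' t left_module_homD(4)[OF Th(1) t]
    by (simp add: fGh(2)[unfolded D.hopf_G_map_eq] D.hopf_G_records alpha_B_pure[OF H(1)] alpha_B_pure[OF H(2)] D.hopf_G_map_eq D'.hopf_G_map_eq
        tensor_map_id D'.E_facts(3) D'.B_facts(4) D'.coact_closed)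
qed

lemma alpha_B_formula:
  assumes M: "left_module E M" and e': "e' \<in> carrier E'" and m: "m \<in> carrier M" and b: "b \<in> carrier B"
    and x: "x \<in> {..<n :: nat} \<rightarrow> carrier E'" and y: "y \<in> {..<n} \<rightarrow> carrier B'"
    and coact: "coact E' e' = (\<Oplus>\<^bsub>E' \<boxtimes> B'\<^esub>i \<in> {..<n}. pure_tensor (E' \<boxtimes> B') (x i) (y i))"
  shows "alpha_B K B B' E E' \<phi> f M
      (pure_tensor (ext_E (hopf_G K B E M)) e' (pure_tensor (hopf_G K B E M) m b)) =
    (\<Oplus>\<^bsub>hopf_G K B' E' (ext_E M)\<^esub>i \<in> {..<n}.
      pure_tensor (hopf_G K B' E' (ext_E M)) (pure_tensor (ext_E M) (x i) m) (y i \<otimes>\<^bsub>B'\<^esub> \<phi> b))"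
proof -
  note VM = left_module_vs_of[OF D.E_facts(1) M]
  note G = D'.left_module_hopf_G[OF X.left_module_ext[OF M]]
  note Z = zip_bilinear[OF pure_E[OF M] \<phi>D(5)]
  have mb: "pure_tensor (vs_of E M \<boxtimes> B) m b \<in> carrier (vs_of E M \<boxtimes> B)"
    using m b by (simp add: pure_simps(1) VM D.B_facts(4))
  have add: "additive_map (E' \<boxtimes> B') (hopf_G K B' E' (ext_E M))
      (\<lambda>s. pure_translate M s (pure_tensor (vs_of E M \<boxtimes> B) m b))"
    using bilinear_mapD(4,5)[OF Z(1)] mb by (auto intro!: additive_mapI simp: D'.hopf_G_records)
  have "(\<lambda>i. pure_tensor (E' \<boxtimes> B') (x i) (y i)) \<in> {..<n} \<rightarrow> carrier (E' \<boxtimes> B')"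
    using x y by (auto simp: pure_simps(1) D'.E_facts(3) D'.B_facts(4) Pi_iff)
  from additive_map_finsum[OF add abelian_group_tensor[OF D'.E_facts(3) D'.B_facts(4)] left_moduleD(2)[OF G] this]
  have "pure_translate M (coact E' e') (pure_tensor (vs_of E M \<boxtimes> B) m b) =
    (\<Oplus>\<^bsub>hopf_G K B' E' (ext_E M)\<^esub>i \<in> {..<n}.
      pure_translate M (pure_tensor (E' \<boxtimes> B') (x i) (y i)) (pure_tensor (vs_of E M \<boxtimes> B) m b))"
    by (simp add: coact)
  also have "\<dots> = (\<Oplus>\<^bsub>hopf_G K B' E' (ext_E M)\<^esub>i \<in> {..<n}.
      pure_tensor (hopf_G K B' E' (ext_E M)) (pure_tensor (ext_E M) (x i) m) (y i \<otimes>\<^bsub>B'\<^esub> \<phi> b))"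
  proof (rule abelian_monoid.finsum_cong')
    have val: "pure_translate M (pure_tensor (E' \<boxtimes> B') (x i) (y i)) (pure_tensor (vs_of E M \<boxtimes> B) m b) =
      pure_tensor (hopf_G K B' E' (ext_E M)) (pure_tensor (ext_E M) (x i) m) (y i \<otimes>\<^bsub>B'\<^esub> \<phi> b)" if "i < n" for i
      using that x y m b by (simp add: Z(2) D'.hopf_G_pure Pi_iff)
    then show "pure_translate M (pure_tensor (E' \<boxtimes> B') (x i) (y i)) (pure_tensor (vs_of E M \<boxtimes> B) m b) =
      pure_tensor (hopf_G K B' E' (ext_E M)) (pure_tensor (ext_E M) (x i) m) (y i \<otimes>\<^bsub>B'\<^esub> \<phi> b)"
      if "i \<in> {..<n}" for i
      using that by simp
    show "(\<lambda>i. pure_tensor (hopf_G K B' E' (ext_E M)) (pure_tensor (ext_E M) (x i) m) (y i \<otimes>\<^bsub>B'\<^esub> \<phi> b))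
      \<in> {..<n} \<rightarrow> carrier (hopf_G K B' E' (ext_E M))"
      using additive_map_closed[OF add] x y by (auto simp: Pi_iff pure_simps(1) D'.E_facts(3) D'.B_facts(4) simp flip: val)
  qed (use left_moduleD(2)[OF G] in \<open>auto simp: abelian_group_def\<close>)
  finally show ?thesis
    using alpha_B_pure[OF M e' mb] by (simp add: D.hopf_G_pure)
qed

lemma alpha_B_delta:
  assumes M: "left_module E M" and z: "z \<in> carrier (ext_E (hopf_G K B E M))"
  shows "hopf_delta K B' E' (ext_E M) (alpha_B K B B' E E' \<phi> f M z) =
    hopf_G_map K B' E' (hopf_G K B' E' (ext_E M)) (alpha_B K B B' E E' \<phi> f M)
      (alpha_B K B B' E E' \<phi> f (hopf_G K B E M)
        (ext_scalars_map E E' f (hopf_G K B E (hopf_G K B E M)) (hopf_delta K B E M) z))"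
proof (rule hopf_ext_eqI[OF M _ _ _ z])
  note GM = D.left_module_hopf_G[OF M] and EM = X.left_module_ext[OF M]
  note VM = left_module_vs_of[OF D.E_facts(1) M]
  note \<delta> = D.hopf_delta_hom[OF M] and \<delta>' = D'.hopf_delta_hom[OF EM]
  note \<alpha> = alpha_B_hom[OF M]
  note f\<delta> = X.ext_scalars_map_hom[OF \<delta>]
  note Z = zip_bilinear[OF pure_E[OF M] \<phi>D(5)]
  note LMB = left_module_tensor[OF VM D.B_facts(4)]
  show "additive_map (ext_E (hopf_G K B E M)) (hopf_G K B' E' (hopf_G K B' E' (ext_E M)))
      (\<lambda>z. hopf_delta K B' E' (ext_E M) (alpha_B K B B' E E' \<phi> f M z))"
    by (rule additive_map_compose[OF left_module_homD(3)[OF \<delta>'] left_module_homD(3)[OF \<alpha>]])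
  show "additive_map (ext_E (hopf_G K B E M)) (hopf_G K B' E' (hopf_G K B' E' (ext_E M)))
    (\<lambda>z. hopf_G_map K B' E' (hopf_G K B' E' (ext_E M)) (alpha_B K B B' E E' \<phi> f M)
      (alpha_B K B B' E E' \<phi> f (hopf_G K B E M)
        (ext_scalars_map E E' f (hopf_G K B E (hopf_G K B E M)) (hopf_delta K B E M) z)))"
    by (rule additive_map_compose[OF left_module_homD(3)[OF D'.hopf_G_map_hom[OF \<alpha>]]
          additive_map_compose[OF left_module_homD(3)[OF alpha_B_hom[OF GM]] left_module_homD(3)[OF f\<delta>(1)]]])
  fix e' t assume e': "e' \<in> carrier E'" and t: "t \<in> carrier (vs_of E M \<boxtimes> B)"
  have \<delta>t: "hopf_delta K B E M t \<in> carrier (vs_of E (hopf_G K B E M) \<boxtimes> B)"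
    using left_module_homD(4)[OF \<delta>, of t] t by (simp add: D.hopf_G_records)
  \<comment> \<open>The value of \<open>\<alpha>\<close> at \<open>x \<otimes> t\<close>, so that applying \<open>\<alpha>\<close> to the first factor of a zip replaces \<open>x \<otimes> t\<close> by \<open>q x t\<close>.\<close>
  define q where "q x t = pure_translate M (coact E' x) t" for x t
  have q: "bilinear E' (vs_of E M \<boxtimes> B) (vs_of E' (ext_E M) \<boxtimes> B') q"
    unfolding q_def[abs_def] by (rule bilinear_map_compose[OF Z(1) D'.E_facts(4) left_module_hom_id[OF LMB]])
  have \<alpha>V: "linear (vs_of E' (ext_E (hopf_G K B E M))) (vs_of E' (ext_E M) \<boxtimes> B') (alpha_B K B B' E E' \<phi> f M)"
    by (rule left_module_hom_compose[OF D'.vs_of_hopf_G_linear[OF EM] vs_of_linear[OF D'.E_facts(1) \<alpha>]])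
  have "tensor_map ((vs_of E' (ext_E M) \<boxtimes> B') \<boxtimes> B') (alpha_B K B B' E E' \<phi> f M) (\<lambda>y. y)
      (pure_translate (hopf_G K B E M) (coact E' e') (hopf_delta K B E M t)) =
    tzip (vs_of E' (ext_E M) \<boxtimes> B') B' q translate
      (tensor_map (E' \<boxtimes> B') (\<lambda>x. x) (\<lambda>x. x) (coact E' e'))
      (tensor_map ((vs_of E M \<boxtimes> B) \<boxtimes> B) (\<lambda>x. x) (\<lambda>x. x) (hopf_delta K B E M t))"
    by (rule zip_map[OF pure_E[OF GM] \<phi>D(5) q \<phi>D(5) left_module_hom_id[OF D'.E_facts(3)]
          D.vs_of_hopf_G_linear[OF M] \<alpha>V left_module_hom_id[OF D'.B_facts(4)] left_module_hom_id[OF D.B_facts(4)]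
          left_module_hom_id[OF D'.B_facts(4)]])
      (use e' \<delta>t in \<open>simp_all add: alpha_B_pure[OF M] q_def D'.coact_closed D.hopf_G_records\<close>)
  also have "\<dots> = tzip (vs_of E' (ext_E M) \<boxtimes> B') B' q translate (coact E' e') (hopf_delta K B E M t)"
    using \<delta>t by (simp add: tensor_map_id D'.E_facts(3) D'.B_facts(4) D'.coact_closed[OF e'] LMB D.B_facts(4) D.tensor_vs_of_hopf_G[OF M])
  also have "\<dots> = hopf_delta K B' E' (ext_E M) (pure_translate M (coact E' e') t)"
    using coaction_comult[OF D.bialg D'.bialg \<phi> D'.comod pure_E[OF M] e' t]
    by (simp add: D.hopf_delta_eq[OF M] D'.hopf_delta_eq[OF EM] q_def[abs_def])
  finally show "hopf_delta K B' E' (ext_E M)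
      (alpha_B K B B' E E' \<phi> f M (pure_tensor (ext_E (hopf_G K B E M)) e' t)) =
    hopf_G_map K B' E' (hopf_G K B' E' (ext_E M)) (alpha_B K B B' E E' \<phi> f M)
      (alpha_B K B B' E E' \<phi> f (hopf_G K B E M)
        (ext_scalars_map E E' f (hopf_G K B E (hopf_G K B E M)) (hopf_delta K B E M)
          (pure_tensor (ext_E (hopf_G K B E M)) e' t)))"
    using e' t \<delta>t
    by (simp add: f\<delta>(2) D.hopf_G_records alpha_B_pure[OF M] alpha_B_pure[OF GM] D'.hopf_G_map_eq
        tensor_map_record_cong[OF D'.tensor_vs_of_hopf_G[OF EM]])
qed

lemma alpha_B_epsilon:
  assumes M: "left_module E M" and z: "z \<in> carrier (ext_E (hopf_G K B E M))"
  shows "hopf_epsilon B' E' (ext_E M) (alpha_B K B B' E E' \<phi> f M z) =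
    ext_scalars_map E E' f M (hopf_epsilon B E M) z"
proof (rule hopf_ext_eqI[OF M _ _ _ z])
  note EM = X.left_module_ext[OF M]
  note \<epsilon> = D.hopf_epsilon_hom[OF M] and \<epsilon>' = D'.hopf_epsilon_hom[OF EM]
  note f\<epsilon> = X.ext_scalars_map_hom[OF \<epsilon>]
  show "additive_map (ext_E (hopf_G K B E M)) (ext_E M)
      (\<lambda>z. hopf_epsilon B' E' (ext_E M) (alpha_B K B B' E E' \<phi> f M z))"
    by (rule additive_map_compose[OF left_module_homD(3)[OF \<epsilon>'] left_module_homD(3)[OF alpha_B_hom[OF M]]])
  show "additive_map (ext_E (hopf_G K B E M)) (ext_E M) (ext_scalars_map E E' f M (hopf_epsilon B E M))"
    by (rule left_module_homD(3)[OF f\<epsilon>(1)])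
  show "hopf_epsilon B' E' (ext_E M) (alpha_B K B B' E E' \<phi> f M (pure_tensor (ext_E (hopf_G K B E M)) e' t)) =
      ext_scalars_map E E' f M (hopf_epsilon B E M) (pure_tensor (ext_E (hopf_G K B E M)) e' t)"
    if e': "e' \<in> carrier E'" and t: "t \<in> carrier (vs_of E M \<boxtimes> B)" for e' t
    using e' t coaction_counit[OF D.bialg D'.bialg \<phi> D'.comod pure_E[OF M] e' t]
    by (simp add: alpha_B_pure[OF M] f\<epsilon>(2)[unfolded D.hopf_epsilon_eq] D.hopf_G_records D.hopf_epsilon_eq D'.hopf_epsilon_eq)
qed

end

theorem mainTheorem2:
  fixes K :: "'k ring"
    and B :: "('k, 'b) bialg" and B' :: "('k, 'c) bialg"
    and E :: "('k, 'b, 'e) comod_alg" and E' :: "('k, 'c, 'd) comod_alg"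
    and \<phi> :: "'b \<Rightarrow> 'c" and f :: "'e \<Rightarrow> 'd"
  assumes "field K"
    and "bialgebra K B" and "bialgebra K B'" and "\<phi> \<in> bialg_hom K B B'"
    and "comodule_algebra K B E" and "comodule_algebra K B' E'"
    and "f \<in> comod_alg_hom K \<phi> B' E E'"
  shows
    \<comment> \<open>the identification of the extension of scalars of B with B'\<close>
    "left_module_hom B' (ext_scalars B B' \<phi> (regular B)) (regular B') (unitor B' \<phi>) \<and>
     bij_betw (unitor B' \<phi>)
       (carrier (ext_scalars B B' \<phi> (regular B))) (carrier B') \<and>
     \<comment> \<open>components\<close>
     (\<forall>M :: ('e, 'm) module. left_module E M \<longrightarrow>
       left_module_hom E' (ext_scalars E E' f (hopf_G K B E M))
         (hopf_G K B' E' (ext_scalars E E' f M)) (alpha_B K B B' E E' \<phi> f M)) \<and>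
     \<comment> \<open>naturality\<close>
     (\<forall>(M :: ('e, 'm) module) (N :: ('e, 'n) module) h. left_module_hom E M N h \<longrightarrow>
       (\<forall>z \<in> carrier (ext_scalars E E' f (hopf_G K B E M)).
         alpha_B K B B' E E' \<phi> f N
           (ext_scalars_map E E' f (hopf_G K B E N) (hopf_G_map K B E N h) z) =
         hopf_G_map K B' E' (ext_scalars E E' f N) (ext_scalars_map E E' f N h)
           (alpha_B K B B' E E' \<phi> f M z))) \<and>
     \<comment> \<open>the formula, for every expansion of the coaction of e' as a sum of pure tensors\<close>
     (\<forall>(M :: ('e, 'm) module) e' m b (n :: nat) x y.
       left_module E M \<and> e' \<in> carrier E' \<and> m \<in> carrier M \<and> b \<in> carrier B \<and>
       x \<in> {..<n} \<rightarrow> carrier E' \<and> y \<in> {..<n} \<rightarrow> carrier B' \<and>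
       coact E' e' = (\<Oplus>\<^bsub>tensor_K K E' B'\<^esub>i \<in> {..<n}. pure_tensor (tensor_K K E' B') (x i) (y i)) \<longrightarrow>
       alpha_B K B B' E E' \<phi> f M
         (pure_tensor (ext_scalars E E' f (hopf_G K B E M)) e' (pure_tensor (hopf_G K B E M) m b)) =
       (\<Oplus>\<^bsub>hopf_G K B' E' (ext_scalars E E' f M)\<^esub>i \<in> {..<n}.
         pure_tensor (hopf_G K B' E' (ext_scalars E E' f M))
           (pure_tensor (ext_scalars E E' f M) (x i) m) (y i \<otimes>\<^bsub>B'\<^esub> \<phi> b))) \<and>
     \<comment> \<open>compatibility with the comultiplications\<close>
     (\<forall>M :: ('e, 'm) module. left_module E M \<longrightarrow>
       (\<forall>z \<in> carrier (ext_scalars E E' f (hopf_G K B E M)).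
         hopf_delta K B' E' (ext_scalars E E' f M) (alpha_B K B B' E E' \<phi> f M z) =
         hopf_G_map K B' E' (hopf_G K B' E' (ext_scalars E E' f M)) (alpha_B K B B' E E' \<phi> f M)
           (alpha_B K B B' E E' \<phi> f (hopf_G K B E M)
             (ext_scalars_map E E' f (hopf_G K B E (hopf_G K B E M)) (hopf_delta K B E M) z)))) \<and>
     \<comment> \<open>compatibility with the counits\<close>
     (\<forall>M :: ('e, 'm) module. left_module E M \<longrightarrow>
       (\<forall>z \<in> carrier (ext_scalars E E' f (hopf_G K B E M)).
         hopf_epsilon B' E' (ext_scalars E E' f M) (alpha_B K B B' E E' \<phi> f M z) =
         ext_scalars_map E E' f M (hopf_epsilon B E M) z))"
proof -
  interpret comm_scalars K
    by (rule assoc_algebraD(1)[OF bialgebraD(1)[OF assms(2)]])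
  interpret comodule_algebra_map K B B' E E' \<phi> f
    by (intro comodule_algebra_map.intro comodule_algebra_over.intro comodule_algebra_over_axioms.intro
        comodule_algebra_map_axioms.intro comm_scalars_axioms assms)
  show ?thesis
    by (intro conjI allI impI ballI unitor_hom unitor_bij alpha_B_hom alpha_B_natural alpha_B_delta
        alpha_B_epsilon; (elim conjE)?; (rule alpha_B_formula)?; assumption)
qed

end
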